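(* Let $d\ge1$, $p\in(2,\infty)$, $r\in\left(\frac{dp}{p-2},\infty\right)$, $\sigma>0$, $W>0$, $\psi>0$, $C_{\mathrm{top}}>0$, let $T$ be a positive integer, $\Delta t=1/T$ and $\tau=\sigma\sqrt{\Delta t}$. Let $f_0\in L^{r^*}(\mathbb R^d)$ and let $U:C^1_0\to\mathbb R$ be continuously Fréchet differentiable and bounded from below. Let $$\mathcal L(f,u,v,\lambda)=\Delta t\sum_{k=1}^{T-1}\left(C_{\mathrm{top}}\|u_k\|_{L^r}^p+\|v_k\|_V^p\right)+U(f_T)+\sum_{k=2}^T\left(\lambda_k\mid f_k-G(f_{k-1},u_{k-1},v_{k-1})\right)+\left(\lambda_1\mid f_1-\eta_\tau\star f_0\right)$$ for $f=(f_1,\dots,f_T)\in (C^1_0)^T$, $u=(u_1,\dots,u_{T-1})\in L^r(\mathbb R^d)^{T-1}$, $v=(v_1,\dots,v_{T-1})\in V^{T-1}$, $\lambda=(\lambda_1,\dots,\lambda_T)\in((C^1_0)^* )^T$. Then every critical point $(f,u,v,\lambda)$ of $\mathcal L$ satisfies $$\lambda_T=dU(f_T),\qquad \lambda_k=-\partial_fG(f_k,u_k,v_k)^*\lambda_{k+1},\quad k=1,\dots,T-1.\qquad(\dagger)$$ Moreover, for $(u,v)\in L^r(\mathbb R^d)^{T-1}\times V^{T-1}$ let $f=f(f_0,u,v)$ be defined by $f_1=\eta_\tau\star f_0$, $f_{k+1}=G(f_k,u_k,v_k)$ for $k=1,\dots,T-1$, let $\lambda$ be given by $(\dagger)$, and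 let $$\tilde E(u,v)=\Delta t\sum_{k=1}^{T-1}\left(C_{\mathrm{top}}\|u_k\|_{L^r}^p+\|v_k\|_V^p\right)+U(f_T).$$ Then, for $k=1,\dots,T-1$, $$\partial_{u_k}\tilde E(u,v)=\partial_{u_k}\mathcal L(f,u,v,\lambda)=\Delta t\,C_{\mathrm{top}}\,p\,\|u_k\|_{L^r}^{p-r}|u_k|^{r-1}\mathrm{sign}(u_k)-\partial_uG(f_k,u_k,v_k)^*\lambda_{k+1},$$ $$\partial_{v_k}\tilde E(u,v)=\partial_{v_k}\mathcal L(f,u,v,\lambda)=\Delta t\,p\,\|v_k\|_V^{p-2}v_k-\partial_vG(f_k,u_k,v_k)^*\lambda_{k+1}.$$
   Context: $r^*=r/(r-1)$. $C^1_0=C^1_0(\mathbb R^d)$ is the closure of the compactly supported functions in the Banach space of $C^1$ functions on $\mathbb R^d$ that are bounded with their first derivatives, with norm $\|h\|_{C^1}=\max_{|\alpha|\le1}\sup_x|\partial_\alpha h(x)|$. $(\lambda\mid h)$ is the pairing of a dual vector with a vector. $V$ is a fixed Hilbert space of vector fields on $\mathbb R^d$ continuously embedded in the space $C^1(\mathbb R^d,\mathbb R^d)$ of vector fields bounded with their first derivatives. $\eta_\tau(x)=\frac{\exp(-|x|^2/2\tau^2)}{(2\pi)^{d/2}\tau^d}$ and $\star$ is convolution. $I(\xi)=W\xi^2(\xi-1)^2(\xi-1/2)\mathbf 1_{[0,1]}(\xi)$, $\chi(z)=\sqrt{|z|^2+\psi^2}$ for $z\in\mathbb R^d$, and $G:C^1_0\times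 L^r(\mathbb R^d)\times V\to C^1_0$ is $$G(f',u',v')=\eta_\tau\star f'+\eta_\tau\star\left(\chi(\nabla f')u'-\nabla f'^Tv'+I(f')\right),$$ which is continuously Fréchet differentiable; $\partial_fG,\partial_uG,\partial_vG$ are its partial differentials, and $\partial_fG^*:(C^1_0)^*\to(C^1_0)^*$, $\partial_uG^*:(C^1_0)^*\to L^{r^*}$, $\partial_vG^*:(C^1_0)^*\to V^*$ their Banach-space adjoints. A critical point of $\mathcal L$ is a point where all its partial Fréchet derivatives vanish. The derivative with respect to $u_k$ is an element of $(L^r)^*=L^{r^*}$ (the term $\|u_k\|_{L^r}^{p-r}|u_k|^{r-1}\mathrm{sign}(u_k)$ is $0$ when $u_k=0$), and the derivative with respect to $v_k$ is an element of $V^*$, where $v_k\in V$ in the formula is identified with the functional $\langle v_k,\cdot\rangle_V$.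
   Formalization: The signs in (†) are corrected to λ_T = −dU(f_T) and λ_k = ∂_fG(f_k,u_k,v_k)^*λ_{k+1}, as the displayed Lagrangian forces; as printed (†) fails, e.g. for T=1, f_0=0, U(h)=exp(h(0)). *)

theory Defs
  imports "HOL-Analysis.Analysis"
begin

section \<open>The space of bounded functions of class C1 with bounded first derivatives\<close>

definition partial_deriv ::
  "'a::euclidean_space \<Rightarrow> ('a \<Rightarrow> 'b::real_normed_vector) \<Rightarrow> 'a \<Rightarrow> 'b" where
  "partial_deriv b h x = frechet_derivative h (at x) b"

definition gradient :: "('a::euclidean_space \<Rightarrow> real) \<Rightarrow> 'a \<Rightarrow> 'a" where
  "gradient h x = (\<Sum>b\<in>Basis. partial_deriv b h x *\<^sub>R b)"

definition bounded_C1 :: "('a::euclidean_space \<Rightarrow> 'b::real_normed_vector) set" where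
  "bounded_C1 = {h. (\<forall>x. h differentiable (at x)) \<and> bounded (range h) \<and>
     (\<forall>b\<in>Basis. continuous_on UNIV (partial_deriv b h) \<and> bounded (range (partial_deriv b h)))}"

lemma partial_deriv_add:
  assumes "g differentiable (at x)" "h differentiable (at x)"
  shows "partial_deriv b (\<lambda>x. g x + h x) x = partial_deriv b g x + partial_deriv b h x"
proof -
  have "((\<lambda>x. g x + h x) has_derivative
      (\<lambda>y. frechet_derivative g (at x) y + frechet_derivative h (at x) y)) (at x)"
    using assms by (intro has_derivative_add) (auto simp: frechet_derivative_works)
  from frechet_derivative_at[OF this] show ?thesis
    by (simp add: partial_deriv_def fun_eq_iff)
qed

lemma partial_deriv_scaleR:
  assumes "h differentiable (at x)"
  shows "partial_deriv b (\<lambda>x. c *\<^sub>R h x) x = c *\<^sub>R partial_deriv b h x"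
proof -
  have "((\<lambda>x. c *\<^sub>R h x) has_derivative (\<lambda>y. c *\<^sub>R frechet_derivative h (at x) y)) (at x)"
    using assms by (intro has_derivative_scaleR_right) (auto simp: frechet_derivative_works)
  from frechet_derivative_at[OF this] show ?thesis
    by (simp add: partial_deriv_def fun_eq_iff)
qed

lemma partial_deriv_const [simp]: "partial_deriv b (\<lambda>x. c) = (\<lambda>x. 0)"
  by (simp add: partial_deriv_def fun_eq_iff)

lemma bounded_C1_zero: "(\<lambda>x. 0) \<in> bounded_C1"
  by (auto simp: bounded_C1_def image_constant_conv)

lemma bounded_C1_add:
  assumes "g \<in> bounded_C1" "h \<in> bounded_C1"
  shows "(\<lambda>x. g x + h x) \<in> bounded_C1"
proof -
  have eq: "partial_deriv b (\<lambda>x. g x + h x) = (\<lambda>x. partial_deriv b g x + partial_deriv b h x)" for b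
    using assms by (auto simp: bounded_C1_def partial_deriv_add)
  show ?thesis
    using assms unfolding bounded_C1_def
    by (auto simp: eq intro!: continuous_on_add bounded_plus_comp)
qed

lemma bounded_C1_scaleR:
  assumes "h \<in> bounded_C1"
  shows "(\<lambda>x. c *\<^sub>R h x) \<in> bounded_C1"
proof -
  have eq: "partial_deriv b (\<lambda>x. c *\<^sub>R h x) = (\<lambda>x. c *\<^sub>R partial_deriv b h x)" for b
    using assms by (auto simp: bounded_C1_def partial_deriv_scaleR)
  show ?thesis
    using assms unfolding bounded_C1_def
    by (auto simp: eq intro!: continuous_intros bounded_scaleR_comp)
qed

typedef (overloaded) ('a, 'b) bC1 =
  "bounded_C1 :: ('a::euclidean_space \<Rightarrow> 'b::real_normed_vector) set"
  morphisms apply_bC1 bC1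
  using bounded_C1_zero by blast

lemma bC1_eqI: "(\<And>x. apply_bC1 g x = apply_bC1 h x) \<Longrightarrow> g = h"
  by (metis apply_bC1_inject ext)

instantiation bC1 :: (euclidean_space, real_normed_vector) real_vector
begin

definition "0 = bC1 (\<lambda>x. 0)"
definition "g + h = bC1 (\<lambda>x. apply_bC1 g x + apply_bC1 h x)"
definition "c *\<^sub>R h = bC1 (\<lambda>x. c *\<^sub>R apply_bC1 h x)"
definition "- h = (-1) *\<^sub>R (h :: ('a, 'b) bC1)"
definition "g - h = g + - (h :: ('a, 'b) bC1)"

lemma apply_bC1_zero [simp]: "apply_bC1 0 = (\<lambda>x. 0)"
  by (simp add: zero_bC1_def bC1_inverse bounded_C1_zero)

lemma apply_bC1_add [simp]: "apply_bC1 (g + h) = (\<lambda>x. apply_bC1 g x + apply_bC1 h x)"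
  by (simp add: plus_bC1_def bC1_inverse bounded_C1_add apply_bC1)

lemma apply_bC1_scaleR [simp]: "apply_bC1 (c *\<^sub>R h) = (\<lambda>x. c *\<^sub>R apply_bC1 h x)"
  by (simp add: scaleR_bC1_def bC1_inverse bounded_C1_scaleR apply_bC1)

lemma apply_bC1_uminus [simp]: "apply_bC1 (- h) = (\<lambda>x. - apply_bC1 h x)"
  by (simp add: uminus_bC1_def)

lemma apply_bC1_diff [simp]: "apply_bC1 (g - h) = (\<lambda>x. apply_bC1 g x - apply_bC1 h x)"
  by (simp add: minus_bC1_def)

instance
  by standard (auto intro!: bC1_eqI simp: algebra_simps)

end

lemma bC1_differentiable: "apply_bC1 h differentiable (at x)"
  using apply_bC1[of h] by (auto simp: bounded_C1_def)

lemma bC1_bounded: "bounded (range (apply_bC1 h))"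
  using apply_bC1[of h] by (auto simp: bounded_C1_def)

lemma bC1_partial_bounded: "b \<in> Basis \<Longrightarrow> bounded (range (partial_deriv b (apply_bC1 h)))"
  using apply_bC1[of h] by (auto simp: bounded_C1_def)

lemma SUP_norm_le_iff:
  assumes "bounded (range k)"
  shows "(SUP x. norm (k x)) \<le> c \<longleftrightarrow> (\<forall>x. norm (k x) \<le> (c::real))"
  using assms by (subst cSUP_le_iff) (auto simp: bounded_iff bdd_above_def)

instantiation bC1 :: (euclidean_space, real_normed_vector) real_normed_vector
begin

definition norm_bC1 :: "('a, 'b) bC1 \<Rightarrow> real" where
  "norm_bC1 h = Max (insert (SUP x. norm (apply_bC1 h x))
     ((\<lambda>b. SUP x. norm (partial_deriv b (apply_bC1 h) x)) ` Basis))"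

definition "dist g h = norm (g - h :: ('a, 'b) bC1)"
definition "sgn h = inverse (norm h) *\<^sub>R (h :: ('a, 'b) bC1)"
definition [code del]:
  "(uniformity :: (('a, 'b) bC1 \<times> ('a, 'b) bC1) filter) =
     (INF e\<in>{0<..}. principal {(x, y). dist x y < e})"
definition [code del]:
  "open (S :: ('a, 'b) bC1 set) = (\<forall>x\<in>S. \<forall>\<^sub>F (x', y) in uniformity. x' = x \<longrightarrow> y \<in> S)"

lemma norm_bC1_le_iff:
  "norm h \<le> c \<longleftrightarrow> (\<forall>x. norm (apply_bC1 h x) \<le> c) \<and>
     (\<forall>b\<in>Basis. \<forall>x. norm (partial_deriv b (apply_bC1 h) x) \<le> c)"
  for h :: "('a, 'b) bC1"
  by (auto simp: norm_bC1_def SUP_norm_le_iff bC1_bounded bC1_partial_bounded)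

lemma norm_apply_bC1_le: "norm (apply_bC1 h x) \<le> norm (h :: ('a, 'b) bC1)"
  using norm_bC1_le_iff[of h "norm h"] by auto

lemma norm_partial_bC1_le:
  "b \<in> Basis \<Longrightarrow> norm (partial_deriv b (apply_bC1 h) x) \<le> norm (h :: ('a, 'b) bC1)"
  using norm_bC1_le_iff[of h "norm h"] by auto

instance
proof
  fix g h :: "('a, 'b) bC1" and c :: real
  show "dist g h = norm (g - h)" by (rule dist_bC1_def)
  show "sgn h = inverse (norm h) *\<^sub>R h" by (rule sgn_bC1_def)
  show "(uniformity :: (('a, 'b) bC1 \<times> ('a, 'b) bC1) filter) =
     (INF e\<in>{0<..}. principal {(x, y). dist x y < e})" by (rule uniformity_bC1_def)
  show "open S = (\<forall>x\<in>S. \<forall>\<^sub>F (x', y) in uniformity. x' = x \<longrightarrow> y \<in> S)"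
    for S :: "('a, 'b) bC1 set" by (rule open_bC1_def)
  have nonneg: "0 \<le> norm h" for h :: "('a, 'b) bC1"
    using norm_apply_bC1_le[of h 0] norm_ge_zero[of "apply_bC1 h 0"] by linarith
  show "norm h = 0 \<longleftrightarrow> h = 0"
  proof
    assume *: "norm h = 0"
    have "apply_bC1 h x = 0" for x
      using norm_apply_bC1_le[of h x] by (simp add: *)
    then show "h = 0" by (intro bC1_eqI) simp
  next
    assume "h = 0"
    then have "norm h \<le> 0" by (simp add: norm_bC1_le_iff)
    with nonneg[of h] show "norm h = 0" by linarith
  qed
  show "norm (g + h) \<le> norm g + norm h"
    unfolding norm_bC1_le_iff
    by (auto simp: partial_deriv_add bC1_differentiable intro!: order_trans[OF norm_triangle_ineq]
        add_mono norm_apply_bC1_le norm_partial_bC1_le)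
  have le: "norm (c *\<^sub>R h) \<le> \<bar>c\<bar> * norm h" for c and h :: "('a, 'b) bC1"
    unfolding norm_bC1_le_iff
    by (auto simp: partial_deriv_scaleR bC1_differentiable
        intro!: mult_left_mono norm_apply_bC1_le norm_partial_bC1_le)
  show "norm (c *\<^sub>R h) = \<bar>c\<bar> * norm h"
  proof (cases "c = 0")
    case True
    then have "norm (c *\<^sub>R h) \<le> 0" by (simp add: norm_bC1_le_iff)
    with nonneg[of "c *\<^sub>R h"] True show ?thesis by simp
  next
    case False
    have "\<bar>c\<bar> * norm h = \<bar>c\<bar> * norm (inverse c *\<^sub>R (c *\<^sub>R h))"
      using False by simp
    also have "\<dots> \<le> \<bar>c\<bar> * (\<bar>inverse c\<bar> * norm (c *\<^sub>R h))"
      by (intro mult_left_mono le) simp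
    also have "\<dots> = norm (c *\<^sub>R h)"
      using False by (simp add: field_simps)
    finally show ?thesis using le[of c h] by linarith
  qed
qed

end


section \<open>The closure of the compactly supported functions\<close>

definition compactly_supported :: "('a::euclidean_space, real) bC1 set" where
  "compactly_supported = {h. compact (closure {x. apply_bC1 h x \<noteq> 0})}"

lemma compactly_supported_subspace: "subspace compactly_supported"
proof (rule subspaceI)
  show "0 \<in> compactly_supported"
    by (simp add: compactly_supported_def)
next
  fix g h :: "('a, real) bC1"
  assume gh: "g \<in> compactly_supported" "h \<in> compactly_supported"
  have "{x. apply_bC1 g x + apply_bC1 h x \<noteq> 0}
      \<subseteq> {x. apply_bC1 g x \<noteq> 0} \<union> {x. apply_bC1 h x \<noteq> 0}" by auto
  then show "g + h \<in> compactly_supported"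
    using gh by (auto simp: compactly_supported_def intro: bounded_subset[OF iffD2[OF bounded_Un]])
next
  fix c :: real and h :: "('a, real) bC1"
  assume "h \<in> compactly_supported"
  then show "c *\<^sub>R h \<in> compactly_supported"
    by (cases "c = 0") (auto simp: compactly_supported_def)
qed

lemma subspace_closure_normed:
  fixes S :: "'b::real_normed_vector set"
  assumes "subspace S"
  shows "subspace (closure S)"
proof (rule subspaceI)
  show "0 \<in> closure S"
    using subspace_0[OF assms] closure_subset by blast
next
  fix x y assume "x \<in> closure S" "y \<in> closure S"
  then obtain f g where "\<And>n. f n \<in> S" "f \<longlonglongrightarrow> x" "\<And>n. g n \<in> S" "g \<longlonglongrightarrow> y"
    unfolding closure_sequential by blast
  then have "\<forall>n. f n + g n \<in> S" "(\<lambda>n. f n + g n) \<longlonglongrightarrow> x + y"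
    using subspace_add[OF assms] by (auto intro: tendsto_add)
  then show "x + y \<in> closure S"
    unfolding closure_sequential by (intro exI[of _ "\<lambda>n. f n + g n"] conjI)
next
  fix c x assume "x \<in> closure S"
  then obtain f where "\<And>n. f n \<in> S" "f \<longlonglongrightarrow> x"
    unfolding closure_sequential by blast
  then have "\<forall>n. c *\<^sub>R f n \<in> S" "(\<lambda>n. c *\<^sub>R f n) \<longlonglongrightarrow> c *\<^sub>R x"
    using subspace_scale[OF assms] by (auto intro: tendsto_scaleR tendsto_const)
  then show "c *\<^sub>R x \<in> closure S"
    unfolding closure_sequential by (intro exI[of _ "\<lambda>n. c *\<^sub>R f n"] conjI)
qed

typedef (overloaded) 'a C10 = "closure (compactly_supported :: ('a::euclidean_space, real) bC1 set)"
  morphisms bC1_of C10_of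
  using subspace_0[OF subspace_closure_normed[OF compactly_supported_subspace]] by blast

lemmas C10_subspace = subspace_closure_normed[OF compactly_supported_subspace]

instantiation C10 :: (euclidean_space) real_vector
begin

definition "0 = C10_of 0"
definition "f + g = C10_of (bC1_of f + bC1_of g)"
definition "c *\<^sub>R f = C10_of (c *\<^sub>R bC1_of f)"
definition "- f = C10_of (- bC1_of f)"
definition "f - g = C10_of (bC1_of f - bC1_of g)"

lemma bC1_of_zero [simp]: "bC1_of 0 = 0"
  by (simp add: zero_C10_def C10_of_inverse subspace_0[OF C10_subspace])

lemma bC1_of_add [simp]: "bC1_of (f + g) = bC1_of f + bC1_of g"
  by (simp add: plus_C10_def C10_of_inverse subspace_add[OF C10_subspace] bC1_of)

lemma bC1_of_scaleR [simp]: "bC1_of (c *\<^sub>R f) = c *\<^sub>R bC1_of f"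
  by (simp add: scaleR_C10_def C10_of_inverse subspace_scale[OF C10_subspace] bC1_of)

lemma bC1_of_uminus [simp]: "bC1_of (- f) = - bC1_of f"
  by (simp add: uminus_C10_def C10_of_inverse subspace_neg[OF C10_subspace] bC1_of)

lemma bC1_of_diff [simp]: "bC1_of (f - g) = bC1_of f - bC1_of g"
  by (simp add: minus_C10_def C10_of_inverse subspace_diff[OF C10_subspace] bC1_of)

instance
  by standard (simp_all add: bC1_of_inject[symmetric] scaleR_add_left scaleR_add_right)

end

instantiation C10 :: (euclidean_space) real_normed_vector
begin

definition "norm f = norm (bC1_of (f :: 'a C10))"
definition "dist f g = norm (f - g :: 'a C10)"
definition "sgn f = inverse (norm f) *\<^sub>R (f :: 'a C10)"
definition [code del]:
  "(uniformity :: ('a C10 \<times> 'a C10) filter) = (INF e\<in>{0<..}. principal {(x, y). dist x y < e})"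
definition [code del]:
  "open (S :: 'a C10 set) = (\<forall>x\<in>S. \<forall>\<^sub>F (x', y) in uniformity. x' = x \<longrightarrow> y \<in> S)"

instance
  by standard
    (auto simp: norm_C10_def dist_C10_def sgn_C10_def uniformity_C10_def open_C10_def
      bC1_of_inject[symmetric] norm_triangle_ineq)

end

definition C10_fun :: "'a::euclidean_space C10 \<Rightarrow> 'a \<Rightarrow> real" where
  "C10_fun f = apply_bC1 (bC1_of f)"

definition to_C10 :: "('a::euclidean_space \<Rightarrow> real) \<Rightarrow> 'a C10" where
  "to_C10 h = C10_of (bC1 h)"

lemma to_C10_C10_fun: "to_C10 (C10_fun f) = f"
  by (simp add: to_C10_def C10_fun_def apply_bC1_inverse bC1_of_inverse)

lemma C10_fun_to_C10:
  "h \<in> bounded_C1 \<Longrightarrow> bC1 h \<in> closure compactly_supported \<Longrightarrow> C10_fun (to_C10 h) = h"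
  by (simp add: to_C10_def C10_fun_def bC1_inverse C10_of_inverse)


section \<open>Lebesgue spaces\<close>

text \<open>
  The exponent is a real number, so the spaces are sets of functions with a seminorm instead of
  types.  Elements are functions and not equivalence classes; every class has a Borel measurable
  representative.
\<close>

definition Lr :: "real \<Rightarrow> ('a::euclidean_space \<Rightarrow> real) set" where
  "Lr r = {u \<in> borel_measurable lborel. integrable lborel (\<lambda>x. \<bar>u x\<bar> powr r)}"

definition Lr_norm :: "real \<Rightarrow> ('a::euclidean_space \<Rightarrow> real) \<Rightarrow> real" where
  "Lr_norm r u = (\<integral>x. \<bar>u x\<bar> powr r \<partial>lborel) powr (1 / r)"

definition conj_exponent :: "real \<Rightarrow> real" where
  "conj_exponent r = r / (r - 1)"

text \<open>The functional on \<open>Lr r\<close> that is identified with an element of \<open>Lr (conj_exponent r)\<close>.\<close>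

definition Lr_pairing :: "('a::euclidean_space \<Rightarrow> real) \<Rightarrow> ('a \<Rightarrow> real) \<Rightarrow> real" where
  "Lr_pairing g h = (\<integral>x. g x * h x \<partial>lborel)"

definition bounded_linear_Lr ::
  "real \<Rightarrow> (('a::euclidean_space \<Rightarrow> real) \<Rightarrow> 'b::real_normed_vector) \<Rightarrow> bool" where
  "bounded_linear_Lr r D \<longleftrightarrow>
     (\<forall>g\<in>Lr r. \<forall>h\<in>Lr r. D (\<lambda>x. g x + h x) = D g + D h) \<and>
     (\<forall>c. \<forall>h\<in>Lr r. D (\<lambda>x. c * h x) = c *\<^sub>R D h) \<and>
     (\<exists>K. \<forall>h\<in>Lr r. norm (D h) \<le> K * Lr_norm r h)"

definition has_derivative_Lr ::
  "real \<Rightarrow> (('a::euclidean_space \<Rightarrow> real) \<Rightarrow> 'b::real_normed_vector) \<Rightarrow>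
   (('a \<Rightarrow> real) \<Rightarrow> 'b) \<Rightarrow> ('a \<Rightarrow> real) \<Rightarrow> bool" where
  "has_derivative_Lr r F D u \<longleftrightarrow> bounded_linear_Lr r D \<and>
     (\<forall>e>0. \<exists>d>0. \<forall>h\<in>Lr r. Lr_norm r h < d \<longrightarrow>
        norm (F (\<lambda>x. u x + h x) - F u - D h) \<le> e * Lr_norm r h)"

text \<open>As with \<^const>\<open>frechet_derivative\<close>; only the values on \<open>Lr r\<close> are determined.\<close>

definition frechet_derivative_Lr ::
  "real \<Rightarrow> (('a::euclidean_space \<Rightarrow> real) \<Rightarrow> 'b::real_normed_vector) \<Rightarrow>
   ('a \<Rightarrow> real) \<Rightarrow> ('a \<Rightarrow> real) \<Rightarrow> 'b" where
  "frechet_derivative_Lr r F u = (SOME D. has_derivative_Lr r F D u)"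

lemma Lr_scale: "h \<in> Lr r \<Longrightarrow> (\<lambda>x. c * h x) \<in> Lr r"
  by (auto simp: Lr_def abs_mult powr_mult)

lemma Lr_norm_scale: "r > 0 \<Longrightarrow> Lr_norm r (\<lambda>x. c * h x) = \<bar>c\<bar> * Lr_norm r h"
  by (simp add: Lr_norm_def abs_mult powr_mult powr_powr)

lemma has_derivative_Lr_unique:
  assumes r: "r > 0" and D: "has_derivative_Lr r F D u" and D': "has_derivative_Lr r F D' u"
    and h: "h \<in> Lr r"
  shows "D h = D' h"
proof -
  have nn: "0 \<le> Lr_norm r h" by (simp add: Lr_norm_def)
  have "norm (D h - D' h) \<le> e" if e: "e > 0" for e
  proof -
    define q where "q = e / (Lr_norm r h + 1)"
    define e' where "e' = q / 2"
    have e': "e' > 0" using e nn by (simp add: e'_def q_def)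
    obtain d1 where d1: "d1 > 0" "\<And>h. h \<in> Lr r \<Longrightarrow> Lr_norm r h < d1 \<Longrightarrow>
        norm (F (\<lambda>x. u x + h x) - F u - D h) \<le> e' * Lr_norm r h"
      using D e' unfolding has_derivative_Lr_def by blast
    obtain d2 where d2: "d2 > 0" "\<And>h. h \<in> Lr r \<Longrightarrow> Lr_norm r h < d2 \<Longrightarrow>
        norm (F (\<lambda>x. u x + h x) - F u - D' h) \<le> e' * Lr_norm r h"
      using D' e' unfolding has_derivative_Lr_def by blast
    define c where "c = min d1 d2 / (2 * (Lr_norm r h + 1))"
    have c: "c > 0" using d1 d2 nn by (simp add: c_def)
    define k where "k = (\<lambda>x. c * h x)"
    have k: "k \<in> Lr r" "Lr_norm r k = c * Lr_norm r h"
      using Lr_scale[OF h, of c] c by (simp_all add: k_def Lr_norm_scale[OF r])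
    have "c * Lr_norm r h < c * (2 * (Lr_norm r h + 1))"
      using c nn by (intro mult_strict_left_mono) auto
    also have "\<dots> = min d1 d2" using nn by (simp add: c_def)
    finally have small: "Lr_norm r k < d1" "Lr_norm r k < d2" by (auto simp: k)
    have "norm (D k - D' k) \<le> norm (F (\<lambda>x. u x + k x) - F u - D' k)
        + norm (F (\<lambda>x. u x + k x) - F u - D k)"
      by (rule order_trans[OF _ norm_triangle_ineq4]) simp
    also have "\<dots> \<le> e' * Lr_norm r k + e' * Lr_norm r k"
      by (intro add_mono d1(2)[OF k(1) small(1)] d2(2)[OF k(1) small(2)])
    also have "\<dots> = c * (2 * e' * Lr_norm r h)" by (simp only: k) algebra
    also have "D k - D' k = c *\<^sub>R (D h - D' h)"
      using D D' h by (simp add: has_derivative_Lr_def bounded_linear_Lr_def k_def scaleR_diff_right)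
    finally have "c * norm (D h - D' h) \<le> c * (2 * e' * Lr_norm r h)"
      using c by (simp only: norm_scaleR abs_of_pos)
    then have "norm (D h - D' h) \<le> 2 * e' * Lr_norm r h"
      using c by (rule mult_left_le_imp_le)
    also have "\<dots> = e * (Lr_norm r h / (Lr_norm r h + 1))"
      by (simp add: e'_def) (simp add: q_def)
    also have "\<dots> \<le> e * 1"
      using e nn by (intro mult_left_mono) auto
    also have "e * 1 = e" by simp
    finally show ?thesis .
  qed
  then have "norm (D h - D' h) \<le> 0"
    using field_le_epsilon[of "norm (D h - D' h)" 0] by simp
  then show ?thesis by simp
qed

lemma Lr_duality_map:
  assumes "u \<in> Lr r" "r > 1"
  shows "(\<lambda>x. c * \<bar>u x\<bar> powr (r - 1) * sgn (u x)) \<in> Lr (conj_exponent r)"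
proof -
  have eq: "\<bar>c * \<bar>u x\<bar> powr (r - 1) * sgn (u x)\<bar> powr (r / (r - 1))
      = \<bar>c\<bar> powr (r / (r - 1)) * \<bar>u x\<bar> powr r" for x
    using assms(2) by (cases "u x = 0") (auto simp: abs_mult powr_mult powr_powr abs_sgn_eq)
  have [measurable]: "u \<in> borel_measurable borel"
    using assms(1) by (simp add: Lr_def)
  have "(\<lambda>x. c * \<bar>u x\<bar> powr (r - 1) * sgn (u x)) \<in> borel_measurable lborel"
    unfolding sgn_if by measurable
  then show ?thesis
    using assms(1) by (simp add: Lr_def conj_exponent_def eq)
qed


section \<open>The discrete dynamics\<close>

definition gaussian :: "real \<Rightarrow> 'a::euclidean_space \<Rightarrow> real" where
  "gaussian \<tau> x = exp (- (norm x)\<^sup>2 / (2 * \<tau>\<^sup>2)) / ((2 * pi) powr (DIM('a) / 2) * \<tau> ^ DIM('a))"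

definition convolution :: "('a::euclidean_space \<Rightarrow> real) \<Rightarrow> ('a \<Rightarrow> real) \<Rightarrow> 'a \<Rightarrow> real" where
  "convolution g h x = (\<integral>y. g (x - y) * h y \<partial>lborel)"

definition reaction :: "real \<Rightarrow> real \<Rightarrow> real" where
  "reaction W \<xi> = W * \<xi>\<^sup>2 * (\<xi> - 1)\<^sup>2 * (\<xi> - 1/2) * indicator {0..1} \<xi>"

definition smooth_norm :: "real \<Rightarrow> 'a::euclidean_space \<Rightarrow> real" where
  "smooth_norm \<psi> z = sqrt ((norm z)\<^sup>2 + \<psi>\<^sup>2)"

text \<open>
  A Hilbert space of vector fields is a Hilbert space type \<open>'v\<close> together with a continuous linear
  embedding \<open>emb\<close> into the space of vector fields that are bounded with their first derivatives.
\<close>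

definition step_map ::
  "real \<Rightarrow> real \<Rightarrow> real \<Rightarrow> ('v::real_inner \<Rightarrow> ('a::euclidean_space, 'a) bC1) \<Rightarrow>
   'a C10 \<Rightarrow> ('a \<Rightarrow> real) \<Rightarrow> 'v \<Rightarrow> 'a C10" where
  "step_map \<tau> W \<psi> emb f u v = to_C10 (\<lambda>x.
     convolution (gaussian \<tau>) (C10_fun f) x +
     convolution (gaussian \<tau>) (\<lambda>y. smooth_norm \<psi> (gradient (C10_fun f) y) * u y
       - gradient (C10_fun f) y \<bullet> apply_bC1 (emb v) y + reaction W (C10_fun f y)) x)"

definition initial_state :: "real \<Rightarrow> ('a::euclidean_space \<Rightarrow> real) \<Rightarrow> 'a C10" where
  "initial_state \<tau> f\<^sub>0 = to_C10 (convolution (gaussian \<tau>) f\<^sub>0)"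

text \<open>
  Below \<open>G\<close> is an arbitrary step map and \<open>i\<close> an initial state.  Finite families indexed by
  \<open>{1..T}\<close> or \<open>{1..T - 1}\<close> are functions on the natural numbers, whose other values are irrelevant.
\<close>

primrec state ::
  "('a::euclidean_space C10 \<Rightarrow> ('a \<Rightarrow> real) \<Rightarrow> 'v \<Rightarrow> 'a C10) \<Rightarrow> 'a C10 \<Rightarrow>
   (nat \<Rightarrow> 'a \<Rightarrow> real) \<Rightarrow> (nat \<Rightarrow> 'v) \<Rightarrow> nat \<Rightarrow> 'a C10" where
  "state G i u v 0 = i"
| "state G i u v (Suc k) = (if k = 0 then i else G (state G i u v k) (u k) (v k))"

definition control_cost ::
  "nat \<Rightarrow> real \<Rightarrow> real \<Rightarrow> real \<Rightarrow>
   (nat \<Rightarrow> 'a::euclidean_space \<Rightarrow> real) \<Rightarrow> (nat \<Rightarrow> 'v::real_inner) \<Rightarrow> real" where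
  "control_cost T C p r u v =
     1 / real T * (\<Sum>k=1..T-1. C * Lr_norm r (u k) powr p + norm (v k) powr p)"

definition reduced_energy ::
  "nat \<Rightarrow> real \<Rightarrow> real \<Rightarrow> real \<Rightarrow> ('a::euclidean_space C10 \<Rightarrow> real) \<Rightarrow>
   ('a C10 \<Rightarrow> ('a \<Rightarrow> real) \<Rightarrow> 'v \<Rightarrow> 'a C10) \<Rightarrow> 'a C10 \<Rightarrow>
   (nat \<Rightarrow> 'a \<Rightarrow> real) \<Rightarrow> (nat \<Rightarrow> 'v::real_inner) \<Rightarrow> real" where
  "reduced_energy T C p r U G i u v = control_cost T C p r u v + U (state G i u v T)"

definition lagrangian ::
  "nat \<Rightarrow> real \<Rightarrow> real \<Rightarrow> real \<Rightarrow> ('a::euclidean_space C10 \<Rightarrow> real) \<Rightarrow>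
   ('a C10 \<Rightarrow> ('a \<Rightarrow> real) \<Rightarrow> 'v \<Rightarrow> 'a C10) \<Rightarrow> 'a C10 \<Rightarrow>
   (nat \<Rightarrow> 'a C10) \<Rightarrow> (nat \<Rightarrow> 'a \<Rightarrow> real) \<Rightarrow> (nat \<Rightarrow> 'v::real_inner) \<Rightarrow>
   (nat \<Rightarrow> 'a C10 \<Rightarrow>\<^sub>L real) \<Rightarrow> real" where
  "lagrangian T C p r U G i f u v l =
     control_cost T C p r u v + U (f T)
     + (\<Sum>k=2..T. blinfun_apply (l k) (f k - G (f (k-1)) (u (k-1)) (v (k-1))))
     + blinfun_apply (l 1) (f 1 - i)"

definition critical_point ::
  "nat \<Rightarrow> real \<Rightarrow> ((nat \<Rightarrow> 'a::euclidean_space C10) \<Rightarrow> (nat \<Rightarrow> 'a \<Rightarrow> real) \<Rightarrow>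
     (nat \<Rightarrow> 'v::real_inner) \<Rightarrow> (nat \<Rightarrow> 'a C10 \<Rightarrow>\<^sub>L real) \<Rightarrow> real) \<Rightarrow>
   (nat \<Rightarrow> 'a C10) \<Rightarrow> (nat \<Rightarrow> 'a \<Rightarrow> real) \<Rightarrow> (nat \<Rightarrow> 'v) \<Rightarrow> (nat \<Rightarrow> 'a C10 \<Rightarrow>\<^sub>L real) \<Rightarrow> bool" where
  "critical_point T r L f u v l \<longleftrightarrow>
     (\<forall>k\<in>{1..T-1}. u k \<in> Lr r) \<and>
     (\<forall>k\<in>{1..T}. ((\<lambda>g. L (f(k := g)) u v l) has_derivative (\<lambda>_. 0)) (at (f k))) \<and>
     (\<forall>k\<in>{1..T-1}. has_derivative_Lr r (\<lambda>w. L f (u(k := w)) v l) (\<lambda>_. 0) (u k)) \<and>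
     (\<forall>k\<in>{1..T-1}. ((\<lambda>w. L f u (v(k := w)) l) has_derivative (\<lambda>_. 0)) (at (v k))) \<and>
     (\<forall>k\<in>{1..T}. ((\<lambda>m. L f u v (l(k := m))) has_derivative (\<lambda>_. 0)) (at (l k)))"

definition banach_adjoint ::
  "('b::real_normed_vector \<Rightarrow>\<^sub>L 'c::real_normed_vector) \<Rightarrow> ('c \<Rightarrow>\<^sub>L real) \<Rightarrow> ('b \<Rightarrow>\<^sub>L real)" where
  "banach_adjoint A l = l o\<^sub>L A"

definition deriv_f ::
  "('a::euclidean_space C10 \<Rightarrow> ('a \<Rightarrow> real) \<Rightarrow> 'v \<Rightarrow> 'a C10) \<Rightarrow>
   'a C10 \<Rightarrow> ('a \<Rightarrow> real) \<Rightarrow> 'v \<Rightarrow> 'a C10 \<Rightarrow>\<^sub>L 'a C10" where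
  "deriv_f G f u v = Blinfun (frechet_derivative (\<lambda>g. G g u v) (at f))"

definition deriv_u ::
  "real \<Rightarrow> ('a::euclidean_space C10 \<Rightarrow> ('a \<Rightarrow> real) \<Rightarrow> 'v \<Rightarrow> 'a C10) \<Rightarrow>
   'a C10 \<Rightarrow> ('a \<Rightarrow> real) \<Rightarrow> 'v \<Rightarrow> ('a \<Rightarrow> real) \<Rightarrow> 'a C10" where
  "deriv_u r G f u v = frechet_derivative_Lr r (\<lambda>w. G f w v) u"

definition deriv_v ::
  "('a::euclidean_space C10 \<Rightarrow> ('a \<Rightarrow> real) \<Rightarrow> 'v::real_inner \<Rightarrow> 'a C10) \<Rightarrow>
   'a C10 \<Rightarrow> ('a \<Rightarrow> real) \<Rightarrow> 'v \<Rightarrow> 'v \<Rightarrow>\<^sub>L 'a C10" where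
  "deriv_v G f u v = Blinfun (frechet_derivative (\<lambda>w. G f u w) (at v))"

text \<open>
  The signs are those forced by the terms \<open>l k (f k - G (f (k - 1)) \<dots>)\<close> of the Lagrangian:
  its derivatives in \<open>f T\<close> and in \<open>f k\<close> are \<open>dU (f T) + l T\<close> and
  \<open>l k - banach_adjoint (deriv_f G (f k) (u k) (v k)) (l (k + 1))\<close>.
\<close>

definition adjoint_system ::
  "nat \<Rightarrow> ('a::euclidean_space C10 \<Rightarrow> 'a C10 \<Rightarrow>\<^sub>L real) \<Rightarrow>
   ('a C10 \<Rightarrow> ('a \<Rightarrow> real) \<Rightarrow> 'v \<Rightarrow> 'a C10) \<Rightarrow>
   (nat \<Rightarrow> 'a C10) \<Rightarrow> (nat \<Rightarrow> 'a \<Rightarrow> real) \<Rightarrow> (nat \<Rightarrow> 'v) \<Rightarrow> (nat \<Rightarrow> 'a C10 \<Rightarrow>\<^sub>L real) \<Rightarrow> bool" where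
  "adjoint_system T dU G f u v l \<longleftrightarrow>
     l T = - dU (f T) \<and>
     (\<forall>k\<in>{1..T-1}. l k = banach_adjoint (deriv_f G (f k) (u k) (v k)) (l (k + 1)))"

end

(*
  Every partial map of G is the composition of a pointwise expression with convolution by the
  Gaussian, and this convolution maps L^r, as well as the bounded functions vanishing at infinity,
  boundedly into C^1_0. Since chi and the reaction term have pointwise Taylor remainders of second
  order, and G is affine in u and in v, the partial derivatives of G exist. The formula for
  lambda then expresses that the derivatives of the Lagrangian in f vanish. Finally
  lambda_j o (d f_j / d u_k) does not depend on j > k, by the adjoint equation and the chain rule, so
  that the derivative of U(f_T) in u_k is -lambda_{k+1} o d_u G; likewise for v_k.
*)

theory Submission
  imports Defs
begin


text \<open>The signs come from the Lagrangian, where f_T and f_k occur with a plus sign in their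
  pairings: stationarity reads \<open>l T = - dU (f T)\<close> and
  \<open>l k = banach_adjoint ... (l (k + 1))\<close>, so that along a trajectory l_k is minus the
  derivative of U(f_T) in f_k. The analysis rests on one inequality: if a kernel is at most K times
  \<open>decay\<close> and |h| <= s + \<psi> with \<psi> integrable, their convolution is at most K
  (s 2^d + integral of \<psi>). For the Gaussian, its derivative, its Taylor remainder and its
  increments it yields boundedness, differentiability and continuity. The majorant is exponential
  because a translate of a Gaussian is not bounded by a multiple of that Gaussian, while an
  exponential absorbs translations. Keeping s free gives access to L^r: balancing s against the norm
  replaces a Hoelder estimate. Two encodings shape the rest. Since r is real, \<open>Lr r\<close> is
  a set with a seminorm, so derivatives in u have their own sum and chain rules. And
  \<open>to_C10\<close> is meaningful only on functions that belong to C^1_0, so every use of G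
  first certifies membership, which is the purpose of \<open>almost_integrable\<close>.\<close>

section \<open>Convolution of exponentially decaying kernels\<close>

text \<open>
  The \<open>l1\<close> norm in the exponent makes \<open>decay\<close> a product of functions of one coordinate, whose
  integral is computed by Fubini.
\<close>

definition decay :: "'a::euclidean_space \<Rightarrow> real" where
  "decay z = (\<Prod>b\<in>Basis. exp (- \<bar>z \<bullet> b\<bar>))"

lemma decay_eq: "decay z = exp (- (\<Sum>b\<in>Basis. \<bar>z \<bullet> b\<bar>))"
  by (simp add: decay_def exp_sum sum_negf[symmetric])

lemma decay_nonneg [simp]: "decay z \<ge> 0"
  by (simp add: decay_eq)

lemma decay_le_exp_norm: "decay z \<le> exp (- norm z)"
  using norm_le_l1[of z] by (simp add: decay_eq)

lemma decay_le_1: "decay z \<le> 1"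
  by (simp add: decay_eq sum_nonneg)

lemma exp_norm_le_decay: "exp (- (DIM('a) * norm z)) \<le> decay (z :: 'a::euclidean_space)"
proof -
  have "(\<Sum>b\<in>Basis. \<bar>z \<bullet> b\<bar>) \<le> (\<Sum>b\<in>(Basis::'a set). norm z)"
    by (intro sum_mono) (simp add: Basis_le_norm)
  then show ?thesis by (simp add: decay_eq)
qed

lemma decay_measurable [measurable]: "decay \<in> borel_measurable borel"
  unfolding decay_def by measurable

lemma nn_integral_exp_minus_abs: "(\<integral>\<^sup>+t. ennreal (exp (- \<bar>t\<bar>)) \<partial>lborel) = 2"
proof -
  have half: "(\<integral>\<^sup>+t. ennreal (exp (- t)) * indicator {0::real..} t \<partial>lborel) = ennreal (0 - (- exp (- 0)))"
  proof (rule nn_integral_FTC_atLeast)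
    show "((\<lambda>t::real. - exp (- t)) \<longlongrightarrow> 0) at_top"
      using tendsto_minus[OF filterlim_compose[OF exp_at_bot filterlim_uminus_at_bot_at_top]]
      by simp
  qed (auto intro!: derivative_eq_intros)
  \<comment> \<open>The two closed half-lines share the point 0, so the integrands agree only almost
    everywhere. The shape \<open>0 + (-1) * t\<close> is the one expected by the affine substitution
    rule.\<close>
  have "(\<integral>\<^sup>+t. ennreal (exp (- \<bar>t\<bar>)) \<partial>lborel)
      = (\<integral>\<^sup>+t. ennreal (exp (- t)) * indicator {0::real..} t
           + ennreal (exp (- (0 + (-1) * t))) * indicator {0::real..} (0 + (-1) * t) \<partial>lborel)"
    by (rule nn_integral_cong_AE, rule AE_mp[OF AE_lborel_singleton[of 0]])
      (auto simp: indicator_def)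
  also have "\<dots> = (\<integral>\<^sup>+t. ennreal (exp (- t)) * indicator {0::real..} t \<partial>lborel)
      + (\<integral>\<^sup>+t. ennreal (exp (- (0 + (-1) * t))) * indicator {0::real..} (0 + (-1) * t) \<partial>lborel)"
    by (intro nn_integral_add) auto
  also have "(\<integral>\<^sup>+t. ennreal (exp (- (0 + (-1) * t))) * indicator {0::real..} (0 + (-1) * t) \<partial>lborel)
      = (\<integral>\<^sup>+t. ennreal (exp (- t)) * indicator {0::real..} t \<partial>lborel)"
    by (subst (2) nn_integral_real_affine[where c = "-1" and t = 0]) auto
  finally show ?thesis
    unfolding half by simp
qed

lemma nn_integral_decay:
  "(\<integral>\<^sup>+y. ennreal (decay (x - y)) \<partial>lborel) = ennreal (2 ^ DIM('a))" for x :: "'a::euclidean_space"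
proof -
  have one: "(\<integral>\<^sup>+t. ennreal (exp (- \<bar>c - t\<bar>)) \<partial>lborel) = 2" for c :: real
    using nn_integral_real_affine[of "\<lambda>t. ennreal (exp (- \<bar>t\<bar>))" "-1" c]
    by (simp add: nn_integral_exp_minus_abs)
  have "(\<integral>\<^sup>+y. ennreal (decay (x - y)) \<partial>lborel)
      = (\<integral>\<^sup>+y. (\<Prod>b\<in>Basis. ennreal (exp (- \<bar>x \<bullet> b - y \<bullet> b\<bar>))) \<partial>lborel)"
    by (simp add: decay_def inner_diff_left prod_ennreal)
  also have "\<dots> = (\<Prod>b\<in>Basis. (\<integral>\<^sup>+t. ennreal (exp (- \<bar>x \<bullet> b - t\<bar>)) \<partial>lborel))"
    by (rule nn_integral_lborel_prod) auto
  also have "\<dots> = ennreal (2 ^ DIM('a))"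
    by (simp add: one ennreal_power flip: ennreal_numeral)
  finally show ?thesis .
qed

lemma decay_integrable: "integrable lborel (\<lambda>y. decay (x - y))"
  by (rule integrableI_nonneg) (auto simp: nn_integral_decay)

lemma integral_decay: "(\<integral>y. decay (x - y) \<partial>lborel) = 2 ^ DIM('a)" for x :: "'a::euclidean_space"
  by (rule integral_eq_nn_integral[THEN trans]) (auto simp: nn_integral_decay)

section \<open>Kernels with exponential decay and almost integrable functions\<close>

definition decay_kernel :: "real \<Rightarrow> ('a::euclidean_space \<Rightarrow> real) \<Rightarrow> bool" where
  "decay_kernel K k \<longleftrightarrow> k \<in> borel_measurable borel \<and> (\<forall>z. \<bar>k z\<bar> \<le> K * decay z)"

text \<open>
  A function is almost integrable if it is an integrable function up to an arbitrarily small bounded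
  error.  This class contains both \<open>Lr r\<close> and the bounded functions vanishing at infinity, which are
  the two kinds of terms to which the step map applies the Gaussian.
\<close>

definition dominated :: "real \<Rightarrow> ('a::euclidean_space \<Rightarrow> real) \<Rightarrow> ('a \<Rightarrow> real) \<Rightarrow> bool" where
  "dominated s \<psi> h \<longleftrightarrow> h \<in> borel_measurable borel \<and> integrable lborel \<psi> \<and>
     (\<forall>y. 0 \<le> \<psi> y \<and> \<bar>h y\<bar> \<le> s + \<psi> y)"

definition almost_integrable :: "('a::euclidean_space \<Rightarrow> real) \<Rightarrow> bool" where
  "almost_integrable h \<longleftrightarrow> (\<forall>s>0. \<exists>\<psi>. dominated s \<psi> h)"

lemma almost_integrableD: "almost_integrable h \<Longrightarrow> \<exists>\<psi>. dominated 1 \<psi> h"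
  by (auto simp: almost_integrable_def)

lemma almost_integrable_measurable: "almost_integrable h \<Longrightarrow> h \<in> borel_measurable borel"
  using almost_integrableD[of h] by (auto simp: dominated_def)

lemma dominated_add:
  assumes "dominated s \<psi> g" "dominated t \<phi> h"
  shows "dominated (s + t) (\<lambda>y. \<psi> y + \<phi> y) (\<lambda>y. g y + h y)"
proof -
  have "\<bar>g y + h y\<bar> \<le> s + t + (\<psi> y + \<phi> y)" for y
  proof -
    have "\<bar>g y\<bar> \<le> s + \<psi> y" "\<bar>h y\<bar> \<le> t + \<phi> y" using assms by (auto simp: dominated_def)
    then show ?thesis by linarith
  qed
  then show ?thesis using assms by (auto simp: dominated_def)
qed

lemma dominated_mult:
  assumes "dominated s \<psi> h" "c \<in> borel_measurable borel" "\<And>y. \<bar>c y\<bar> \<le> B"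
  shows "dominated (B * s) (\<lambda>y. B * \<psi> y) (\<lambda>y. c y * h y)"
proof -
  have B: "B \<ge> 0" using assms(3)[of 0] by linarith
  have "\<bar>c y * h y\<bar> \<le> B * (s + \<psi> y)" for y
    unfolding abs_mult using assms B by (intro mult_mono) (auto simp: dominated_def)
  then show ?thesis using assms B by (auto simp: dominated_def distrib_left)
qed

lemma almost_integrable_add:
  assumes "almost_integrable g" "almost_integrable h"
  shows "almost_integrable (\<lambda>y. g y + h y)"
  unfolding almost_integrable_def
proof (intro allI impI)
  fix s :: real assume "s > 0"
  then obtain \<psi> \<phi> where "dominated (s/2) \<psi> g" "dominated (s/2) \<phi> h"
    using assms by (metis almost_integrable_def half_gt_zero)
  from dominated_add[OF this] show "\<exists>\<psi>. dominated s \<psi> (\<lambda>y. g y + h y)" by auto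
qed

lemma almost_integrable_mult:
  assumes "almost_integrable h" "c \<in> borel_measurable borel" "\<And>y. \<bar>c y\<bar> \<le> B"
  shows "almost_integrable (\<lambda>y. c y * h y)"
  unfolding almost_integrable_def
proof (intro allI impI)
  fix s :: real assume s: "s > 0"
  have B: "B \<ge> 0" using assms(3)[of 0] by linarith
  \<comment> \<open>\<open>B + 1\<close> instead of \<open>B\<close> keeps the quotient meaningful
    for \<open>B = 0\<close>.\<close>
  then obtain \<psi> where "dominated (s / (B + 1)) \<psi> h"
    using assms s unfolding almost_integrable_def by (metis add_nonneg_pos divide_pos_pos zero_less_one)
  from dominated_mult[OF this assms(2), of "B + 1"] assms(3) B
  have "dominated s (\<lambda>y. (B + 1) * \<psi> y) (\<lambda>y. c y * h y)" by (auto simp: add_increasing2)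
  then show "\<exists>\<psi>. dominated s \<psi> (\<lambda>y. c y * h y)" by blast
qed

lemma almost_integrable_scale: "almost_integrable h \<Longrightarrow> almost_integrable (\<lambda>y. c * h y)"
  using almost_integrable_mult[of h "\<lambda>_. c" "\<bar>c\<bar>"] by auto

lemma almost_integrable_diff:
  "almost_integrable g \<Longrightarrow> almost_integrable h \<Longrightarrow> almost_integrable (\<lambda>y. g y - h y)"
  using almost_integrable_add[OF _ almost_integrable_scale[of h "-1"], of g] by simp

text \<open>Vanishing at infinity makes |h| < s outside some ball; inside it the constant B is
  integrable, so B times the indicator of the ball serves as the integrable majorant.\<close>

lemma almost_integrable_vanishing:
  assumes "h \<in> borel_measurable borel" "\<And>y. \<bar>h y\<bar> \<le> B" "(h \<longlongrightarrow> 0) at_infinity"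
  shows "almost_integrable h"
  unfolding almost_integrable_def
proof (intro allI impI)
  fix s :: real assume "s > 0"
  then obtain R where R: "\<And>y. norm y \<ge> R \<Longrightarrow> \<bar>h y\<bar> < s"
    using assms(3) by (auto simp: Lim_at_infinity)
  have "integrable lborel (\<lambda>y. B * indicator (cball 0 R) y)"
    by (intro integrable_mult_right integrable_real_indicator) (auto intro!: emeasure_bounded_finite[unfolded infinity_ennreal_def])
  moreover have "0 \<le> B * indicator (cball 0 R) y \<and> \<bar>h y\<bar> \<le> s + B * indicator (cball 0 R) y" for y
    using R[of y] assms(2)[of y] \<open>s > 0\<close> by (auto simp: indicator_def)
  ultimately show "\<exists>\<psi>. dominated s \<psi> h"
    using assms(1) by (auto simp: dominated_def)
qed

text \<open>The two parts of the majorant use the kernel differently: the constant s meets the total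
  mass 2^d of \<open>decay\<close>, while for \<psi> it suffices that \<open>decay\<close> is at
  most 1. The last version keeps the weight in front of \<psi>, which is what decays as x goes to
  infinity. All bounds are linear in K, so small kernels such as Taylor remainders give small
  convolutions.\<close>

lemma convolution_dominated:
  fixes k :: "'a::euclidean_space \<Rightarrow> real"
  assumes k: "decay_kernel K k" and h: "dominated s \<psi> h" and s: "s \<ge> 0"
  shows convolution_integrable: "integrable lborel (\<lambda>y. k (x - y) * h y)"
    and convolution_le: "\<bar>convolution k h x\<bar> \<le> K * (s * 2 ^ DIM('a) + (\<integral>y. \<psi> y \<partial>lborel))"
    and convolution_le_decay:
      "\<bar>convolution k h x\<bar> \<le> K * (s * 2 ^ DIM('a) + (\<integral>y. decay (x - y) * \<psi> y \<partial>lborel))"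
proof -
  have [measurable]: "k \<in> borel_measurable borel" "h \<in> borel_measurable borel"
    "\<psi> \<in> borel_measurable borel"
    using k h by (auto simp: decay_kernel_def dominated_def)
  \<comment> \<open>At the origin \<open>decay\<close> is 1, so the kernel bound itself forces K to
    be nonnegative.\<close>
  have "\<bar>k 0\<bar> \<le> K * decay (0::'a)" using k by (auto simp: decay_kernel_def)
  then have K: "K \<ge> 0" by (simp add: decay_eq)
  have \<psi>: "integrable lborel \<psi>" "\<And>y. 0 \<le> \<psi> y" using h by (auto simp: dominated_def)
  have d\<psi>: "integrable lborel (\<lambda>y. decay (x - y) * \<psi> y)"
    by (rule Bochner_Integration.integrable_bound[OF \<psi>(1)])
      (auto simp: abs_mult intro!: AE_I2 mult_left_le_one_le decay_le_1 \<psi>(2))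
  have le: "\<bar>k (x - y) * h y\<bar> \<le> K * (s * decay (x - y) + decay (x - y) * \<psi> y)" for y
  proof -
    have "\<bar>k (x - y) * h y\<bar> \<le> (K * decay (x - y)) * (s + \<psi> y)"
      unfolding abs_mult using k h K by (intro mult_mono) (auto simp: decay_kernel_def dominated_def)
    then show ?thesis by (simp add: algebra_simps)
  qed
  have int: "integrable lborel (\<lambda>y. K * (s * decay (x - y) + decay (x - y) * \<psi> y))"
    by (intro integrable_mult_right Bochner_Integration.integrable_add decay_integrable d\<psi>)
  show 1: "integrable lborel (\<lambda>y. k (x - y) * h y)"
    by (rule Bochner_Integration.integrable_bound[OF int])
      (use order_trans[OF le abs_ge_self] in auto)
  have "\<bar>convolution k h x\<bar> \<le> (\<integral>y. K * (s * decay (x - y) + decay (x - y) * \<psi> y) \<partial>lborel)"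
    unfolding convolution_def real_norm_def[symmetric]
    by (rule Bochner_Integration.integral_norm_bound_integral[OF 1 int]) (use le in auto)
  also have "\<dots> = K * (s * 2 ^ DIM('a) + (\<integral>y. decay (x - y) * \<psi> y \<partial>lborel))"
    using decay_integrable[of x] d\<psi> integral_decay[of x] by simp
  finally show 2: "\<bar>convolution k h x\<bar>
      \<le> K * (s * 2 ^ DIM('a) + (\<integral>y. decay (x - y) * \<psi> y \<partial>lborel))" .
  have "(\<integral>y. decay (x - y) * \<psi> y \<partial>lborel) \<le> (\<integral>y. \<psi> y \<partial>lborel)"
    by (intro integral_mono d\<psi> \<psi>(1) mult_left_le_one_le decay_le_1 \<psi>(2) decay_nonneg)
  then show "\<bar>convolution k h x\<bar> \<le> K * (s * 2 ^ DIM('a) + (\<integral>y. \<psi> y \<partial>lborel))"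
    using 2 K by (meson add_left_mono mult_left_mono order_trans)
qed

lemma convolution_integrable':
  "decay_kernel K k \<Longrightarrow> almost_integrable h \<Longrightarrow> integrable lborel (\<lambda>y. k (x - y) * h y)"
  using convolution_integrable almost_integrableD by (metis zero_le_one)

text \<open>For |x| >= 2 n either |y| <= n, and then |x - y| >= n makes the weight at most exp(-n),
  or y lies outside the ball of radius n. This gives a majorant independent of x, whose integral
  tends to 0 with growing n by dominated convergence.\<close>

lemma integral_decay_tendsto_0:
  fixes \<psi> :: "'a::euclidean_space \<Rightarrow> real"
  assumes \<psi>: "integrable lborel \<psi>" "\<And>y. 0 \<le> \<psi> y"
  shows "((\<lambda>x. \<integral>y. decay (x - y) * \<psi> y \<partial>lborel) \<longlongrightarrow> 0) at_infinity"
  unfolding Lim_at_infinity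
proof (intro allI impI)
  fix e :: real assume e: "e > 0"
  define q where "q n y = (exp (- real n) + indicator (- cball 0 (real n)) y) * \<psi> y" for n y
  have [measurable]: "\<psi> \<in> borel_measurable borel" using \<psi> by auto
  have [measurable]: "q n \<in> borel_measurable borel" for n
    unfolding q_def[abs_def] by measurable
  have e2: "exp (- real n) \<le> 2" for n
    by (rule order_trans[of _ "1::real"]) auto
  have lim: "(\<lambda>n. \<integral>y. q n y \<partial>lborel) \<longlonglongrightarrow> integral\<^sup>L lborel (\<lambda>y::'a. 0)"
  proof (rule Bochner_Integration.integral_dominated_convergence[where w = "\<lambda>y. 2 * \<psi> y"])
    show "AE y in lborel. (\<lambda>n. q n y) \<longlonglongrightarrow> 0"
    proof (rule AE_I2)
      fix y :: 'a
      have 1: "(\<lambda>n. exp (- real n)) \<longlonglongrightarrow> 0"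
        by (intro filterlim_compose[OF exp_at_bot] filterlim_compose[OF filterlim_uminus_at_bot_at_top] filterlim_real_sequentially)
      obtain N where N: "real N \<ge> norm y" using real_arch_simple by blast
      have "eventually (\<lambda>n. indicator (- cball 0 (real n)) y = (0::real)) sequentially"
        using eventually_ge_at_top[of N] by eventually_elim (use N in \<open>auto simp: indicator_def\<close>)
      then have 2: "(\<lambda>n. indicator (- cball 0 (real n)) y :: real) \<longlonglongrightarrow> 0"
        by (rule tendsto_eventually)
      show "(\<lambda>n. q n y) \<longlonglongrightarrow> 0"
        unfolding q_def using tendsto_mult_right[OF tendsto_add[OF 1 2], of "\<psi> y"] by simp
    qed
    show "AE y in lborel. norm (q n y) \<le> 2 * \<psi> y" for n
      unfolding q_def using \<psi>(2) e2 by (intro AE_I2) (auto simp: indicator_def abs_mult intro!: mult_right_mono)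
  qed (use \<psi> in \<open>auto simp: q_def\<close>)
  then obtain n where n: "\<bar>\<integral>y. q n y \<partial>lborel\<bar> < e"
    using e LIMSEQ_D[OF lim, of e] by fastforce
  have qint: "integrable lborel (q n)"
    by (rule Bochner_Integration.integrable_bound[of _ "\<lambda>y. 2 * \<psi> y"])
      (use \<psi> e2 in \<open>auto simp: q_def indicator_def abs_mult intro!: mult_right_mono\<close>)
  have "\<bar>\<integral>y. decay (x - y) * \<psi> y \<partial>lborel\<bar> < e" if x: "norm x \<ge> 2 * real n" for x :: 'a
  proof -
    have le: "decay (x - y) * \<psi> y \<le> q n y" for y
      unfolding q_def
    proof (rule mult_right_mono[OF _ \<psi>(2)])
      show "decay (x - y) \<le> exp (- real n) + indicator (- cball 0 (real n)) y"
      proof (cases "norm y \<le> n")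
        case True
        then have "norm (x - y) \<ge> n" using x norm_triangle_ineq2[of x y] by linarith
        then show ?thesis using decay_le_exp_norm[of "x - y"] True
          by (auto intro: order_trans)
      next
        case False
        then show ?thesis using decay_le_1[of "x - y"] by (auto simp: add_increasing)
      qed
    qed
    have "(\<integral>y. decay (x - y) * \<psi> y \<partial>lborel) \<le> (\<integral>y. q n y \<partial>lborel)"
      by (intro integral_mono' qint le) (use \<psi> in \<open>auto simp: q_def\<close>)
    moreover have "0 \<le> (\<integral>y. decay (x - y) * \<psi> y \<partial>lborel)"
      by (intro Bochner_Integration.integral_nonneg) (use \<psi> in auto)
    ultimately show ?thesis using n by linarith
  qed
  then show "\<exists>b. \<forall>x. b \<le> norm x \<longrightarrow> dist (\<integral>y. decay (x - y) * \<psi> y \<partial>lborel) 0 < e"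
    by (auto simp: dist_real_def)
qed

text \<open>The bounded error s contributes at most K s 2^d at every x; the integrable part vanishes
  at infinity.\<close>

lemma convolution_tendsto_0:
  fixes k :: "'a::euclidean_space \<Rightarrow> real"
  assumes k: "decay_kernel K k" and h: "almost_integrable h"
  shows "(convolution k h \<longlongrightarrow> 0) at_infinity"
  unfolding tendsto_iff dist_real_def
proof (intro allI impI)
  fix e :: real assume e: "e > 0"
  have "\<bar>k 0\<bar> \<le> K * decay (0::'a)" using k by (auto simp: decay_kernel_def)
  then have K: "K \<ge> 0" by (simp add: decay_eq)
  \<comment> \<open>Chosen so that s 2^d equals e / (2 (K + 1)), the same share that is allotted to
    the integral; \<open>K + 1\<close> makes the final inequality strict.\<close>
  define s where "s = e / (2 * (K + 1) * 2 ^ DIM('a))"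
  have s: "s > 0" using e K by (simp add: s_def)
  then obtain \<psi> where \<psi>: "dominated s \<psi> h" using h by (auto simp: almost_integrable_def)
  have "((\<lambda>x. \<integral>y. decay (x - y) * \<psi> y \<partial>lborel) \<longlongrightarrow> 0) at_infinity"
    using \<psi> by (intro integral_decay_tendsto_0) (auto simp: dominated_def)
  then have "\<forall>\<^sub>F x in at_infinity. \<bar>\<integral>y. decay (x - y) * \<psi> y \<partial>lborel\<bar> < e / (2 * (K + 1))"
    using K e unfolding tendsto_iff dist_real_def by simp
  then show "\<forall>\<^sub>F x in at_infinity. \<bar>convolution k h x - 0\<bar> < e"
  proof eventually_elim
    case (elim x)
    have "\<bar>convolution k h x\<bar> \<le> K * (s * 2 ^ DIM('a) + (\<integral>y. decay (x - y) * \<psi> y \<partial>lborel))"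
      by (rule convolution_le_decay[OF k \<psi>]) (use s in simp)
    also have "\<dots> \<le> K * (e / (2 * (K + 1)) + e / (2 * (K + 1)))"
      using elim K by (intro mult_left_mono add_mono) (auto simp: s_def)
    also have "\<dots> = K * (e / (K + 1))" using K by (simp add: divide_simps)
    also have "\<dots> < e" using K e by (simp add: field_simps)
    finally show ?case by simp
  qed
qed


section \<open>The Gaussian kernel and its derivative\<close>

text \<open>The direction comes before the point, so that \<open>gaussian_deriv \<tau> b\<close> is
  itself a kernel.\<close>

definition gaussian_deriv :: "real \<Rightarrow> 'a \<Rightarrow> 'a::euclidean_space \<Rightarrow> real" where
  "gaussian_deriv \<tau> s z = - ((z \<bullet> s) / \<tau>\<^sup>2) * gaussian \<tau> z"

lemma gaussian_nonneg: "\<tau> > 0 \<Longrightarrow> gaussian \<tau> z \<ge> 0"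
  by (simp add: gaussian_def)

lemma gaussian_measurable [measurable]: "gaussian \<tau> \<in> borel_measurable borel"
  unfolding gaussian_def by measurable

lemma gaussian_deriv_measurable [measurable]: "gaussian_deriv \<tau> s \<in> borel_measurable borel"
  unfolding gaussian_deriv_def by measurable

text \<open>Factoring out the unshifted Gaussian reduces increments and remainders to those of the
  scalar exponential, at an exponent of order |s| (1 + |z|) for |s| <= 1.\<close>

lemma gaussian_add:
  "gaussian \<tau> (z + s) = gaussian \<tau> z * exp (- ((2 * (z \<bullet> s) + (norm s)\<^sup>2) / (2 * \<tau>\<^sup>2)))"
proof -
  have "(norm (z + s))\<^sup>2 = (norm z)\<^sup>2 + (2 * (z \<bullet> s) + (norm s)\<^sup>2)"
    by (simp add: power2_norm_eq_inner inner_add_left inner_add_right inner_commute)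
  then have eq: "- (norm (z + s))\<^sup>2 / (2 * \<tau>\<^sup>2)
      = - (norm z)\<^sup>2 / (2 * \<tau>\<^sup>2) + - ((2 * (z \<bullet> s) + (norm s)\<^sup>2) / (2 * \<tau>\<^sup>2))"
    by (simp only: minus_add_distrib add_divide_distrib minus_divide_left)
  show ?thesis
    unfolding gaussian_def eq exp_add by simp
qed

lemma abs_exp_minus_1_le: "\<bar>exp t - 1\<bar> \<le> \<bar>t\<bar> * exp \<bar>t\<bar>" for t :: real
proof (cases "t \<ge> 0")
  case True
  have "(1 - t) * exp t \<le> exp (- t) * exp t"
    using exp_ge_add_one_self[of "- t"] by (intro mult_right_mono) auto
  then have "exp t - 1 \<le> t * exp t" by (simp add: exp_minus algebra_simps)
  then show ?thesis using True by simp
next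
  case False
  have "1 - exp t \<le> - t" using exp_ge_add_one_self[of t] by linarith
  also have "\<dots> \<le> - t * exp (- t)" using False by (simp add: mult_le_cancel_left1)
  finally show ?thesis using False by simp
qed

text \<open>The mean value theorem gives \<open>exp t - 1 = t * exp c\<close> with c between 0 and
  t, so the remainder is t times \<open>exp c - 1\<close>, and the first-order bound supplies the
  second factor t.\<close>

lemma abs_exp_minus_1_minus_le: "\<bar>exp t - 1 - t\<bar> \<le> t\<^sup>2 * exp \<bar>t\<bar>" for t :: real
proof (cases "t = 0")
  case False
  have "\<exists>c. (0 < c \<and> c < t \<or> t < c \<and> c < 0) \<and> exp t - exp 0 - 0 = (t - 0) * exp c"
  proof (cases "t > 0")
    case True
    then show ?thesis using MVT2[of 0 t exp exp] by (auto intro!: derivative_eq_intros)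
  next
    case f: False
    then obtain c where "t < c" "c < 0" "exp 0 - exp t = (0 - t) * exp c"
      using MVT2[of t 0 exp exp] False by (auto intro!: derivative_eq_intros)
    then show ?thesis by (intro exI[of _ c]) (auto simp: algebra_simps)
  qed
  then obtain c where c: "\<bar>c\<bar> \<le> \<bar>t\<bar>" "exp t - 1 = t * exp c" by auto
  have "exp t - 1 - t = t * (exp c - 1)" using c by (simp add: algebra_simps)
  then have "\<bar>exp t - 1 - t\<bar> = \<bar>t\<bar> * \<bar>exp c - 1\<bar>" by (simp add: abs_mult)
  also have "\<dots> \<le> \<bar>t\<bar> * (\<bar>t\<bar> * exp \<bar>t\<bar>)"
    using c by (intro mult_left_mono order_trans[OF abs_exp_minus_1_le] mult_mono) auto
  finally show ?thesis by (simp add: power2_eq_square mult.assoc[symmetric])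
qed simp

text \<open>Completing the square shows that the quadratic exponent beats any linear one. The term
  \<open>(2 * norm z + 1) / (2 * \<tau>\<^sup>2)\<close> bounds the change of the exponent under
  shifts of length at most 1, and the Taylor estimates use up at most three exponentials of
  it.\<close>

lemma gaussian_exp_le_decay:
  assumes "\<tau> > 0"
  shows "\<exists>K\<ge>0. \<forall>z::'a::euclidean_space.
    gaussian \<tau> z * exp (3 * ((2 * norm z + 1) / (2 * \<tau>\<^sup>2))) \<le> K * decay z"
proof -
  define A where "A = 1 / ((2 * pi) powr (DIM('a) / 2) * \<tau> ^ DIM('a))"
  have A: "A \<ge> 0" using assms by (simp add: A_def)
  \<comment> \<open>m is the linear growth to be absorbed: 3 / \<tau>^2 from the exponential factor
    and the dimension from the lower bound of \<open>decay\<close>; c collects the constants left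
    after completing the square.\<close>
  define m where "m = 3 / \<tau>\<^sup>2 + DIM('a)"
  define c where "c = 3 / (2 * \<tau>\<^sup>2) + m\<^sup>2 * \<tau>\<^sup>2 / 2"
  have "gaussian \<tau> z * exp (3 * ((2 * norm z + 1) / (2 * \<tau>\<^sup>2))) \<le> A * exp c * decay z" for z :: 'a
  proof -
    have "0 \<le> (norm z / \<tau> - m * \<tau>)\<^sup>2" by simp
    also have "\<dots> = (norm z)\<^sup>2 / \<tau>\<^sup>2 - 2 * m * norm z + m\<^sup>2 * \<tau>\<^sup>2"
      using assms by (simp add: power2_diff power_divide power_mult_distrib)
    finally have "m * norm z \<le> (norm z)\<^sup>2 / (2 * \<tau>\<^sup>2) + m\<^sup>2 * \<tau>\<^sup>2 / 2" by (simp add: field_simps)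
    then have "- (norm z)\<^sup>2 / (2 * \<tau>\<^sup>2) + 3 * ((2 * norm z + 1) / (2 * \<tau>\<^sup>2)) \<le> c - DIM('a) * norm z"
      unfolding c_def m_def by (simp add: add_divide_distrib distrib_left distrib_right)
    then have "exp (- (norm z)\<^sup>2 / (2 * \<tau>\<^sup>2) + 3 * ((2 * norm z + 1) / (2 * \<tau>\<^sup>2)))
        \<le> exp (c + - (DIM('a) * norm z))" by simp
    also have "\<dots> \<le> exp c * decay z"
      unfolding exp_add by (intro mult_left_mono exp_norm_le_decay) auto
    finally have "A * exp (- (norm z)\<^sup>2 / (2 * \<tau>\<^sup>2) + 3 * ((2 * norm z + 1) / (2 * \<tau>\<^sup>2)))
        \<le> A * (exp c * decay z)" using A by (intro mult_left_mono)
    then show ?thesis unfolding exp_add by (simp add: gaussian_def A_def)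
  qed
  then show ?thesis using A by (intro exI[of _ "A * exp c"]) auto
qed

text \<open>After factoring out the Gaussian, every error is a power of |s| times a polynomial in
  |z| times exponentials linear in |z|. Bounding the polynomials by exponentials leaves at most
  \<open>exp (3 * \<beta> z)\<close>, which \<open>gaussian_exp_le_decay\<close> absorbs.\<close>

lemma gaussian_bounds:
  assumes "\<tau> > 0"
  obtains K where "K \<ge> 0"
    "\<And>z::'a::euclidean_space. \<bar>gaussian \<tau> z\<bar> \<le> K * decay z"
    "\<And>s z::'a. \<bar>gaussian_deriv \<tau> s z\<bar> \<le> K * norm s * decay z"
    "\<And>s z::'a. norm s \<le> 1 \<Longrightarrow>
      \<bar>gaussian \<tau> (z + s) - gaussian \<tau> z - gaussian_deriv \<tau> s z\<bar> \<le> K * (norm s)\<^sup>2 * decay z"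
    "\<And>b s z::'a. norm s \<le> 1 \<Longrightarrow>
      \<bar>gaussian_deriv \<tau> b (z + s) - gaussian_deriv \<tau> b z\<bar> \<le> K * norm b * norm s * decay z"
proof -
  obtain K where K: "K \<ge> 0"
    "\<And>z::'a. gaussian \<tau> z * exp (3 * ((2 * norm z + 1) / (2 * \<tau>\<^sup>2))) \<le> K * decay z"
    using gaussian_exp_le_decay[OF assms] by blast
  define \<beta> where "\<beta> z = (2 * norm z + 1) / (2 * \<tau>\<^sup>2)" for z :: 'a
  define E where "E z = gaussian \<tau> z * exp (3 * \<beta> z)" for z :: 'a
  have \<beta>: "\<beta> z \<ge> 0" for z by (simp add: \<beta>_def)
  have \<beta>_le: "\<beta> z \<le> exp (\<beta> z)" for z using exp_ge_add_one_self[of "\<beta> z"] by linarith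
  have \<beta>1: "norm z / \<tau>\<^sup>2 \<le> \<beta> z" "1 / (2 * \<tau>\<^sup>2) \<le> \<beta> z" for z
    using assms by (auto simp: \<beta>_def field_simps)
  have E_le: "E z \<le> K * decay z" for z using K(2) by (simp add: E_def \<beta>_def)
  have g0: "gaussian \<tau> z \<ge> 0" for z :: 'a using assms by (rule gaussian_nonneg)
  have E0: "E z \<ge> 0" for z using g0 by (simp add: E_def)
  have gE: "gaussian \<tau> z * exp (c * \<beta> z) \<le> E z" if "c \<le> 3" for c z
    unfolding E_def using that \<beta> g0 by (intro mult_left_mono) (auto intro: mult_right_mono)
  \<comment> \<open>\<theta> is the amount by which the shift by s lowers the exponent of the
    Gaussian.\<close>
  define \<theta> where "\<theta> z s = (2 * (z \<bullet> s) + (norm s)\<^sup>2) / (2 * \<tau>\<^sup>2)" for z s :: 'a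
  have \<theta>_eq: "\<theta> z s = (z \<bullet> s) / \<tau>\<^sup>2 + (norm s)\<^sup>2 / (2 * \<tau>\<^sup>2)" for z s
    by (simp add: \<theta>_def add_divide_distrib)
  have \<theta>: "\<bar>\<theta> z s\<bar> \<le> norm s * \<beta> z" "\<bar>\<theta> z s\<bar> \<le> \<beta> z" if "norm s \<le> 1" for z s
  proof -
    have "\<bar>2 * (z \<bullet> s) + (norm s)\<^sup>2\<bar> \<le> 2 * (norm z * norm s) + norm s * norm s"
      using Cauchy_Schwarz_ineq2[of z s] mult_nonneg_nonneg[OF norm_ge_zero norm_ge_zero, of s s]
      unfolding power2_eq_square by (intro abs_leI) linarith+
    also have "\<dots> \<le> 2 * (norm z * norm s) + norm s * 1"
      using that by (intro add_left_mono mult_left_mono) auto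
    finally have "\<bar>2 * (z \<bullet> s) + (norm s)\<^sup>2\<bar> \<le> norm s * (2 * norm z + 1)" by (simp add: algebra_simps)
    then show 1: "\<bar>\<theta> z s\<bar> \<le> norm s * \<beta> z"
      using assms by (simp add: \<theta>_def \<beta>_def divide_right_mono)
    show "\<bar>\<theta> z s\<bar> \<le> \<beta> z"
      using 1 mult_right_mono[OF that \<beta>[of z]] by simp
  qed
  have g_add: "gaussian \<tau> (z + s) = gaussian \<tau> z * exp (- \<theta> z s)" for z s
    by (simp add: gaussian_add \<theta>_def)
  have gd: "\<bar>gaussian \<tau> (z + s) - gaussian \<tau> z\<bar> \<le> norm s * (gaussian \<tau> z * exp (2 * \<beta> z))"
    if "norm s \<le> 1" for z s
  proof -
    have "gaussian \<tau> (z + s) - gaussian \<tau> z = gaussian \<tau> z * (exp (- \<theta> z s) - 1)"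
      unfolding g_add by (simp add: right_diff_distrib)
    also have "\<bar>\<dots>\<bar> \<le> gaussian \<tau> z * (\<bar>- \<theta> z s\<bar> * exp \<bar>- \<theta> z s\<bar>)"
      unfolding abs_mult using g0[of z] by (intro mult_mono abs_exp_minus_1_le) auto
    also have "\<dots> \<le> gaussian \<tau> z * ((norm s * \<beta> z) * exp (\<beta> z))"
      using \<theta>[OF that, of z] g0[of z] \<beta>[of z] by (intro mult_left_mono mult_mono) auto
    also have "\<dots> \<le> gaussian \<tau> z * ((norm s * exp (\<beta> z)) * exp (\<beta> z))"
      using \<beta>_le[of z] g0[of z] by (intro mult_left_mono mult_right_mono) auto
    also have "\<dots> = norm s * (gaussian \<tau> z * exp (2 * \<beta> z))"
      by (simp add: mult_exp_exp)
    finally show ?thesis .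
  qed
  have gdE: "\<bar>gaussian \<tau> (z + s) - gaussian \<tau> z\<bar> \<le> norm s * E z" if "norm s \<le> 1" for z s
    using gd[OF that, of z] mult_left_mono[OF gE[of 2 z], of "norm s"] by simp
  have zb: "\<bar>(z \<bullet> b) / \<tau>\<^sup>2\<bar> \<le> norm b * \<beta> z" for z b :: 'a
  proof -
    have "\<bar>(z \<bullet> b) / \<tau>\<^sup>2\<bar> \<le> norm b * (norm z / \<tau>\<^sup>2)"
      using divide_right_mono[OF Cauchy_Schwarz_ineq2[of z b], of "\<tau>\<^sup>2"] by (simp add: mult.commute)
    also have "\<dots> \<le> norm b * \<beta> z" using \<beta>1 by (intro mult_left_mono) auto
    finally show ?thesis .
  qed
  have 1: "\<bar>gaussian \<tau> z\<bar> \<le> 6 * K * decay z" for z :: 'a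
    using gE[of 0 z] E_le[of z] g0[of z] E0[of z] by simp
  have 2: "\<bar>gaussian_deriv \<tau> s z\<bar> \<le> norm s * E z" for s z
  proof -
    have "\<bar>gaussian_deriv \<tau> s z\<bar> \<le> (norm s * \<beta> z) * gaussian \<tau> z"
      unfolding gaussian_deriv_def abs_mult using zb[of z s] g0[of z] \<beta>[of z] by (intro mult_mono) auto
    also have "\<dots> \<le> (norm s * exp (\<beta> z)) * gaussian \<tau> z"
      using \<beta>_le[of z] g0[of z] by (intro mult_left_mono mult_right_mono) auto
    also have "\<dots> = norm s * (gaussian \<tau> z * exp (1 * \<beta> z))" by simp
    also have "\<dots> \<le> norm s * E z" by (intro mult_left_mono gE) auto
    finally show ?thesis .
  qed
  have 3: "\<bar>gaussian \<tau> (z + s) - gaussian \<tau> z - gaussian_deriv \<tau> s z\<bar> \<le> 2 * (norm s)\<^sup>2 * E z"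
    if "norm s \<le> 1" for s z
  proof -
    \<comment> \<open>Multiplied by the Gaussian, the part of -\<theta> linear in s is exactly
      \<open>gaussian_deriv\<close>; the rest of \<theta>, |s|^2 / (2 \<tau>^2), is already
      quadratic and joins the remainder of the exponential.\<close>
    have "gaussian \<tau> (z + s) - gaussian \<tau> z - gaussian_deriv \<tau> s z
        = gaussian \<tau> z * ((exp (- \<theta> z s) - 1 - (- \<theta> z s)) - (norm s)\<^sup>2 / (2 * \<tau>\<^sup>2))"
      unfolding g_add by (simp add: gaussian_deriv_def \<theta>_eq algebra_simps)
    also have "\<bar>\<dots>\<bar> \<le> gaussian \<tau> z * (((norm s)\<^sup>2 * exp (3 * \<beta> z)) + (norm s)\<^sup>2 * exp (3 * \<beta> z))"
      unfolding abs_mult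
    proof (rule mult_mono)
      have "\<bar>exp (- \<theta> z s) - 1 - (- \<theta> z s)\<bar> \<le> (- \<theta> z s)\<^sup>2 * exp \<bar>- \<theta> z s\<bar>"
        by (rule abs_exp_minus_1_minus_le)
      also have "\<dots> \<le> (norm s * exp (\<beta> z))\<^sup>2 * exp (\<beta> z)"
      proof (rule mult_mono)
        have "\<bar>\<theta> z s\<bar> \<le> norm s * exp (\<beta> z)"
          by (rule order_trans[OF \<theta>(1)[OF that] mult_left_mono[OF \<beta>_le]]) simp
        then show "(- \<theta> z s)\<^sup>2 \<le> (norm s * exp (\<beta> z))\<^sup>2"
          by (metis abs_ge_zero power2_abs power2_minus power_mono)
      qed (use \<theta>[OF that, of z] in auto)
      also have "\<dots> = (norm s)\<^sup>2 * exp (3 * \<beta> z)"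
        by (simp add: power_mult_distrib exp_double[symmetric] mult_exp_exp)
      finally have a: "\<bar>exp (- \<theta> z s) - 1 - (- \<theta> z s)\<bar> \<le> (norm s)\<^sup>2 * exp (3 * \<beta> z)" .
      have "(norm s)\<^sup>2 * (1 / (2 * \<tau>\<^sup>2)) \<le> (norm s)\<^sup>2 * exp (3 * \<beta> z)"
        using \<beta>1(2)[of z] \<beta>_le[of "z"] \<beta>[of z]
        by (intro mult_left_mono) (auto intro: order_trans[of _ "exp (\<beta> z)"])
      then have b: "\<bar>(norm s)\<^sup>2 / (2 * \<tau>\<^sup>2)\<bar> \<le> (norm s)\<^sup>2 * exp (3 * \<beta> z)" by simp
      show "\<bar>exp (- \<theta> z s) - 1 - (- \<theta> z s) - (norm s)\<^sup>2 / (2 * \<tau>\<^sup>2)\<bar>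
          \<le> (norm s)\<^sup>2 * exp (3 * \<beta> z) + (norm s)\<^sup>2 * exp (3 * \<beta> z)"
        using a b by linarith
    qed (use g0[of z] in auto)
    also have "\<dots> = 2 * (norm s)\<^sup>2 * E z" by (simp add: E_def)
    finally show ?thesis .
  qed
  have 4: "\<bar>gaussian_deriv \<tau> b (z + s) - gaussian_deriv \<tau> b z\<bar> \<le> 3 * norm b * norm s * E z"
    if s: "norm s \<le> 1" for b s z
  proof -
    have "gaussian_deriv \<tau> b (z + s) - gaussian_deriv \<tau> b z
        = - ((z \<bullet> b) / \<tau>\<^sup>2) * (gaussian \<tau> (z + s) - gaussian \<tau> z)
          - ((s \<bullet> b) / \<tau>\<^sup>2) * gaussian \<tau> (z + s)"
      by (simp add: gaussian_deriv_def inner_add_left add_divide_distrib diff_divide_distrib algebra_simps)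
    also have "\<bar>\<dots>\<bar> \<le> \<bar>- ((z \<bullet> b) / \<tau>\<^sup>2) * (gaussian \<tau> (z + s) - gaussian \<tau> z)\<bar>
        + \<bar>((s \<bullet> b) / \<tau>\<^sup>2) * gaussian \<tau> (z + s)\<bar>" by (rule abs_triangle_ineq4)
    also have "\<dots> \<le> norm b * norm s * E z + 2 * norm b * norm s * E z"
    proof (rule add_mono)
      have "\<bar>- ((z \<bullet> b) / \<tau>\<^sup>2) * (gaussian \<tau> (z + s) - gaussian \<tau> z)\<bar>
          \<le> (norm b * \<beta> z) * (norm s * (gaussian \<tau> z * exp (2 * \<beta> z)))"
        unfolding abs_mult using zb[of z b] gd[OF s, of z] \<beta>[of z] by (intro mult_mono) auto
      also have "\<dots> \<le> (norm b * exp (\<beta> z)) * (norm s * (gaussian \<tau> z * exp (2 * \<beta> z)))"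
        using \<beta>_le[of z] g0[of z] by (intro mult_right_mono mult_left_mono) auto
      also have "\<dots> = norm b * norm s * E z"
        by (simp add: E_def mult_exp_exp)
      finally show "\<bar>- ((z \<bullet> b) / \<tau>\<^sup>2) * (gaussian \<tau> (z + s) - gaussian \<tau> z)\<bar>
          \<le> norm b * norm s * E z" .
      have "\<bar>(s \<bullet> b) / \<tau>\<^sup>2\<bar> \<le> norm s * norm b * (2 * (1 / (2 * \<tau>\<^sup>2)))"
        using divide_right_mono[OF Cauchy_Schwarz_ineq2[of s b], of "\<tau>\<^sup>2"] by simp
      also have "\<dots> \<le> norm s * norm b * (2 * \<beta> z)"
        using \<beta>1 by (intro mult_left_mono) auto
      also have "\<dots> \<le> norm s * norm b * (2 * exp (\<beta> z))"
        using \<beta>_le[of z] by (intro mult_left_mono) auto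
      finally have a: "\<bar>(s \<bullet> b) / \<tau>\<^sup>2\<bar> \<le> norm s * norm b * (2 * exp (\<beta> z))" .
      have "gaussian \<tau> (z + s) \<le> gaussian \<tau> z * exp (\<beta> z)"
        unfolding g_add using \<theta>(2)[OF s, of z] g0[of z] by (intro mult_left_mono) auto
      then have "\<bar>((s \<bullet> b) / \<tau>\<^sup>2) * gaussian \<tau> (z + s)\<bar>
          \<le> (norm s * norm b * (2 * exp (\<beta> z))) * (gaussian \<tau> z * exp (\<beta> z))"
        unfolding abs_mult using a g0[of "z + s"] by (intro mult_mono) auto
      also have "\<dots> = 2 * norm b * norm s * (gaussian \<tau> z * exp (2 * \<beta> z))"
        by (simp add: mult_exp_exp)
      also have "\<dots> \<le> 2 * norm b * norm s * E z"
        by (intro mult_left_mono gE) auto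
      finally show "\<bar>((s \<bullet> b) / \<tau>\<^sup>2) * gaussian \<tau> (z + s)\<bar> \<le> 2 * norm b * norm s * E z" .
    qed
    finally show ?thesis by (simp add: mult_ac)
  qed
  \<comment> \<open>The estimates above carry factors 1, 2 and 3 in front of \<open>E\<close>; the
    common constant \<open>6 * K\<close> covers them all.\<close>
  have c: "x \<le> 6 * K * c * decay z" if "x \<le> a * c * E z" "0 \<le> a" "a \<le> 6" "0 \<le> c" for x a c z
  proof -
    have "a * c * E z \<le> 6 * c * (K * decay z)"
      using that E_le[of z] E0[of z] by (intro mult_mono) auto
    then show ?thesis using that(1) by (simp add: mult_ac)
  qed
  show ?thesis
  proof (rule that[of "6 * K"])
    show "6 * K \<ge> 0" using K by simp
    show "\<bar>gaussian_deriv \<tau> s z\<bar> \<le> 6 * K * norm s * decay z" for s z :: 'a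
      using 2[of s z] by (intro c[of _ 1]) auto
    show "\<bar>gaussian \<tau> (z + s) - gaussian \<tau> z - gaussian_deriv \<tau> s z\<bar>
        \<le> 6 * K * (norm s)\<^sup>2 * decay z" if "norm s \<le> 1" for s z :: 'a
      using 3[OF that, of z] by (intro c[of _ 2]) auto
    show "\<bar>gaussian_deriv \<tau> b (z + s) - gaussian_deriv \<tau> b z\<bar>
        \<le> 6 * K * norm b * norm s * decay z" if "norm s \<le> 1" for b s z :: 'a
      using c[of _ 3 "norm b * norm s" z] 4[OF that, of b z] by (simp add: mult_ac)
  qed (rule 1)
qed


section \<open>Convolution with the Gaussian is of class C1\<close>

text \<open>The remainder divided by |s| is at most N |s|, which tends to 0. Taylor estimates of
  second order thus turn directly into Frechet derivatives.\<close>

lemma has_derivative_quadraticI: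
  assumes D: "bounded_linear D"
    and le: "\<And>s. norm s \<le> 1 \<Longrightarrow> norm (f (x + s) - f x - D s) \<le> N * (norm s)\<^sup>2"
  shows "(f has_derivative D) (at x)"
  unfolding has_derivative_at
proof (intro conjI D)
  have lim: "(\<lambda>s. N * norm s) \<midarrow>0\<rightarrow> 0"
    by (auto intro!: tendsto_eq_intros)
  have "\<forall>\<^sub>F s in at 0. norm (norm (f (x + s) - f x - D s) / norm s) \<le> N * norm s"
    unfolding eventually_at
  proof (intro exI[of _ 1] conjI ballI impI)
    fix s :: 'a assume "s \<noteq> 0 \<and> dist s 0 < 1"
    then show "norm (norm (f (x + s) - f x - D s) / norm s) \<le> N * norm s"
      using le[of s] by (simp add: divide_le_eq power2_eq_square mult.assoc)
  qed simp
  then show "(\<lambda>s. norm (f (x + s) - f x - D s) / norm s) \<midarrow>0\<rightarrow> 0"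
    by (rule Lim_null_comparison[OF _ lim])
qed

lemma decay_kernel_gaussian:
  assumes "\<tau> > 0"
  obtains K where "K \<ge> 0" "decay_kernel K (gaussian \<tau> :: 'a::euclidean_space \<Rightarrow> real)"
    "\<And>s::'a. decay_kernel (K * norm s) (gaussian_deriv \<tau> s)"
    "\<And>s::'a. norm s \<le> 1 \<Longrightarrow>
      decay_kernel (K * (norm s)\<^sup>2) (\<lambda>z. gaussian \<tau> (z + s) - gaussian \<tau> z - gaussian_deriv \<tau> s z)"
    "\<And>b s::'a. norm s \<le> 1 \<Longrightarrow>
      decay_kernel (K * norm b * norm s) (\<lambda>z. gaussian_deriv \<tau> b (z + s) - gaussian_deriv \<tau> b z)"
proof -
  obtain K where "K \<ge> 0"
    "\<And>z::'a::euclidean_space. \<bar>gaussian \<tau> z\<bar> \<le> K * decay z"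
    "\<And>s z::'a. \<bar>gaussian_deriv \<tau> s z\<bar> \<le> K * norm s * decay z"
    "\<And>s z::'a. norm s \<le> 1 \<Longrightarrow>
      \<bar>gaussian \<tau> (z + s) - gaussian \<tau> z - gaussian_deriv \<tau> s z\<bar> \<le> K * (norm s)\<^sup>2 * decay z"
    "\<And>b s z::'a. norm s \<le> 1 \<Longrightarrow>
      \<bar>gaussian_deriv \<tau> b (z + s) - gaussian_deriv \<tau> b z\<bar> \<le> K * norm b * norm s * decay z"
    using gaussian_bounds[OF assms] by blast
  then show ?thesis by (intro that[of K]) (auto simp: decay_kernel_def)
qed

lemma convolution_add:
  assumes "decay_kernel K k" "almost_integrable g" "almost_integrable h"
  shows "convolution k (\<lambda>y. g y + h y) x = convolution k g x + convolution k h x"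
  using convolution_integrable'[OF assms(1,2), of x] convolution_integrable'[OF assms(1,3), of x]
  by (simp add: convolution_def distrib_left)

lemma convolution_scale: "convolution k (\<lambda>y. c * h y) x = c * convolution k h x"
  unfolding convolution_def by (subst mult.left_commute) simp

context
  fixes \<tau> :: real and h :: "'a::euclidean_space \<Rightarrow> real"
  assumes \<tau>: "\<tau> > 0" and h: "almost_integrable h"
begin

text \<open>Differentiation under the integral is replaced by an estimate: the Taylor remainder of
  the Gaussian is itself a kernel with constant K |s|^2, and \<open>convolution_le\<close> carries
  this quadratic bound over to the convolution.\<close>

lemma convolution_gaussian_has_derivative:
  "(convolution (gaussian \<tau>) h has_derivative (\<lambda>s. convolution (gaussian_deriv \<tau> s) h x)) (at x)"
proof -
  obtain K where K: "K \<ge> 0" "decay_kernel K (gaussian \<tau> :: 'a \<Rightarrow> real)"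
    "\<And>s::'a. decay_kernel (K * norm s) (gaussian_deriv \<tau> s)"
    "\<And>s::'a. norm s \<le> 1 \<Longrightarrow>
      decay_kernel (K * (norm s)\<^sup>2) (\<lambda>z. gaussian \<tau> (z + s) - gaussian \<tau> z - gaussian_deriv \<tau> s z)"
    using decay_kernel_gaussian[OF \<tau>] by metis
  obtain \<psi> where \<psi>: "dominated 1 \<psi> h" using almost_integrableD[OF h] by blast
  define N where "N = 1 * 2 ^ DIM('a) + (\<integral>y. \<psi> y \<partial>lborel)"
  note int = convolution_integrable[OF _ \<psi>] and le = convolution_le[OF _ \<psi>, folded N_def]
  show ?thesis
  proof (rule has_derivative_quadraticI[where N = "K * N"])
    show "bounded_linear (\<lambda>s. convolution (gaussian_deriv \<tau> s) h x)"
    proof (rule bounded_linear_intro[where K = "K * N"])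
      show "convolution (gaussian_deriv \<tau> (s + t)) h x
          = convolution (gaussian_deriv \<tau> s) h x + convolution (gaussian_deriv \<tau> t) h x" for s t
      proof -
        have "gaussian_deriv \<tau> (s + t) z = gaussian_deriv \<tau> s z + gaussian_deriv \<tau> t z" for z
          by (simp add: gaussian_deriv_def inner_add_right add_divide_distrib algebra_simps)
        then show ?thesis
          using int[OF K(3)[of s], of x] int[OF K(3)[of t], of x]
          unfolding convolution_def by (simp add: distrib_right)
      qed
      show "convolution (gaussian_deriv \<tau> (c *\<^sub>R s)) h x
          = c *\<^sub>R convolution (gaussian_deriv \<tau> s) h x" for c s
      proof -
        have "gaussian_deriv \<tau> (c *\<^sub>R s) z = c * gaussian_deriv \<tau> s z" for z
          by (simp add: gaussian_deriv_def)
        then show ?thesis by (simp add: convolution_def mult.assoc)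
      qed
      show "norm (convolution (gaussian_deriv \<tau> s) h x) \<le> norm s * (K * N)" for s
        using le[OF K(3)[of s], of x] by (simp add: mult_ac)
    qed
    fix s :: 'a assume s: "norm s \<le> 1"
    have "convolution (gaussian \<tau>) h (x + s) - convolution (gaussian \<tau>) h x
        - convolution (gaussian_deriv \<tau> s) h x
        = convolution (\<lambda>z. gaussian \<tau> (z + s) - gaussian \<tau> z - gaussian_deriv \<tau> s z) h x"
      using int[OF K(2), of x] int[OF K(2), of "x + s"] int[OF K(3)[of s], of x]
      unfolding convolution_def
      by (simp add: left_diff_distrib diff_add_eq)
    then show "norm (convolution (gaussian \<tau>) h (x + s) - convolution (gaussian \<tau>) h x
        - convolution (gaussian_deriv \<tau> s) h x) \<le> K * N * (norm s)\<^sup>2"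
      using le[OF K(4)[OF s], of x] by (simp add: mult_ac)
  qed
qed

lemma partial_deriv_convolution:
  "partial_deriv b (convolution (gaussian \<tau>) h) = convolution (gaussian_deriv \<tau> b) h"
  using frechet_derivative_at[OF convolution_gaussian_has_derivative]
  by (auto simp: partial_deriv_def fun_eq_iff)

text \<open>The increment kernel has constant K |b| |s|, so the convolution satisfies a Lipschitz
  estimate for increments of length at most 1.\<close>

lemma continuous_on_convolution_gaussian_deriv:
  "continuous_on UNIV (convolution (gaussian_deriv \<tau> b) h)"
proof -
  obtain K where K: "K \<ge> 0"
    "\<And>s::'a. decay_kernel (K * norm s) (gaussian_deriv \<tau> s)"
    "\<And>b s::'a. norm s \<le> 1 \<Longrightarrow>
      decay_kernel (K * norm b * norm s) (\<lambda>z. gaussian_deriv \<tau> b (z + s) - gaussian_deriv \<tau> b z)"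
    using decay_kernel_gaussian[OF \<tau>] by metis
  obtain \<psi> where \<psi>: "dominated 1 \<psi> h" using almost_integrableD[OF h] by blast
  define N where "N = 1 * 2 ^ DIM('a) + (\<integral>y. \<psi> y \<partial>lborel)"
  note int = convolution_integrable[OF _ \<psi>] and le = convolution_le[OF _ \<psi>, folded N_def]
  have le': "\<bar>convolution (gaussian_deriv \<tau> b) h (x + s) - convolution (gaussian_deriv \<tau> b) h x\<bar>
      \<le> K * norm b * N * norm s" if s: "norm s \<le> 1" for x s
  proof -
    have "convolution (gaussian_deriv \<tau> b) h (x + s) - convolution (gaussian_deriv \<tau> b) h x
        = convolution (\<lambda>z. gaussian_deriv \<tau> b (z + s) - gaussian_deriv \<tau> b z) h x"
      using int[OF K(2)[of b], of "x + s"] int[OF K(2)[of b], of x]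
      unfolding convolution_def by (simp add: left_diff_distrib diff_add_eq)
    then show ?thesis
      using le[OF K(3)[OF s, of b], of x] by (simp add: mult_ac)
  qed
  have "isCont (convolution (gaussian_deriv \<tau> b) h) x" for x
  proof -
    have lim: "(\<lambda>s. K * norm b * N * norm s) \<midarrow>0\<rightarrow> 0"
      by (auto intro!: tendsto_eq_intros)
    have "\<forall>\<^sub>F s in at 0. norm (convolution (gaussian_deriv \<tau> b) h (x + s)
        - convolution (gaussian_deriv \<tau> b) h x) \<le> K * norm b * N * norm s"
      unfolding eventually_at using le' by (intro exI[of _ 1]) auto
    then have "(\<lambda>s. convolution (gaussian_deriv \<tau> b) h (x + s)
        - convolution (gaussian_deriv \<tau> b) h x) \<midarrow>0\<rightarrow> 0"
      by (rule Lim_null_comparison[OF _ lim])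
    then show ?thesis
      unfolding isCont_iff by (rule LIM_zero_cancel)
  qed
  then show ?thesis by (simp add: continuous_on_eq_continuous_at)
qed

lemma convolution_gaussian_bounded_C1: "convolution (gaussian \<tau>) h \<in> bounded_C1"
proof -
  obtain K where K: "K \<ge> 0" "decay_kernel K (gaussian \<tau> :: 'a \<Rightarrow> real)"
    "\<And>s::'a. decay_kernel (K * norm s) (gaussian_deriv \<tau> s)"
    using decay_kernel_gaussian[OF \<tau>] by metis
  obtain \<psi> where \<psi>: "dominated 1 \<psi> h" using almost_integrableD[OF h] by blast
  have "bounded (range (convolution k h))" if "decay_kernel C k" for C k
    unfolding bounded_iff using convolution_le[OF that \<psi>] by auto
  moreover have "convolution (gaussian \<tau>) h differentiable (at x)" for x
    using convolution_gaussian_has_derivative[of x] unfolding differentiable_def by blast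
  ultimately show ?thesis
    using K by (auto simp: bounded_C1_def partial_deriv_convolution
        continuous_on_convolution_gaussian_deriv)
qed

end

section \<open>Cutoff functions and a criterion for membership in C^1_0\<close>

lemma max_0_square_has_derivative:
  "((\<lambda>t::real. (max 0 t)\<^sup>2) has_derivative (\<lambda>s. 2 * max 0 t * s)) (at t)"
proof (rule has_derivative_quadraticI[where N = 1])
  show "bounded_linear (\<lambda>s. 2 * max 0 t * s)" by (rule bounded_linear_mult_right)
  fix s :: real
  consider "t \<ge> 0" "t + s \<ge> 0" | "t \<ge> 0" "t + s < 0" | "t < 0" "t + s \<ge> 0" | "t < 0" "t + s < 0"
    by linarith
  then have "\<bar>(max 0 (t + s))\<^sup>2 - (max 0 t)\<^sup>2 - 2 * max 0 t * s\<bar> \<le> s\<^sup>2"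
  proof cases
    case 1
    then show ?thesis by (simp add: power2_eq_square algebra_simps)
  next
    case 2
    have "t\<^sup>2 + 2 * t * s = (t + s)\<^sup>2 - s\<^sup>2" by (simp add: power2_eq_square algebra_simps)
    moreover have "(t + s)\<^sup>2 \<le> s\<^sup>2"
      using 2 by (intro abs_le_square_iff[THEN iffD1]) auto
    moreover have "max 0 (t + s) = 0" "max 0 t = t" using 2 by auto
    ultimately have "(max 0 (t + s))\<^sup>2 - (max 0 t)\<^sup>2 - 2 * max 0 t * s = s\<^sup>2 - (t + s)\<^sup>2"
      "(t + s)\<^sup>2 \<le> s\<^sup>2" by simp_all
    then show ?thesis by simp
  next
    case 3
    then have "(t + s)\<^sup>2 \<le> s\<^sup>2" by (intro power_mono) auto
    then show ?thesis using 3 by simp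
  qed simp
  then show "norm ((max 0 (t + s))\<^sup>2 - (max 0 t)\<^sup>2 - 2 * max 0 t * s) \<le> 1 * (norm s)\<^sup>2"
    by simp
qed

text \<open>A cutoff in closed form: 1 at the origin and, for \<epsilon> > 0, 0 outside the ball of
  radius 1 / \<epsilon>. Squaring makes the positive part continuously differentiable, and
  \<open>x \<bullet> x\<close> avoids the singularity of the norm at 0.\<close>

definition cutoff :: "real \<Rightarrow> 'a::euclidean_space \<Rightarrow> real" where
  "cutoff \<epsilon> x = (max 0 (1 - \<epsilon>\<^sup>2 * (x \<bullet> x)))\<^sup>2"

definition cutoff_deriv :: "real \<Rightarrow> 'a \<Rightarrow> 'a::euclidean_space \<Rightarrow> real" where
  "cutoff_deriv \<epsilon> s x = - (4 * \<epsilon>\<^sup>2) * max 0 (1 - \<epsilon>\<^sup>2 * (x \<bullet> x)) * (x \<bullet> s)"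

lemma cutoff_has_derivative:
  "(cutoff \<epsilon> has_derivative (\<lambda>s. cutoff_deriv \<epsilon> s x)) (at x)"
proof -
  have "((\<lambda>x. 1 - \<epsilon>\<^sup>2 * (x \<bullet> x)) has_derivative (\<lambda>s. - (\<epsilon>\<^sup>2 * (x \<bullet> s + s \<bullet> x)))) (at x)"
    by (auto intro!: derivative_eq_intros)
  from has_derivative_compose[OF this max_0_square_has_derivative] show ?thesis
    unfolding cutoff_def[abs_def] cutoff_deriv_def
    by (simp add: inner_commute algebra_simps)
qed

text \<open>The cutoff depends on x through \<epsilon> |x| alone. Its derivative is nonzero only
  where \<epsilon> |x| < 1, so one of the two factors \<epsilon> survives; the defect is bounded by
  1 - (1 - q)^2 <= 2 q.\<close>

lemma cutoff_bounds:
  assumes "\<epsilon> > 0" "b \<in> Basis"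
  shows "0 \<le> cutoff \<epsilon> x" "cutoff \<epsilon> x \<le> 1" "1 - cutoff \<epsilon> x \<le> 2 * \<epsilon>\<^sup>2 * (norm x)\<^sup>2"
    "\<bar>cutoff_deriv \<epsilon> b x\<bar> \<le> 4 * \<epsilon>" "norm x \<ge> 1 / \<epsilon> \<Longrightarrow> cutoff \<epsilon> x = 0"
proof -
  define q where "q = \<epsilon>\<^sup>2 * (x \<bullet> x)"
  have q: "q = (\<epsilon> * norm x)\<^sup>2" "q \<ge> 0"
    by (simp_all add: q_def power_mult_distrib power2_norm_eq_inner)
  have eq: "cutoff \<epsilon> x = (max 0 (1 - q))\<^sup>2" by (simp add: cutoff_def q_def)
  show "0 \<le> cutoff \<epsilon> x" "cutoff \<epsilon> x \<le> 1"
    using q(2) by (auto simp: eq intro: power_le_one)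
  have "1 - (max 0 (1 - q))\<^sup>2 \<le> 2 * q"
  proof (cases "q \<le> 1")
    case True
    then show ?thesis using zero_le_power2[of q] by (simp add: power2_diff)
  qed auto
  then show "1 - cutoff \<epsilon> x \<le> 2 * \<epsilon>\<^sup>2 * (norm x)\<^sup>2"
    by (simp add: eq q power_mult_distrib)
  show "cutoff \<epsilon> x = 0" if "norm x \<ge> 1 / \<epsilon>"
  proof -
    have "1 \<le> \<epsilon> * norm x" using that assms(1) by (simp add: field_simps)
    then have "q \<ge> 1" by (simp add: q one_le_power)
    then show ?thesis by (simp add: eq)
  qed
  show "\<bar>cutoff_deriv \<epsilon> b x\<bar> \<le> 4 * \<epsilon>"
  proof (cases "q \<le> 1")
    case True
    have "(\<epsilon> * norm x)\<^sup>2 \<le> 1\<^sup>2" using True q by simp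
    then have le: "\<epsilon> * norm x \<le> 1" using power2_le_imp_le zero_le_one by blast
    have "\<bar>cutoff_deriv \<epsilon> b x\<bar> = 4 * \<epsilon> * ((1 - q) * (\<epsilon> * \<bar>x \<bullet> b\<bar>))"
      using True assms(1) by (simp add: cutoff_deriv_def abs_mult q_def power2_eq_square)
    also have "\<dots> \<le> 4 * \<epsilon> * (1 * (\<epsilon> * norm x))"
      using True q assms by (intro mult_left_mono mult_mono) (auto simp: Basis_le_norm)
    also have "\<dots> \<le> 4 * \<epsilon> * 1" using le assms(1) by (intro mult_left_mono) auto
    finally show ?thesis by simp
  next
    case False
    then show ?thesis using assms(1) by (simp add: cutoff_deriv_def q_def)
  qed
qed

text \<open>Cutting off h at radius 1 / \<epsilon> multiplies h and its partial derivatives by the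
  cutoff and adds to the derivatives a term of order \<epsilon>. The decay of h handles the points
  far out, the flatness of the cutoff near 0 handles the others.\<close>

lemma closure_compactly_supportedI:
  fixes h :: "('a::euclidean_space, real) bC1"
  assumes lim: "(apply_bC1 h \<longlongrightarrow> 0) at_infinity"
    and dlim: "\<And>b. b \<in> Basis \<Longrightarrow> (partial_deriv b (apply_bC1 h) \<longlongrightarrow> 0) at_infinity"
  shows "h \<in> closure compactly_supported"
  unfolding closure_approachable
proof (intro allI impI)
  fix e :: real assume e: "e > 0"
  define e' where "e' = e / 3"
  have e': "e' > 0" using e by (simp add: e'_def)
  have "\<forall>\<^sub>F x in at_infinity. \<bar>apply_bC1 h x\<bar> < e' \<and>
      (\<forall>b\<in>Basis. \<bar>partial_deriv b (apply_bC1 h) x\<bar> < e')"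
    using tendstoD[OF lim e'] tendstoD[OF dlim e']
    by (intro eventually_conj eventually_ball_finite) (auto simp: dist_real_def)
  then obtain R where R: "\<And>x. norm x \<ge> R \<Longrightarrow> \<bar>apply_bC1 h x\<bar> < e'"
    "\<And>x b. norm x \<ge> R \<Longrightarrow> b \<in> Basis \<Longrightarrow> \<bar>partial_deriv b (apply_bC1 h) x\<bar> < e'"
    unfolding eventually_at_infinity by blast
  define B where "B = norm h + 1"
  have B: "B \<ge> 1" by (simp add: B_def)
  have hB: "\<bar>apply_bC1 h x\<bar> \<le> B" for x
    using norm_apply_bC1_le[of h x] by (simp add: B_def)
  have dB: "\<bar>partial_deriv b (apply_bC1 h) x\<bar> \<le> B" if "b \<in> Basis" for b x
    using norm_partial_bC1_le[OF that, of h x] by (simp add: B_def)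
  \<comment> \<open>The single condition 4 (R^2 + 1) B \<epsilon> <= e', together with \<epsilon> <=
    1, serves both the derivative of the cutoff, 4 \<epsilon> B, and its defect on the ball of
    radius R, 2 \<epsilon>^2 R^2 B.\<close>
  define \<epsilon> where "\<epsilon> = min 1 (e' / (4 * (R\<^sup>2 + 1) * B))"
  have \<epsilon>: "\<epsilon> > 0" "\<epsilon> \<le> 1" using e' B by (auto simp: \<epsilon>_def add_nonneg_pos)
  have "\<epsilon> \<le> e' / (4 * (R\<^sup>2 + 1) * B)" by (simp add: \<epsilon>_def)
  then have \<epsilon>R: "\<epsilon> * (4 * (R\<^sup>2 + 1) * B) \<le> e'"
    using B by (subst (asm) pos_le_divide_eq) (auto intro!: mult_pos_pos add_nonneg_pos)
  have 4: "4 * \<epsilon> * B \<le> e'"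
  proof -
    have "4 * \<epsilon> * B \<le> \<epsilon> * (4 * (R\<^sup>2 + 1) * B)" using \<epsilon> B by (simp add: algebra_simps)
    then show ?thesis using \<epsilon>R by linarith
  qed
  have 2: "2 * \<epsilon>\<^sup>2 * R\<^sup>2 * B \<le> e'"
  proof -
    have "\<epsilon>\<^sup>2 * (2 * R\<^sup>2 * B) \<le> \<epsilon> * (2 * R\<^sup>2 * B)"
      using \<epsilon> B by (intro mult_right_mono) (auto simp: power2_eq_square mult_le_cancel_left1)
    also have "\<dots> \<le> \<epsilon> * (4 * (R\<^sup>2 + 1) * B)"
      using \<epsilon> B by (intro mult_left_mono mult_right_mono) (auto simp: algebra_simps)
    finally show ?thesis using \<epsilon>R by (simp add: mult_ac)
  qed
  define w where "w x = cutoff \<epsilon> x * apply_bC1 h x" for x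
  define dw where "dw x s = cutoff \<epsilon> x * frechet_derivative (apply_bC1 h) (at x) s
      + cutoff_deriv \<epsilon> s x * apply_bC1 h x" for x s
  have dh: "(apply_bC1 h has_derivative frechet_derivative (apply_bC1 h) (at x)) (at x)" for x
    using bC1_differentiable[of h x] by (simp add: frechet_derivative_works)
  have w_deriv: "(w has_derivative dw x) (at x)" for x
    unfolding w_def[abs_def] dw_def[abs_def]
    by (rule has_derivative_mult[OF cutoff_has_derivative dh])
  have pw: "partial_deriv b w = (\<lambda>x. cutoff \<epsilon> x * partial_deriv b (apply_bC1 h) x
      + cutoff_deriv \<epsilon> b x * apply_bC1 h x)" for b
    using frechet_derivative_at[OF w_deriv] by (auto simp: partial_deriv_def dw_def fun_eq_iff)
  have prod_le: "\<bar>c * y\<bar> \<le> \<bar>y\<bar>" if "0 \<le> c" "c \<le> 1" for c y :: real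
    using that by (simp add: abs_mult mult_left_le_one_le)
  have w_C1: "w \<in> bounded_C1"
    unfolding bounded_C1_def
  proof (intro CollectI conjI allI ballI)
    show "w differentiable at x" for x using w_deriv by (auto simp: differentiable_def)
    have "\<bar>w x\<bar> \<le> B" for x
      unfolding w_def by (rule order_trans[OF prod_le[OF cutoff_bounds(1,2)[OF \<epsilon>(1) SOME_Basis]] hB])
    then show "bounded (range w)" unfolding bounded_iff by auto
    fix b :: 'a assume b: "b \<in> Basis"
    have ch: "continuous_on UNIV (apply_bC1 h)"
      using dh has_derivative_continuous continuous_at_imp_continuous_on by blast
    show "continuous_on UNIV (partial_deriv b w)"
      unfolding pw cutoff_def cutoff_deriv_def
      using apply_bC1[of h] b ch by (auto intro!: continuous_intros simp: bounded_C1_def)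
    have "\<bar>partial_deriv b w x\<bar> \<le> B + 4 * \<epsilon> * B" for x
    proof -
      have "\<bar>partial_deriv b w x\<bar> \<le> \<bar>cutoff \<epsilon> x * partial_deriv b (apply_bC1 h) x\<bar>
          + \<bar>cutoff_deriv \<epsilon> b x\<bar> * \<bar>apply_bC1 h x\<bar>"
        unfolding pw by (metis abs_mult abs_triangle_ineq)
      also have "\<dots> \<le> B + 4 * \<epsilon> * B"
        using order_trans[OF prod_le[OF cutoff_bounds(1,2)[OF \<epsilon>(1) b]] dB[OF b]]
          cutoff_bounds(4)[OF \<epsilon>(1) b] hB \<epsilon>(1) by (intro add_mono mult_mono) auto
      finally show ?thesis .
    qed
    then show "bounded (range (partial_deriv b w))" unfolding bounded_iff by auto
  qed
  have w_apply: "apply_bC1 (bC1 w) = w" using w_C1 by (rule bC1_inverse)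
  have "cutoff \<epsilon> x = 0" if "norm x > 1 / \<epsilon>" for x :: 'a
    by (rule cutoff_bounds(5)[OF \<epsilon>(1) SOME_Basis less_imp_le[OF that]])
  then have "{x. apply_bC1 (bC1 w) x \<noteq> 0} \<subseteq> cball 0 (1 / \<epsilon>)"
    unfolding w_apply w_def by (auto simp: not_less[symmetric])
  then have "bC1 w \<in> compactly_supported"
    unfolding compactly_supported_def by (auto intro: bounded_subset[OF bounded_cball])
  moreover have "norm (h - bC1 w) \<le> 2 * e'"
    unfolding norm_bC1_le_iff
  proof (intro conjI allI ballI)
    \<comment> \<open>Beyond R the value y is small and the weight at most 1; within R the weight is
      small and y at most B.\<close>
    have main: "\<bar>(1 - cutoff \<epsilon> x) * y\<bar> \<le> e'" if "\<bar>y\<bar> \<le> B" "norm x \<ge> R \<Longrightarrow> \<bar>y\<bar> < e'" for x :: 'a and y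
    proof (cases "norm x \<ge> R")
      case True
      then show ?thesis
        using that(2) prod_le[of "1 - cutoff \<epsilon> x" y] cutoff_bounds(1,2)[OF \<epsilon>(1) SOME_Basis, of x] by auto
    next
      case False
      have c: "0 \<le> 1 - cutoff \<epsilon> x" "1 - cutoff \<epsilon> x \<le> 2 * \<epsilon>\<^sup>2 * (norm x)\<^sup>2"
        using cutoff_bounds(2,3)[OF \<epsilon>(1) SOME_Basis, of x] by auto
      have "2 * \<epsilon>\<^sup>2 * (norm x)\<^sup>2 \<le> 2 * \<epsilon>\<^sup>2 * R\<^sup>2"
        using False by (intro mult_left_mono power_mono) auto
      then have "(1 - cutoff \<epsilon> x) * \<bar>y\<bar> \<le> (2 * \<epsilon>\<^sup>2 * R\<^sup>2) * B"
        using c that(1) by (intro mult_mono) auto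
      then show ?thesis using 2 c by (simp add: abs_mult)
    qed
    show "norm (apply_bC1 (h - bC1 w) x) \<le> 2 * e'" for x
      using main[OF hB[of x], of x, OF R(1)] e' by (simp add: w_apply w_def algebra_simps)
    fix b :: 'a and x assume b: "b \<in> Basis"
    have "((\<lambda>x. apply_bC1 h x - w x) has_derivative
        (\<lambda>s. frechet_derivative (apply_bC1 h) (at x) s - dw x s)) (at x)"
      by (rule has_derivative_diff[OF dh w_deriv])
    from frechet_derivative_at[OF this]
    have "partial_deriv b (apply_bC1 (h - bC1 w)) x
        = (1 - cutoff \<epsilon> x) * partial_deriv b (apply_bC1 h) x - cutoff_deriv \<epsilon> b x * apply_bC1 h x"
      by (simp add: partial_deriv_def w_apply dw_def fun_eq_iff algebra_simps)
    also have "\<bar>\<dots>\<bar> \<le> \<bar>(1 - cutoff \<epsilon> x) * partial_deriv b (apply_bC1 h) x\<bar>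
        + \<bar>cutoff_deriv \<epsilon> b x\<bar> * \<bar>apply_bC1 h x\<bar>"
      by (metis abs_mult abs_triangle_ineq4)
    also have "\<dots> \<le> e' + 4 * \<epsilon> * B"
      using main[OF dB[OF b, of x], of x, OF R(2)[OF _ b]] cutoff_bounds(4)[OF \<epsilon>(1) b, of x] hB[of x] \<epsilon>(1)
      by (intro add_mono mult_mono) auto
    also have "\<dots> \<le> 2 * e'" using 4 by simp
    finally show "norm (partial_deriv b (apply_bC1 (h - bC1 w)) x) \<le> 2 * e'" by simp
  qed
  ultimately show "\<exists>y\<in>compactly_supported. dist y h < e"
    using e by (intro bexI[of _ "bC1 w"]) (auto simp: dist_norm norm_minus_commute e'_def)
qed


section \<open>Smoothing as a bounded operator\<close>

lemma C10_eqI: "(\<And>x. C10_fun f x = C10_fun g x) \<Longrightarrow> f = g"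
  by (metis C10_fun_def bC1_eqI bC1_of_inject)

lemma C10_fun_add [simp]: "C10_fun (f + g) x = C10_fun f x + C10_fun g x"
  by (simp add: C10_fun_def)

lemma C10_fun_scaleR [simp]: "C10_fun (c *\<^sub>R f) x = c * C10_fun f x"
  by (simp add: C10_fun_def)

lemma norm_C10_le_iff:
  "norm f \<le> c \<longleftrightarrow> (\<forall>x. \<bar>C10_fun f x\<bar> \<le> c) \<and>
     (\<forall>b\<in>Basis. \<forall>x. \<bar>partial_deriv b (C10_fun f) x\<bar> \<le> c)"
  by (simp add: norm_C10_def norm_bC1_le_iff C10_fun_def)

lemma abs_C10_fun_le: "\<bar>C10_fun f x\<bar> \<le> norm f"
  using norm_C10_le_iff[of f "norm f"] by simp

lemma abs_partial_C10_le: "b \<in> Basis \<Longrightarrow> \<bar>partial_deriv b (C10_fun f) x\<bar> \<le> norm f"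
  using norm_C10_le_iff[of f "norm f"] by simp

lemma C10_fun_differentiable: "C10_fun f differentiable (at x)"
  by (simp add: C10_fun_def bC1_differentiable)

lemma C10_fun_measurable [measurable]: "C10_fun f \<in> borel_measurable borel"
  using C10_fun_differentiable
  by (intro borel_measurable_continuous_onI)
    (auto intro!: continuous_at_imp_continuous_on differentiable_imp_continuous_within)

lemma compactly_supported_outside:
  assumes "h \<in> compactly_supported"
  obtains R where "\<And>x. norm x > R \<Longrightarrow> apply_bC1 h x = 0"
    "\<And>b x. norm x > R \<Longrightarrow> partial_deriv b (apply_bC1 h) x = 0"
proof -
  have "bounded {x. apply_bC1 h x \<noteq> 0}"
    using assms bounded_subset[OF compact_imp_bounded closure_subset]
    by (auto simp: compactly_supported_def)
  then obtain R where "\<forall>x\<in>{x. apply_bC1 h x \<noteq> 0}. norm x \<le> R"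
    unfolding bounded_iff by blast
  then have R: "apply_bC1 h x = 0" if "norm x > R" for x using that by force
  have "(apply_bC1 h has_derivative (\<lambda>_. 0)) (at x)" if "norm x > R" for x
    by (rule has_derivative_transform_within_open[of "\<lambda>_. 0" _ _ UNIV "- cball 0 R"])
      (use that R in auto)
  from frechet_derivative_at[OF this]
  have "partial_deriv b (apply_bC1 h) x = 0" if "norm x > R" for b x
    using that unfolding partial_deriv_def by metis
  then show ?thesis using R that by blast
qed

text \<open>The converse of \<open>closure_compactly_supportedI\<close>: an approximant with compact
  support vanishes beyond some R together with its partial derivatives, so there f and its
  derivatives are bounded by the C^1 distance, which is below e / 2.\<close>

lemma C10_tendsto_0:
  shows C10_fun_tendsto_0: "(C10_fun f \<longlongrightarrow> 0) at_infinity"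
    and C10_partial_tendsto_0: "b \<in> Basis \<Longrightarrow> (partial_deriv b (C10_fun f) \<longlongrightarrow> 0) at_infinity"
proof -
  have ex: "\<exists>R. \<forall>x. R \<le> norm x \<longrightarrow> \<bar>C10_fun f x\<bar> < e \<and>
      (\<forall>b\<in>Basis. \<bar>partial_deriv b (C10_fun f) x\<bar> < e)" if e: "e > 0" for e
  proof -
    obtain h where h: "h \<in> compactly_supported" "dist h (bC1_of f) < e / 2"
      using bC1_of[of f] e half_gt_zero unfolding closure_approachable by blast
    obtain R where R: "\<And>x. norm x > R \<Longrightarrow> apply_bC1 h x = 0"
      "\<And>b x. norm x > R \<Longrightarrow> partial_deriv b (apply_bC1 h) x = 0"
      using compactly_supported_outside[OF h(1)] by metis
    have le: "norm (bC1_of f - h) < e / 2" using h(2) by (simp add: dist_norm norm_minus_commute)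
    have sum: "bC1_of f = (bC1_of f - h) + h" by simp
    have 1: "\<bar>C10_fun f x\<bar> < e" if "R + 1 \<le> norm x" for x
      using norm_apply_bC1_le[of "bC1_of f - h" x] le R(1)[of x] that e
      by (simp add: C10_fun_def)
    have 2: "\<bar>partial_deriv b (C10_fun f) x\<bar> < e" if "R + 1 \<le> norm x" "b \<in> Basis" for x b
    proof -
      have "partial_deriv b (C10_fun f) x = partial_deriv b (apply_bC1 (bC1_of f - h)) x"
        unfolding C10_fun_def
        by (subst sum, subst apply_bC1_add, subst partial_deriv_add)
          (use R(2)[of x] that bC1_differentiable[of "bC1_of f - h" x] in \<open>auto intro: bC1_differentiable\<close>)
      then show ?thesis
        using norm_partial_bC1_le[OF that(2), of "bC1_of f - h" x] le e by simp
    qed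
    show ?thesis using 1 2 by blast
  qed
  show "(C10_fun f \<longlongrightarrow> 0) at_infinity"
    unfolding Lim_at_infinity dist_real_def using ex by (metis diff_zero)
  show "(partial_deriv b (C10_fun f) \<longlongrightarrow> 0) at_infinity" if "b \<in> Basis"
    unfolding Lim_at_infinity dist_real_def using ex that by (metis diff_zero)
qed

lemma gradient_C10_add:
  "gradient (C10_fun (f + g)) x = gradient (C10_fun f) x + gradient (C10_fun g) x"
proof -
  have "C10_fun (f + g) = (\<lambda>x. C10_fun f x + C10_fun g x)" by auto
  then show ?thesis
    by (simp add: gradient_def partial_deriv_add C10_fun_differentiable scaleR_add_left sum.distrib)
qed

lemma gradient_C10_scaleR: "gradient (C10_fun (c *\<^sub>R f)) x = c *\<^sub>R gradient (C10_fun f) x"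
proof -
  have "C10_fun (c *\<^sub>R f) = (\<lambda>x. c *\<^sub>R C10_fun f x)" by auto
  then show ?thesis
    by (simp add: gradient_def partial_deriv_scaleR[OF C10_fun_differentiable, unfolded real_scaleR_def]
        scaleR_sum_right)
qed

lemma norm_gradient_C10_le: "norm (gradient (C10_fun f) x) \<le> DIM('a) * norm f"
  for f :: "'a::euclidean_space C10"
proof -
  have "norm (gradient (C10_fun f) x) \<le> (\<Sum>b\<in>(Basis::'a set). norm f)"
    unfolding gradient_def by (rule sum_norm_le) (simp add: abs_partial_C10_le)
  then show ?thesis by simp
qed

lemma gradient_C10_tendsto_0: "(gradient (C10_fun f) \<longlongrightarrow> 0) at_infinity"
proof -
  have "((\<lambda>x. \<Sum>b\<in>Basis. partial_deriv b (C10_fun f) x *\<^sub>R b) \<longlongrightarrow> (\<Sum>b\<in>Basis. 0 *\<^sub>R b)) at_infinity"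
    by (intro tendsto_sum tendsto_scaleR C10_partial_tendsto_0 tendsto_const)
  then show ?thesis by (simp add: gradient_def[abs_def])
qed

lemma gradient_C10_measurable [measurable]: "gradient (C10_fun f) \<in> borel_measurable borel"
  unfolding gradient_def[abs_def] C10_fun_def
  using apply_bC1[of "bC1_of f"]
  by (intro borel_measurable_continuous_onI) (auto intro!: continuous_intros simp: bounded_C1_def)

lemma apply_bC1_measurable [measurable]: "apply_bC1 h \<in> borel_measurable borel"
  for h :: "('a::euclidean_space, 'b::euclidean_space) bC1"
  using bC1_differentiable
  by (intro borel_measurable_continuous_onI)
    (auto intro!: continuous_at_imp_continuous_on differentiable_imp_continuous_within)

section \<open>The smoothing operator and its bounds\<close>

definition smoothing :: "real \<Rightarrow> ('a::euclidean_space \<Rightarrow> real) \<Rightarrow> 'a C10" where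
  "smoothing \<tau> h = to_C10 (convolution (gaussian \<tau>) h)"

text \<open>\<open>to_C10\<close> is meaningful only on C^1_0. Almost integrability supplies both
  requirements: the convolution is of class C1 with bounded derivatives, and it vanishes at infinity
  together with them.\<close>

lemma C10_fun_smoothing:
  assumes "\<tau> > 0" "almost_integrable h"
  shows "C10_fun (smoothing \<tau> h) = convolution (gaussian \<tau>) h"
proof -
  have C1: "convolution (gaussian \<tau>) h \<in> bounded_C1"
    using assms by (rule convolution_gaussian_bounded_C1)
  obtain K where K: "decay_kernel K (gaussian \<tau> :: 'a \<Rightarrow> real)"
    "\<And>s::'a. decay_kernel (K * norm s) (gaussian_deriv \<tau> s)"
    using decay_kernel_gaussian[OF assms(1)] by metis
  have "bC1 (convolution (gaussian \<tau>) h) \<in> closure compactly_supported"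
    by (rule closure_compactly_supportedI)
      (use K assms in \<open>auto simp: bC1_inverse[OF C1] partial_deriv_convolution
        intro: convolution_tendsto_0\<close>)
  then show ?thesis unfolding smoothing_def by (rule C10_fun_to_C10[OF C1])
qed

lemma smoothing_add:
  fixes g :: "'a::euclidean_space \<Rightarrow> real"
  assumes "\<tau> > 0" "almost_integrable g" "almost_integrable h"
  shows "smoothing \<tau> (\<lambda>y. g y + h y) = smoothing \<tau> g + smoothing \<tau> h"
proof -
  obtain K where "decay_kernel K (gaussian \<tau> :: 'a \<Rightarrow> real)"
    using decay_kernel_gaussian[OF assms(1)] by metis
  from convolution_add[OF this] show ?thesis
    by (intro C10_eqI) (simp add: C10_fun_smoothing assms almost_integrable_add)
qed

lemma smoothing_scale:
  assumes "\<tau> > 0" "almost_integrable h"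
  shows "smoothing \<tau> (\<lambda>y. c * h y) = c *\<^sub>R smoothing \<tau> h"
  by (rule C10_eqI) (simp add: C10_fun_smoothing assms almost_integrable_scale convolution_scale)

lemma smoothing_diff:
  assumes "\<tau> > 0" "almost_integrable g" "almost_integrable h"
  shows "smoothing \<tau> (\<lambda>y. g y - h y) = smoothing \<tau> g - smoothing \<tau> h"
  using smoothing_add[OF assms(1,2) almost_integrable_scale[OF assms(3), of "-1"]]
    smoothing_scale[OF assms(1,3), of "-1"] by simp

text \<open>K is uniform in h and in the choice of the majorant; the operator is therefore bounded
  for every norm that controls s plus the integral of \<psi> for some admissible pair.\<close>

lemma smoothing_norm_le:
  assumes "\<tau> > 0"
  obtains K where "K \<ge> 0"
    "\<And>s \<psi> (h :: 'a::euclidean_space \<Rightarrow> real). almost_integrable h \<Longrightarrow> dominated s \<psi> h \<Longrightarrow> s \<ge> 0 \<Longrightarrow>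
      norm (smoothing \<tau> h) \<le> K * (s + (\<integral>y. \<psi> y \<partial>lborel))"
proof -
  obtain K where K: "K \<ge> 0" "decay_kernel K (gaussian \<tau> :: 'a \<Rightarrow> real)"
    "\<And>s::'a. decay_kernel (K * norm s) (gaussian_deriv \<tau> s)"
    using decay_kernel_gaussian[OF assms] by metis
  have "norm (smoothing \<tau> h) \<le> (K * 2 ^ DIM('a)) * (s + (\<integral>y. \<psi> y \<partial>lborel))"
    if h: "almost_integrable h" "dominated s \<psi> h" "s \<ge> 0" for s \<psi> and h :: "'a \<Rightarrow> real"
  proof -
    have "0 \<le> (\<integral>y. \<psi> y \<partial>lborel)"
      using h(2) by (intro Bochner_Integration.integral_nonneg) (auto simp: dominated_def)
    then have "(\<integral>y. \<psi> y \<partial>lborel) \<le> 2 ^ DIM('a) * (\<integral>y. \<psi> y \<partial>lborel)"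
      by (simp add: mult_le_cancel_right1)
    then have "K * (s * 2 ^ DIM('a) + (\<integral>y. \<psi> y \<partial>lborel))
        \<le> K * (s * 2 ^ DIM('a) + 2 ^ DIM('a) * (\<integral>y. \<psi> y \<partial>lborel))"
      using K(1) by (intro mult_left_mono) auto
    then have le: "K * (s * 2 ^ DIM('a) + (\<integral>y. \<psi> y \<partial>lborel))
        \<le> (K * 2 ^ DIM('a)) * (s + (\<integral>y. \<psi> y \<partial>lborel))" by (simp add: algebra_simps)
    have K1: "decay_kernel K (gaussian_deriv \<tau> b)" if "b \<in> Basis" for b :: 'a
      using K(3)[of b] that by simp
    show ?thesis
      unfolding norm_C10_le_iff C10_fun_smoothing[OF assms h(1)] partial_deriv_convolution[OF assms h(1)]
      using order_trans[OF convolution_le[OF K(2) h(2,3)] le]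
        order_trans[OF convolution_le[OF K1 h(2,3)] le] by blast
  qed
  then show ?thesis using K(1) by (intro that[of "K * 2 ^ DIM('a)"]) auto
qed

text \<open>Where |u| > s the ratio |u| / s exceeds 1, and raising it to the power r > 1 only
  enlarges it.\<close>

lemma Lr_dominated:
  assumes u: "u \<in> Lr r" and r: "r > 1" and s: "s > 0"
  shows "dominated s (\<lambda>y. s powr (1 - r) * \<bar>u y\<bar> powr r) u"
proof -
  have "\<bar>u y\<bar> \<le> s + s powr (1 - r) * \<bar>u y\<bar> powr r" for y
  proof (cases "\<bar>u y\<bar> \<le> s")
    case False
    then have "\<bar>u y\<bar> / s \<le> (\<bar>u y\<bar> / s) powr r"
      using powr_mono[of 1 r "\<bar>u y\<bar> / s"] r s by simp
    then have "s * (\<bar>u y\<bar> / s) \<le> s * (\<bar>u y\<bar> / s) powr r" using s by (intro mult_left_mono) auto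
    also have "\<dots> = s powr (1 - r) * \<bar>u y\<bar> powr r"
      using s by (simp add: powr_divide powr_diff)
    finally show ?thesis using s by simp
  qed (simp add: add_increasing2)
  then show ?thesis using u by (auto simp: dominated_def Lr_def)
qed

lemma almost_integrable_Lr: "u \<in> Lr r \<Longrightarrow> r > 1 \<Longrightarrow> almost_integrable u"
  using Lr_dominated unfolding almost_integrable_def by blast

text \<open>With N the integral of |h|^r, the bound K B (s + s^(1 - r) N) holds for every s > 0. Its
  two terms coincide when s is the norm N^(1/r) of h, which gives the factor 2; for N = 0 one lets s
  tend to 0.\<close>

lemma smoothing_Lr_norm_le:
  assumes "\<tau> > 0" "r > 1" "c \<in> borel_measurable borel" "\<And>y::'a::euclidean_space. \<bar>c y\<bar> \<le> B"
  obtains K where "\<And>h. h \<in> Lr r \<Longrightarrow> norm (smoothing \<tau> (\<lambda>y. c y * h y)) \<le> K * Lr_norm r h"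
proof -
  have B: "B \<ge> 0" using assms(4)[of 0] by linarith
  obtain K where K: "K \<ge> 0"
    "\<And>s \<psi> (h :: 'a::euclidean_space \<Rightarrow> real). almost_integrable h \<Longrightarrow> dominated s \<psi> h \<Longrightarrow> s \<ge> 0 \<Longrightarrow>
      norm (smoothing \<tau> h) \<le> K * (s + (\<integral>y. \<psi> y \<partial>lborel))"
    using smoothing_norm_le[OF assms(1)] by metis
  have "norm (smoothing \<tau> (\<lambda>y. c y * h y)) \<le> (2 * K * B) * Lr_norm r h" if h: "h \<in> Lr r" for h
  proof -
    define N where "N = (\<integral>y. \<bar>h y\<bar> powr r \<partial>lborel)"
    have N: "N \<ge> 0" unfolding N_def by (intro Bochner_Integration.integral_nonneg) auto
    have le: "norm (smoothing \<tau> (\<lambda>y. c y * h y)) \<le> K * B * (s + s powr (1 - r) * N)" if s: "s > 0" for s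
      using K(2)[OF almost_integrable_mult[OF almost_integrable_Lr[OF h assms(2)] assms(3,4)]
          dominated_mult[OF Lr_dominated[OF h assms(2) s] assms(3,4)]] B s
      by (simp add: N_def algebra_simps)
    show ?thesis
    proof (cases "N = 0")
      case True
      have "norm (smoothing \<tau> (\<lambda>y. c y * h y)) \<le> 0 + e" if e: "e > 0" for e
      proof -
        have "norm (smoothing \<tau> (\<lambda>y. c y * h y)) \<le> (K * B) * (e / (K * B + 1))"
          using le[of "e / (K * B + 1)"] True e K(1) B by (simp add: add_nonneg_pos)
        also have "\<dots> \<le> e" using e mult_nonneg_nonneg[OF K(1) B] by (simp add: divide_le_eq add_nonneg_pos algebra_simps)
        finally show ?thesis by simp
      qed
      then have "norm (smoothing \<tau> (\<lambda>y. c y * h y)) \<le> 0" by (rule field_le_epsilon)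
      then show ?thesis using True assms(2) by (simp add: Lr_norm_def N_def)
    next
      case False
      define s where "s = N powr (1 / r)"
      have s: "s > 0" using False N by (simp add: s_def)
      have "N = s powr r" using False N assms(2) by (simp add: s_def powr_powr)
      then have "s powr (1 - r) * N = s" using s by (simp add: powr_add[symmetric])
      then show ?thesis using le[OF s] by (simp add: s_def N_def Lr_norm_def)
    qed
  qed
  then show ?thesis using that by blast
qed

text \<open>Here u is fixed and enters the constant. This is the shape of the sources in the
  derivative with respect to f: a number c depending on the increment, times |u| + 1, where the 1
  accounts for the terms without u.\<close>

lemma smoothing_norm_le_Lr:
  assumes "\<tau> > 0" "r > 1" "u \<in> Lr r"
  obtains K where "K \<ge> 0" "\<And>c (h :: 'a::euclidean_space \<Rightarrow> real). almost_integrable h \<Longrightarrow> c \<ge> 0 \<Longrightarrow>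
    (\<And>y. \<bar>h y\<bar> \<le> c * (\<bar>u y\<bar> + 1)) \<Longrightarrow> norm (smoothing \<tau> h) \<le> K * c"
proof -
  obtain K where K: "K \<ge> 0"
    "\<And>s \<psi> (h :: 'a::euclidean_space \<Rightarrow> real). almost_integrable h \<Longrightarrow> dominated s \<psi> h \<Longrightarrow> s \<ge> 0 \<Longrightarrow>
      norm (smoothing \<tau> h) \<le> K * (s + (\<integral>y. \<psi> y \<partial>lborel))"
    using smoothing_norm_le[OF assms(1)] by metis
  obtain \<psi> where \<psi>: "dominated 1 \<psi> u"
    using Lr_dominated[OF assms(3,2) zero_less_one] by blast
  have I: "0 \<le> (\<integral>y. \<psi> y \<partial>lborel)"
    using \<psi> by (intro Bochner_Integration.integral_nonneg) (auto simp: dominated_def)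
  have "norm (smoothing \<tau> h) \<le> (K * (2 + (\<integral>y. \<psi> y \<partial>lborel))) * c"
    if h: "almost_integrable h" "c \<ge> 0" "\<And>y. \<bar>h y\<bar> \<le> c * (\<bar>u y\<bar> + 1)" for c h
  proof -
    \<comment> \<open>One c comes from |u| <= 1 + \<psi>, the other from the added 1.\<close>
    have "\<bar>h y\<bar> \<le> 2 * c + c * \<psi> y" for y
    proof -
      have "c * (\<bar>u y\<bar> + 1) \<le> c * ((1 + \<psi> y) + 1)"
        using \<psi> h(2) by (intro mult_left_mono add_right_mono) (auto simp: dominated_def)
      then show ?thesis using h(3)[of y] by (simp add: algebra_simps)
    qed
    then have "dominated (2 * c) (\<lambda>y. c * \<psi> y) h"
      using \<psi> h by (auto simp: dominated_def almost_integrable_measurable)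
    from K(2)[OF h(1) this] show ?thesis using h(2) by (simp add: algebra_simps)
  qed
  then show ?thesis using K(1) I by (intro that[of "K * (2 + (\<integral>y. \<psi> y \<partial>lborel))"]) auto
qed


section \<open>The reaction term and the smoothed norm\<close>

text \<open>The derivative of the quintic in factored form. The double zeros of the reaction term at
  0 and 1 leave simple zeros here, so the truncation to the interval is continuous.\<close>

definition reaction_deriv :: "real \<Rightarrow> real \<Rightarrow> real" where
  "reaction_deriv W \<xi> = W * (\<xi> * (\<xi> - 1) * (5 * \<xi>\<^sup>2 - 5 * \<xi> + 1)) * indicator {0..1} \<xi>"

lemma reaction_measurable [measurable]: "reaction W \<in> borel_measurable borel"
  unfolding reaction_def[abs_def] by measurable

lemma reaction_deriv_measurable [measurable]: "reaction_deriv W \<in> borel_measurable borel"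
  unfolding reaction_deriv_def[abs_def] by measurable

text \<open>The bounds by the distances to 0 and 1 serve in the Taylor estimate when a step crosses
  an end of the interval. \<open>abs_reaction_le\<close> gives vanishing at infinity after
  composition with functions in C^1_0, and \<open>abs_reaction_deriv_le_W\<close> gives bounded
  multipliers.\<close>

lemma reaction_bounds:
  shows abs_reaction_le_square: "\<bar>reaction W \<xi>\<bar> \<le> \<bar>W\<bar> * \<xi>\<^sup>2"
    and abs_reaction_le_square_1: "\<bar>reaction W \<xi>\<bar> \<le> \<bar>W\<bar> * (\<xi> - 1)\<^sup>2"
    and abs_reaction_le: "\<bar>reaction W \<xi>\<bar> \<le> \<bar>W\<bar> * \<bar>\<xi>\<bar>"
    and abs_reaction_deriv_le: "\<bar>reaction_deriv W \<xi>\<bar> \<le> \<bar>W\<bar> * \<bar>\<xi>\<bar>"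
    and abs_reaction_deriv_le_1: "\<bar>reaction_deriv W \<xi>\<bar> \<le> \<bar>W\<bar> * \<bar>\<xi> - 1\<bar>"
    and abs_reaction_deriv_le_W: "\<bar>reaction_deriv W \<xi>\<bar> \<le> \<bar>W\<bar>"
proof -
  have "\<bar>reaction W \<xi>\<bar> \<le> \<bar>W\<bar> * \<xi>\<^sup>2 \<and> \<bar>reaction W \<xi>\<bar> \<le> \<bar>W\<bar> * (\<xi> - 1)\<^sup>2 \<and>
      \<bar>reaction W \<xi>\<bar> \<le> \<bar>W\<bar> * \<bar>\<xi>\<bar> \<and> \<bar>reaction_deriv W \<xi>\<bar> \<le> \<bar>W\<bar> * \<bar>\<xi>\<bar> \<and>
      \<bar>reaction_deriv W \<xi>\<bar> \<le> \<bar>W\<bar> * \<bar>\<xi> - 1\<bar> \<and> \<bar>reaction_deriv W \<xi>\<bar> \<le> \<bar>W\<bar>"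
  proof (cases "\<xi> \<in> {0..1}")
    case True
    have half: "\<bar>\<xi> - 1/2\<bar> \<le> 1" using True by (auto simp: abs_if)
    have sq: "\<xi>\<^sup>2 \<le> \<xi>" "(\<xi> - 1)\<^sup>2 \<le> 1" "\<xi>\<^sup>2 \<le> 1"
      using True mult_left_mono[of \<xi> 1 \<xi>]
      by (simp_all add: abs_square_le_1) (simp add: power2_eq_square)
    have one: "\<bar>\<xi>\<bar> \<le> 1" "\<bar>\<xi> - 1\<bar> \<le> 1" using True by auto
    \<comment> \<open>Since \<xi> (1 - \<xi>) lies in [0, 1/4], the quadratic factor 1 - 5 \<xi> (1
      - \<xi>) lies in [-1/4, 1].\<close>
    have "0 \<le> \<xi> * (1 - \<xi>)" using True by simp
    moreover have "\<xi> * (1 - \<xi>) = 1/4 - (\<xi> - 1/2)\<^sup>2" by (simp add: power2_eq_square algebra_simps)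
    moreover have "0 \<le> (\<xi> - 1/2)\<^sup>2" by simp
    moreover have "5 * \<xi>\<^sup>2 - 5 * \<xi> + 1 = 1 - 5 * (\<xi> * (1 - \<xi>))"
      by (simp add: power2_eq_square algebra_simps)
    ultimately have Q: "\<bar>5 * \<xi>\<^sup>2 - 5 * \<xi> + 1\<bar> \<le> 1" by linarith
    have R: "\<bar>reaction W \<xi>\<bar> = \<bar>W\<bar> * (\<xi>\<^sup>2 * ((\<xi> - 1)\<^sup>2 * \<bar>\<xi> - 1/2\<bar>))"
      using True by (simp add: reaction_def abs_mult)
    have RD: "\<bar>reaction_deriv W \<xi>\<bar> = \<bar>W\<bar> * (\<bar>\<xi>\<bar> * \<bar>\<xi> - 1\<bar> * \<bar>5 * \<xi>\<^sup>2 - 5 * \<xi> + 1\<bar>)"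
      using True by (simp add: reaction_deriv_def abs_mult)
    have le1: "x * y \<le> x" if "0 \<le> x" "y \<le> 1" for x y :: real
      using mult_left_mono[OF that(2,1)] by simp
    have A: "\<xi>\<^sup>2 * ((\<xi> - 1)\<^sup>2 * \<bar>\<xi> - 1/2\<bar>) \<le> \<xi>\<^sup>2"
      using sq half by (intro le1 mult_le_one) auto
    have B: "\<xi>\<^sup>2 * ((\<xi> - 1)\<^sup>2 * \<bar>\<xi> - 1/2\<bar>) \<le> (\<xi> - 1)\<^sup>2"
      using le1[of "(\<xi> - 1)\<^sup>2" "\<xi>\<^sup>2 * \<bar>\<xi> - 1/2\<bar>"] sq half
        mult_le_one[of "\<xi>\<^sup>2" "\<bar>\<xi> - 1/2\<bar>"] by (simp add: mult_ac)
    have C: "\<xi>\<^sup>2 * ((\<xi> - 1)\<^sup>2 * \<bar>\<xi> - 1/2\<bar>) \<le> \<bar>\<xi>\<bar>"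
      using A sq by linarith
    have D: "\<bar>\<xi>\<bar> * \<bar>\<xi> - 1\<bar> * \<bar>5 * \<xi>\<^sup>2 - 5 * \<xi> + 1\<bar> \<le> \<bar>\<xi>\<bar>"
      using order_trans[OF le1[OF _ Q] le1[OF _ one(2)]] by simp
    have E: "\<bar>\<xi>\<bar> * \<bar>\<xi> - 1\<bar> * \<bar>5 * \<xi>\<^sup>2 - 5 * \<xi> + 1\<bar> \<le> \<bar>\<xi> - 1\<bar>"
      using order_trans[OF le1[OF _ Q] le1[OF _ one(1), of "\<bar>\<xi> - 1\<bar>"]] by (simp add: mult_ac)
    have F: "\<bar>\<xi>\<bar> * \<bar>\<xi> - 1\<bar> * \<bar>5 * \<xi>\<^sup>2 - 5 * \<xi> + 1\<bar> \<le> 1" using D one by linarith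
    show ?thesis
      unfolding R RD using A B C D E mult_left_mono[OF F, of "\<bar>W\<bar>"]
      by (auto intro!: mult_left_mono)
  qed (simp add: reaction_def reaction_deriv_def)
  then show "\<bar>reaction W \<xi>\<bar> \<le> \<bar>W\<bar> * \<xi>\<^sup>2" "\<bar>reaction W \<xi>\<bar> \<le> \<bar>W\<bar> * (\<xi> - 1)\<^sup>2"
    "\<bar>reaction W \<xi>\<bar> \<le> \<bar>W\<bar> * \<bar>\<xi>\<bar>" "\<bar>reaction_deriv W \<xi>\<bar> \<le> \<bar>W\<bar> * \<bar>\<xi>\<bar>"
    "\<bar>reaction_deriv W \<xi>\<bar> \<le> \<bar>W\<bar> * \<bar>\<xi> - 1\<bar>" "\<bar>reaction_deriv W \<xi>\<bar> \<le> \<bar>W\<bar>"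
    by blast+
qed

text \<open>The reaction term is a polynomial on the interval and vanishes to second order at both
  ends. If exactly one of \<xi> and \<xi> + s lies inside, then |s| is at least the distance from
  that point to the end crossed, and the bounds by this distance replace the polynomial
  expansion.\<close>

lemma reaction_taylor:
  obtains K where "K \<ge> 0"
    "\<And>\<xi> s. \<bar>reaction W (\<xi> + s) - reaction W \<xi> - reaction_deriv W \<xi> * s\<bar> \<le> K * s\<^sup>2"
proof -
  \<comment> \<open>The remainder after the linear Taylor term of \<xi>^5 - (5/2) \<xi>^4 + 2
    \<xi>^3 - (1/2) \<xi>^2, divided by s^2. If both points lie in the unit interval then |s| <= 1,
    so q is evaluated on a compact set.\<close>
  define q where "q z = (case z of (x, s) \<Rightarrow> (10 * x^3 + 10 * x\<^sup>2 * s + 5 * x * s\<^sup>2 + s^3)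
      - 5/2 * (6 * x\<^sup>2 + 4 * x * s + s\<^sup>2) + 2 * (3 * x + s) - (1/2 :: real))" for z :: "real \<times> real"
  have "compact (q ` ({0..1} \<times> {-1..1}))"
    unfolding q_def case_prod_beta
    by (intro compact_continuous_image compact_Times compact_Icc continuous_intros)
  then have "bounded (q ` ({0..1} \<times> {-1..1}))" by (rule compact_imp_bounded)
  then obtain M where "\<forall>y\<in>q ` ({0..1} \<times> {-1..1}). norm y \<le> M" unfolding bounded_iff by blast
  then have M: "\<bar>q (x, s)\<bar> \<le> M" if "x \<in> {0..1}" "s \<in> {-1..1}" for x s using that by auto
  have M0: "M \<ge> 0" using M[of 0 0] by simp
  have "\<bar>reaction W (\<xi> + s) - reaction W \<xi> - reaction_deriv W \<xi> * s\<bar> \<le> \<bar>W\<bar> * (M + 2) * s\<^sup>2" for \<xi> s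
  proof -
    \<comment> \<open>The summand 2 in \<open>M + 2\<close> pays for leaving the interval, where the
      value and the linear term cost |W| s^2 each.\<close>
    have two: "\<bar>W\<bar> * x \<le> \<bar>W\<bar> * (M + 2) * s\<^sup>2" if "x \<le> 2 * s\<^sup>2" for x
    proof -
      have "x \<le> (M + 2) * s\<^sup>2" using that M0 mult_nonneg_nonneg[OF M0 zero_le_power2[of s]]
        unfolding distrib_right by linarith
      then show ?thesis unfolding mult.assoc by (rule mult_left_mono) simp
    qed
    consider "\<xi> \<in> {0..1}" "\<xi> + s \<in> {0..1}" | "\<xi> \<in> {0..1}" "\<xi> + s \<notin> {0..1}"
      | "\<xi> \<notin> {0..1}" "\<xi> + s \<in> {0..1}" | "\<xi> \<notin> {0..1}" "\<xi> + s \<notin> {0..1}" by blast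
    then show ?thesis
    proof cases
      case 1
      then have "reaction W (\<xi> + s) - reaction W \<xi> - reaction_deriv W \<xi> * s = W * (q (\<xi>, s) * s\<^sup>2)"
        by (simp add: reaction_def reaction_deriv_def q_def power2_eq_square power3_eq_cube algebra_simps)
      also have "\<bar>\<dots>\<bar> = \<bar>W\<bar> * (\<bar>q (\<xi>, s)\<bar> * s\<^sup>2)" by (simp add: abs_mult)
      also have "\<dots> \<le> \<bar>W\<bar> * ((M + 2) * s\<^sup>2)"
        using M[of \<xi> s] 1 by (intro mult_left_mono mult_right_mono) auto
      finally show ?thesis by (simp add: mult_ac)
    next
      case 2
      have "\<bar>reaction W \<xi>\<bar> \<le> \<bar>W\<bar> * s\<^sup>2 \<and> \<bar>reaction_deriv W \<xi>\<bar> \<le> \<bar>W\<bar> * \<bar>s\<bar>"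
      proof (cases "\<xi> + s < 0")
        case True
        then have "\<bar>\<xi>\<bar> \<le> \<bar>s\<bar>" using 2 by auto
        then have "\<bar>W\<bar> * \<xi>\<^sup>2 \<le> \<bar>W\<bar> * s\<^sup>2" "\<bar>W\<bar> * \<bar>\<xi>\<bar> \<le> \<bar>W\<bar> * \<bar>s\<bar>"
          by (auto intro!: mult_left_mono simp: abs_le_square_iff[symmetric])
        then show ?thesis using abs_reaction_le_square[of W \<xi>] abs_reaction_deriv_le[of W \<xi>] by linarith
      next
        case False
        then have "\<bar>\<xi> - 1\<bar> \<le> \<bar>s\<bar>" using 2 by auto
        then have "\<bar>W\<bar> * (\<xi> - 1)\<^sup>2 \<le> \<bar>W\<bar> * s\<^sup>2" "\<bar>W\<bar> * \<bar>\<xi> - 1\<bar> \<le> \<bar>W\<bar> * \<bar>s\<bar>"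
          by (auto intro!: mult_left_mono simp: abs_le_square_iff[symmetric])
        then show ?thesis using abs_reaction_le_square_1[of W \<xi>] abs_reaction_deriv_le_1[of W \<xi>] by linarith
      qed
      then have "\<bar>reaction W \<xi>\<bar> \<le> \<bar>W\<bar> * s\<^sup>2" "\<bar>reaction_deriv W \<xi> * s\<bar> \<le> \<bar>W\<bar> * s\<^sup>2"
        using mult_right_mono[of "\<bar>reaction_deriv W \<xi>\<bar>" "\<bar>W\<bar> * \<bar>s\<bar>" "\<bar>s\<bar>"]
        by (auto simp: abs_mult power2_eq_square mult.assoc)
      moreover have "reaction W (\<xi> + s) = 0" using 2 by (simp add: reaction_def)
      ultimately show ?thesis using two[of "2 * s\<^sup>2"] by linarith
    next
      case 3
      have "\<bar>reaction W (\<xi> + s)\<bar> \<le> \<bar>W\<bar> * s\<^sup>2"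
      proof (cases "\<xi> < 0")
        case True
        then have "\<bar>\<xi> + s\<bar> \<le> \<bar>s\<bar>" using 3 by auto
        then have "\<bar>W\<bar> * (\<xi> + s)\<^sup>2 \<le> \<bar>W\<bar> * s\<^sup>2"
          by (auto intro!: mult_left_mono simp: abs_le_square_iff[symmetric])
        then show ?thesis using abs_reaction_le_square[of W "\<xi> + s"] by linarith
      next
        case False
        then have "\<bar>\<xi> + s - 1\<bar> \<le> \<bar>s\<bar>" using 3 by auto
        then have "\<bar>W\<bar> * (\<xi> + s - 1)\<^sup>2 \<le> \<bar>W\<bar> * s\<^sup>2"
          by (auto intro!: mult_left_mono simp: abs_le_square_iff[symmetric])
        then show ?thesis using abs_reaction_le_square_1[of W "\<xi> + s"] by linarith
      qed
      moreover have "reaction W \<xi> = 0" "reaction_deriv W \<xi> = 0"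
        using 3 by (simp_all add: reaction_def reaction_deriv_def)
      ultimately show ?thesis using two[of "s\<^sup>2"] by simp
    next
      case 4
      then show ?thesis using M0 by (simp add: reaction_def reaction_deriv_def)
    qed
  qed
  then show ?thesis using M0 by (intro that[of "\<bar>W\<bar> * (M + 2)"]) auto
qed

section \<open>The smoothed norm\<close>

lemma smooth_norm_eq_norm_Pair: "smooth_norm \<psi> z = norm (z, \<psi>)"
  by (simp add: smooth_norm_def norm_Pair)

lemma smooth_norm_pos: "\<psi> > 0 \<Longrightarrow> smooth_norm \<psi> z > 0"
  unfolding smooth_norm_def by (intro real_sqrt_gt_zero add_nonneg_pos) auto

lemma smooth_norm_ge: "norm z \<le> smooth_norm \<psi> z" "\<psi> \<le> smooth_norm \<psi> z"
  unfolding smooth_norm_def by (auto intro: real_le_rsqrt)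

lemma smooth_norm_le: "smooth_norm \<psi> z \<le> norm z + \<bar>\<psi>\<bar>"
  using sqrt_sum_squares_le_sum_abs[of "norm z" \<psi>] by (simp add: smooth_norm_def)

lemma smooth_norm_measurable [measurable]: "smooth_norm \<psi> \<in> borel_measurable borel"
  unfolding smooth_norm_def[abs_def] by measurable

text \<open>With a and b the values at z + w and z, the identity for a^2 - b^2 shows that the
  remainder is exactly (|w|^2 - (a - b)^2) / (2 b). It is nonnegative because the smoothed norm,
  being the norm of the pair (z, \<psi>), is 1-Lipschitz, and b >= \<psi> bounds the
  denominator.\<close>

lemma smooth_norm_taylor:
  assumes "\<psi> > 0"
  shows "\<bar>smooth_norm \<psi> (z + w) - smooth_norm \<psi> z - (z \<bullet> w) / smooth_norm \<psi> z\<bar> \<le> (norm w)\<^sup>2 / \<psi>"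
proof -
  define a b where "a = smooth_norm \<psi> (z + w)" and "b = smooth_norm \<psi> z"
  have b: "b > 0" "\<psi> \<le> b" using smooth_norm_pos[OF assms] smooth_norm_ge by (auto simp: b_def)
  have sq: "a\<^sup>2 = b\<^sup>2 + 2 * (z \<bullet> w) + (norm w)\<^sup>2"
    by (simp add: a_def b_def smooth_norm_def real_sqrt_pow2)
      (simp add: power2_norm_eq_inner inner_add_left inner_add_right inner_commute)
  have "\<bar>a - b\<bar> \<le> norm ((z + w, \<psi>) - (z, \<psi>))"
    unfolding a_def b_def smooth_norm_eq_norm_Pair by (rule norm_triangle_ineq3)
  then have "\<bar>a - b\<bar> \<le> \<bar>norm w\<bar>" by (simp add: norm_Pair)
  then have ab: "(a - b)\<^sup>2 \<le> (norm w)\<^sup>2" by (simp only: abs_le_square_iff)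
  have "2 * b * (a - b - (z \<bullet> w) / b) = 2 * a * b - 2 * b\<^sup>2 - 2 * (z \<bullet> w)"
    using b by (simp add: field_simps power2_eq_square)
  also have "\<dots> = (norm w)\<^sup>2 - (a - b)\<^sup>2"
    using sq by (simp add: power2_diff)
  finally have eq: "a - b - (z \<bullet> w) / b = ((norm w)\<^sup>2 - (a - b)\<^sup>2) / (2 * b)"
    using b by (simp add: field_simps)
  have "\<bar>a - b - (z \<bullet> w) / b\<bar> \<le> (norm w)\<^sup>2 / (2 * b)"
    unfolding eq using ab b by (auto simp: abs_divide intro!: divide_right_mono abs_leI)
  also have "\<dots> \<le> (norm w)\<^sup>2 / \<psi>" using b assms by (intro divide_left_mono) auto
  finally show ?thesis by (simp add: a_def b_def)
qed


section \<open>Partial differentiability of the step map\<close>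

lemma almost_integrable_C10_fun: "almost_integrable (C10_fun f)"
  by (rule almost_integrable_vanishing[where B = "norm f"])
    (auto intro: abs_C10_fun_le C10_fun_tendsto_0)

lemma almost_integrable_gradient_inner:
  fixes f :: "'a::euclidean_space C10"
  assumes [measurable]: "c \<in> borel_measurable borel" and c: "\<And>y. norm (c y) \<le> B"
  shows "almost_integrable (\<lambda>y. gradient (C10_fun f) y \<bullet> c y)"
proof (rule almost_integrable_vanishing)
  have le: "\<bar>gradient (C10_fun f) y \<bullet> c y\<bar> \<le> norm (gradient (C10_fun f) y) * B" for y
    by (rule order_trans[OF Cauchy_Schwarz_ineq2 mult_left_mono[OF c]]) simp
  have B: "B \<ge> 0" using c[of 0] norm_ge_zero order_trans by blast
  show "\<bar>gradient (C10_fun f) y \<bullet> c y\<bar> \<le> DIM('a) * norm f * B" for y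
    by (rule order_trans[OF le mult_right_mono[OF norm_gradient_C10_le B]])
  have "((\<lambda>y. norm (gradient (C10_fun f) y) * B) \<longlongrightarrow> 0) at_infinity"
    using tendsto_mult_right[OF tendsto_norm[OF gradient_C10_tendsto_0], of f B] by simp
  then show "((\<lambda>y. gradient (C10_fun f) y \<bullet> c y) \<longlongrightarrow> 0) at_infinity"
    by (rule Lim_null_comparison[rotated]) (simp add: le)
qed measurable

lemma almost_integrable_reaction: "almost_integrable (\<lambda>y. reaction W (C10_fun f y))"
proof (rule almost_integrable_vanishing)
  show "\<bar>reaction W (C10_fun f y)\<bar> \<le> \<bar>W\<bar> * norm f" for y
    by (rule order_trans[OF abs_reaction_le mult_left_mono[OF abs_C10_fun_le]]) simp
  have "((\<lambda>y. \<bar>W\<bar> * \<bar>C10_fun f y\<bar>) \<longlongrightarrow> 0) at_infinity"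
    using tendsto_mult_left[OF tendsto_rabs[OF C10_fun_tendsto_0], of "\<bar>W\<bar>" f] by simp
  then show "((\<lambda>y. reaction W (C10_fun f y)) \<longlongrightarrow> 0) at_infinity"
    by (rule Lim_null_comparison[rotated]) (simp add: abs_reaction_le)
qed measurable

lemma smooth_norm_gradient_le:
  "\<bar>smooth_norm \<psi> (gradient (C10_fun f) y)\<bar> \<le> DIM('a) * norm f + \<bar>\<psi>\<bar>"
  for f :: "'a::euclidean_space C10"
proof -
  have "0 \<le> smooth_norm \<psi> (gradient (C10_fun f) y)" by (simp add: smooth_norm_def)
  then show ?thesis
    using smooth_norm_le[of \<psi> "gradient (C10_fun f) y"] norm_gradient_C10_le[of f y] by simp
qed

lemma almost_integrable_smooth_norm_mult:
  "almost_integrable u \<Longrightarrow> almost_integrable (\<lambda>y. smooth_norm \<psi> (gradient (C10_fun f) y) * u y)"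
  by (rule almost_integrable_mult[OF _ _ smooth_norm_gradient_le]) measurable

text \<open>Merging the two convolutions of the step map into one source reduces statements about G
  to pointwise statements about this function.\<close>

definition step_source ::
  "real \<Rightarrow> real \<Rightarrow> ('v::real_inner \<Rightarrow> ('a::euclidean_space, 'a) bC1) \<Rightarrow>
   'a C10 \<Rightarrow> ('a \<Rightarrow> real) \<Rightarrow> 'v \<Rightarrow> 'a \<Rightarrow> real" where
  "step_source W \<psi> emb f u v y = C10_fun f y +
     (smooth_norm \<psi> (gradient (C10_fun f) y) * u y
       - gradient (C10_fun f) y \<bullet> apply_bC1 (emb v) y + reaction W (C10_fun f y))"

text \<open>The linearization of \<open>step_source\<close> in f, in direction g; the quotient is
  the derivative of the smoothed norm.\<close>

definition step_source_deriv ::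
  "real \<Rightarrow> real \<Rightarrow> ('v::real_inner \<Rightarrow> ('a::euclidean_space, 'a) bC1) \<Rightarrow>
   'a C10 \<Rightarrow> ('a \<Rightarrow> real) \<Rightarrow> 'v \<Rightarrow> 'a C10 \<Rightarrow> 'a \<Rightarrow> real" where
  "step_source_deriv W \<psi> emb f u v g y = C10_fun g y +
     ((gradient (C10_fun f) y \<bullet> gradient (C10_fun g) y) / smooth_norm \<psi> (gradient (C10_fun f) y) * u y
       - gradient (C10_fun g) y \<bullet> apply_bC1 (emb v) y + reaction_deriv W (C10_fun f y) * C10_fun g y)"

lemma almost_integrable_step_source_rest:
  assumes "almost_integrable u"
  shows "almost_integrable (\<lambda>y. smooth_norm \<psi> (gradient (C10_fun f) y) * u y
       - gradient (C10_fun f) y \<bullet> apply_bC1 (emb v) y + reaction W (C10_fun f y))"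
  by (intro almost_integrable_add almost_integrable_diff almost_integrable_smooth_norm_mult
      almost_integrable_reaction assms almost_integrable_gradient_inner[OF _ norm_apply_bC1_le]) measurable

lemma almost_integrable_step_source:
  "almost_integrable u \<Longrightarrow> almost_integrable (step_source W \<psi> emb f u v)"
  unfolding step_source_def[abs_def]
  by (intro almost_integrable_add almost_integrable_C10_fun almost_integrable_step_source_rest)

lemma abs_inner_div_smooth_norm_le:
  assumes "\<psi> > 0"
  shows "\<bar>(z \<bullet> w) / smooth_norm \<psi> z\<bar> \<le> norm w"
proof -
  have "\<bar>z \<bullet> w\<bar> \<le> smooth_norm \<psi> z * norm w"
    by (rule order_trans[OF Cauchy_Schwarz_ineq2 mult_right_mono[OF smooth_norm_ge(1)]]) simp
  then show ?thesis
    using smooth_norm_pos[OF assms, of z] by (simp add: abs_divide divide_le_eq mult.commute)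
qed

lemma almost_integrable_step_source_deriv:
  assumes "almost_integrable u" "\<psi> > 0"
  shows "almost_integrable (step_source_deriv W \<psi> emb f u v g)"
  unfolding step_source_deriv_def[abs_def]
  by (intro almost_integrable_add almost_integrable_diff almost_integrable_C10_fun
      almost_integrable_gradient_inner[OF _ norm_apply_bC1_le]
      almost_integrable_mult[OF assms(1) _ order_trans[OF abs_inner_div_smooth_norm_le[OF assms(2)] norm_gradient_C10_le]]
      almost_integrable_mult[OF almost_integrable_C10_fun _ abs_reaction_deriv_le_W]) measurable

lemma step_map_eq_smoothing:
  fixes emb :: "'v::real_inner \<Rightarrow> ('a::euclidean_space, 'a) bC1"
  assumes "\<tau> > 0" "almost_integrable u"
  shows "step_map \<tau> W \<psi> emb f u v = smoothing \<tau> (step_source W \<psi> emb f u v)"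
proof -
  obtain K where "decay_kernel K (gaussian \<tau> :: 'a \<Rightarrow> real)"
    using decay_kernel_gaussian[OF assms(1)] by metis
  note add = convolution_add[OF this almost_integrable_C10_fun
      almost_integrable_step_source_rest[OF assms(2)]]
  show ?thesis
    unfolding step_map_def smoothing_def step_source_def[abs_def] add ..
qed

context
  fixes \<tau> r W \<psi> :: real and emb :: "'v::real_inner \<Rightarrow> ('a::euclidean_space, 'a) bC1"
    and f :: "'a C10" and u :: "'a \<Rightarrow> real" and v :: 'v
  assumes \<tau>: "\<tau> > 0" and r: "r > 1" and \<psi>: "\<psi> > 0" and emb: "bounded_linear emb" and u: "u \<in> Lr r"
begin

lemma step_map_differentiable_f: "(\<lambda>g. step_map \<tau> W \<psi> emb g u v) differentiable (at f)"
proof -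
  note ai = almost_integrable_Lr[OF u r]
  note src = almost_integrable_step_source[OF ai, of W \<psi> emb]
  note dsrc = almost_integrable_step_source_deriv[OF ai \<psi>, of W emb]
  let ?D = "\<lambda>g. smoothing \<tau> (step_source_deriv W \<psi> emb f u v g)"
  obtain K where K: "K \<ge> 0" "\<And>c h. almost_integrable h \<Longrightarrow> c \<ge> 0 \<Longrightarrow>
    (\<And>y. \<bar>h y\<bar> \<le> c * (\<bar>u y\<bar> + 1)) \<Longrightarrow> norm (smoothing \<tau> h) \<le> K * c"
    using smoothing_norm_le_Lr[OF \<tau> r u] by metis
  obtain M where M: "M \<ge> 0"
    "\<And>\<xi> s. \<bar>reaction W (\<xi> + s) - reaction W \<xi> - reaction_deriv W \<xi> * s\<bar> \<le> M * s\<^sup>2"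
    using reaction_taylor by metis
  \<comment> \<open>The summands of C1 bound in turn the identity term, the smoothed norm, the
    transport term and the reaction term. C2 contains the two nonlinear ones; the squared dimension
    comes from bounding the gradient by the dimension times the C^1 norm.\<close>
  define C1 where "C1 = 1 + DIM('a) + DIM('a) * norm (emb v) + \<bar>W\<bar>"
  define C2 where "C2 = (DIM('a))\<^sup>2 / \<psi> + M"
  have C: "C1 \<ge> 0" "C2 \<ge> 0" using M(1) \<psi> by (auto simp: C1_def C2_def)
  have "((\<lambda>g. step_map \<tau> W \<psi> emb g u v) has_derivative ?D) (at f)"
  proof (rule has_derivative_quadraticI[where N = "K * C2"])
    show "bounded_linear ?D"
    proof (rule bounded_linear_intro[where K = "K * C1"])
      show "?D (g + h) = ?D g + ?D h" for g h
        unfolding smoothing_add[OF \<tau> dsrc dsrc, symmetric]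
        by (rule arg_cong[where f = "smoothing \<tau>"])
          (simp add: step_source_deriv_def fun_eq_iff gradient_C10_add inner_add_left inner_add_right
            add_divide_distrib algebra_simps)
      show "?D (c *\<^sub>R g) = c *\<^sub>R ?D g" for c g
        unfolding smoothing_scale[OF \<tau> dsrc, symmetric]
        by (rule arg_cong[where f = "smoothing \<tau>"])
          (simp add: step_source_deriv_def fun_eq_iff gradient_C10_scaleR algebra_simps)
      fix g :: "'a C10"
      have "\<bar>step_source_deriv W \<psi> emb f u v g y\<bar> \<le> (norm g * C1) * (\<bar>u y\<bar> + 1)" for y
      proof -
        have 1: "\<bar>(gradient (C10_fun f) y \<bullet> gradient (C10_fun g) y)
            / smooth_norm \<psi> (gradient (C10_fun f) y) * u y\<bar> \<le> (DIM('a) * norm g) * \<bar>u y\<bar>"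
          unfolding abs_mult
          by (rule mult_right_mono[OF order_trans[OF abs_inner_div_smooth_norm_le[OF \<psi>] norm_gradient_C10_le]])
            simp
        have 2: "\<bar>gradient (C10_fun g) y \<bullet> apply_bC1 (emb v) y\<bar> \<le> (DIM('a) * norm g) * norm (emb v)"
          by (rule order_trans[OF Cauchy_Schwarz_ineq2 mult_mono[OF norm_gradient_C10_le norm_apply_bC1_le]])
            auto
        have 3: "\<bar>reaction_deriv W (C10_fun f y) * C10_fun g y\<bar> \<le> \<bar>W\<bar> * norm g"
          unfolding abs_mult by (rule mult_mono[OF abs_reaction_deriv_le_W abs_C10_fun_le]) auto
        have "\<bar>step_source_deriv W \<psi> emb f u v g y\<bar> \<le> norm g + ((DIM('a) * norm g) * \<bar>u y\<bar>
            + (DIM('a) * norm g) * norm (emb v) + \<bar>W\<bar> * norm g)"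
          unfolding step_source_deriv_def using 1 2 3 abs_C10_fun_le[of g y] by linarith
        also have "\<dots> \<le> (norm g * C1) * (\<bar>u y\<bar> + 1)"
          by (simp add: C1_def algebra_simps)
        finally show ?thesis .
      qed
      from K(2)[OF dsrc _ this] show "norm (?D g) \<le> norm g * (K * C1)"
        using C by (simp add: mult_ac)
    qed
    fix g :: "'a C10"
    define R where "R y = step_source W \<psi> emb (f + g) u v y - step_source W \<psi> emb f u v y
      - step_source_deriv W \<psi> emb f u v g y" for y
    have ai_R: "almost_integrable R"
      unfolding R_def[abs_def] by (intro almost_integrable_diff src dsrc)
    have "\<bar>R y\<bar> \<le> ((norm g)\<^sup>2 * C2) * (\<bar>u y\<bar> + 1)" for y
    proof -
      define z w where "z = gradient (C10_fun f) y" and "w = gradient (C10_fun g) y"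
      define \<rho> where "\<rho> = smooth_norm \<psi> (z + w) - smooth_norm \<psi> z - (z \<bullet> w) / smooth_norm \<psi> z"
      define \<sigma> where "\<sigma> = reaction W (C10_fun f y + C10_fun g y) - reaction W (C10_fun f y)
        - reaction_deriv W (C10_fun f y) * C10_fun g y"
      \<comment> \<open>The identity and the transport term are linear in f and cancel; \<rho> and
        \<sigma> are the remainders of the smoothed norm and of the reaction term.\<close>
      have "R y = \<rho> * u y + \<sigma>"
        unfolding R_def step_source_def step_source_deriv_def \<rho>_def \<sigma>_def z_def w_def
          gradient_C10_add C10_fun_add by (simp add: inner_add_left algebra_simps)
      moreover have "\<bar>\<rho>\<bar> \<le> (norm g)\<^sup>2 * ((DIM('a))\<^sup>2 / \<psi>)"
      proof -
        have "(norm w)\<^sup>2 \<le> (DIM('a) * norm g)\<^sup>2"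
          unfolding w_def by (intro power_mono norm_gradient_C10_le) simp
        then have "(norm w)\<^sup>2 / \<psi> \<le> (DIM('a) * norm g)\<^sup>2 / \<psi>"
          using \<psi> by (intro divide_right_mono) auto
        then show ?thesis
          using smooth_norm_taylor[OF \<psi>, of z w] by (simp add: \<rho>_def power_mult_distrib mult_ac)
      qed
      then have "\<bar>\<rho> * u y\<bar> \<le> (norm g)\<^sup>2 * ((DIM('a))\<^sup>2 / \<psi>) * \<bar>u y\<bar>"
        unfolding abs_mult by (rule mult_right_mono) simp
      moreover have "\<bar>\<sigma>\<bar> \<le> (norm g)\<^sup>2 * M"
      proof -
        have "\<bar>C10_fun g y\<bar> \<le> \<bar>norm g\<bar>" using abs_C10_fun_le[of g y] by simp
        then have "M * (C10_fun g y)\<^sup>2 \<le> M * (norm g)\<^sup>2"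
          using M(1) by (intro mult_left_mono) (simp_all only: abs_le_square_iff)
        then show ?thesis
          using M(2)[of "C10_fun f y" "C10_fun g y"] by (simp add: \<sigma>_def mult.commute)
      qed
      ultimately have "\<bar>R y\<bar> \<le> (norm g)\<^sup>2 * ((DIM('a))\<^sup>2 / \<psi>) * \<bar>u y\<bar> + (norm g)\<^sup>2 * M" by linarith
      also have "\<dots> \<le> (norm g)\<^sup>2 * (((DIM('a))\<^sup>2 / \<psi>) * (\<bar>u y\<bar> + 1) + M * (\<bar>u y\<bar> + 1))"
        unfolding mult.assoc distrib_left[symmetric]
        using M(1) \<psi> by (intro mult_left_mono add_mono) (auto simp: distrib_left)
      finally show ?thesis by (simp add: C2_def algebra_simps)
    qed
    from K(2)[OF ai_R _ this]
    have "norm (smoothing \<tau> R) \<le> K * ((norm g)\<^sup>2 * C2)" using C by simp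
    moreover have "smoothing \<tau> R = step_map \<tau> W \<psi> emb (f + g) u v - step_map \<tau> W \<psi> emb f u v - ?D g"
      unfolding R_def[abs_def] step_map_eq_smoothing[OF \<tau> ai]
      by (simp add: smoothing_diff \<tau> almost_integrable_diff src dsrc)
    ultimately show "norm (step_map \<tau> W \<psi> emb (f + g) u v - step_map \<tau> W \<psi> emb f u v - ?D g)
        \<le> K * C2 * (norm g)\<^sup>2" by (simp add: mult_ac)
  qed
  then show ?thesis by (auto simp: differentiable_def)
qed

text \<open>G is affine in v, so the remainder is 0; continuity of the embedding makes the linear
  part bounded.\<close>

lemma step_map_differentiable_v: "(\<lambda>w. step_map \<tau> W \<psi> emb f u w) differentiable (at v)"
proof -
  interpret emb: bounded_linear emb by (rule emb)
  note ai = almost_integrable_Lr[OF u r]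
  note src = almost_integrable_step_source[OF ai, of W \<psi> emb]
  have gi: "almost_integrable (\<lambda>y. gradient (C10_fun f) y \<bullet> apply_bC1 (emb w) y)" for w
    by (intro almost_integrable_gradient_inner[OF _ norm_apply_bC1_le]) measurable
  let ?D = "\<lambda>w. smoothing \<tau> (\<lambda>y. - 1 * (gradient (C10_fun f) y \<bullet> apply_bC1 (emb w) y))"
  obtain K where K: "K \<ge> 0" "\<And>c h. almost_integrable h \<Longrightarrow> c \<ge> 0 \<Longrightarrow>
    (\<And>y. \<bar>h y\<bar> \<le> c * (\<bar>u y\<bar> + 1)) \<Longrightarrow> norm (smoothing \<tau> h) \<le> K * c"
    using smoothing_norm_le_Lr[OF \<tau> r u] by metis
  obtain B where B: "B \<ge> 0" "\<And>w. norm (emb w) \<le> norm w * B"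
    using emb.nonneg_bounded by blast
  have "((\<lambda>w. step_map \<tau> W \<psi> emb f u w) has_derivative ?D) (at v)"
  proof (rule has_derivative_quadraticI[where N = 0])
    show "bounded_linear ?D"
    proof (rule bounded_linear_intro[where K = "K * (DIM('a) * norm f * B)"])
      show "?D (w + w') = ?D w + ?D w'" for w w'
        unfolding smoothing_add[OF \<tau> almost_integrable_scale[OF gi] almost_integrable_scale[OF gi], symmetric]
        by (rule arg_cong[where f = "smoothing \<tau>"]) (simp add: fun_eq_iff emb.add inner_add_right)
      show "?D (c *\<^sub>R w) = c *\<^sub>R ?D w" for c w
        unfolding smoothing_scale[OF \<tau> almost_integrable_scale[OF gi], symmetric]
        by (rule arg_cong[where f = "smoothing \<tau>"]) (simp add: fun_eq_iff emb.scaleR)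
      fix w
      have "\<bar>- 1 * (gradient (C10_fun f) y \<bullet> apply_bC1 (emb w) y)\<bar>
          \<le> (DIM('a) * norm f * (norm w * B)) * (\<bar>u y\<bar> + 1)" for y
      proof -
        have "norm (apply_bC1 (emb w) y) \<le> norm w * B"
          by (rule order_trans[OF norm_apply_bC1_le B(2)])
        then have "\<bar>gradient (C10_fun f) y \<bullet> apply_bC1 (emb w) y\<bar> \<le> (DIM('a) * norm f) * (norm w * B)"
          by (intro order_trans[OF Cauchy_Schwarz_ineq2 mult_mono[OF norm_gradient_C10_le]]) auto
        also have "\<dots> \<le> (DIM('a) * norm f * (norm w * B)) * (\<bar>u y\<bar> + 1)"
          using B(1) by (simp add: distrib_left)
        finally show ?thesis by simp
      qed
      from K(2)[OF almost_integrable_scale[OF gi] _ this]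
      show "norm (?D w) \<le> norm w * (K * (DIM('a) * norm f * B))"
        using B(1) by (simp add: mult_ac)
    qed
    fix w
    have "step_map \<tau> W \<psi> emb f u (v + w) - step_map \<tau> W \<psi> emb f u v - ?D w = 0"
      unfolding step_map_eq_smoothing[OF \<tau> ai] diff_diff_eq
        smoothing_add[OF \<tau> src almost_integrable_scale[OF gi], symmetric] right_minus_eq
      by (rule arg_cong[where f = "smoothing \<tau>"])
        (simp add: fun_eq_iff step_source_def emb.add inner_add_right)
    then show "norm (step_map \<tau> W \<psi> emb f u (v + w) - step_map \<tau> W \<psi> emb f u v - ?D w)
        \<le> 0 * (norm w)\<^sup>2" by simp
  qed
  then show ?thesis by (auto simp: differentiable_def)
qed

text \<open>G is affine in u with a bounded weight, the smoothed norm of the gradient; boundedness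
  of the linear part on \<open>Lr r\<close> is \<open>smoothing_Lr_norm_le\<close>.\<close>

lemma step_map_has_derivative_Lr: "\<exists>D. has_derivative_Lr r (\<lambda>w. step_map \<tau> W \<psi> emb f w v) D u"
proof -
  note ai = almost_integrable_Lr[OF _ r]
  let ?D = "\<lambda>h. smoothing \<tau> (\<lambda>y. smooth_norm \<psi> (gradient (C10_fun f) y) * h y)"
  have gi: "almost_integrable (\<lambda>y. smooth_norm \<psi> (gradient (C10_fun f) y) * h y)" if "h \<in> Lr r" for h
    by (intro almost_integrable_smooth_norm_mult ai that)
  have "(\<lambda>y. smooth_norm \<psi> (gradient (C10_fun f) y)) \<in> borel_measurable borel" by measurable
  from smoothing_Lr_norm_le[OF \<tau> r this smooth_norm_gradient_le]
  obtain K where K: "\<And>h. h \<in> Lr r \<Longrightarrow> norm (?D h) \<le> K * Lr_norm r h"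
    by blast
  have "has_derivative_Lr r (\<lambda>w. step_map \<tau> W \<psi> emb f w v) ?D u"
    unfolding has_derivative_Lr_def
  proof (intro conjI allI impI)
    have "?D (\<lambda>x. g x + h x) = ?D g + ?D h" if "g \<in> Lr r" "h \<in> Lr r" for g h
      unfolding smoothing_add[OF \<tau> gi[OF that(1)] gi[OF that(2)], symmetric] by (simp add: distrib_left)
    moreover have "?D (\<lambda>x. c * h x) = c *\<^sub>R ?D h" if "h \<in> Lr r" for c h
      unfolding smoothing_scale[OF \<tau> gi[OF that], symmetric] by (simp add: mult.left_commute)
    ultimately show "bounded_linear_Lr r ?D" 
      unfolding bounded_linear_Lr_def using K by blast
    fix e :: real assume "e > 0"
    have "step_map \<tau> W \<psi> emb f (\<lambda>x. u x + h x) v - step_map \<tau> W \<psi> emb f u v - ?D h = 0"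
      if h: "h \<in> Lr r" for h
      unfolding step_map_eq_smoothing[OF \<tau> ai[OF u]]
        step_map_eq_smoothing[OF \<tau> almost_integrable_add[OF ai[OF u] ai[OF h]]] diff_diff_eq
        smoothing_add[OF \<tau> almost_integrable_step_source[OF ai[OF u]] gi[OF h], symmetric] right_minus_eq
      by (rule arg_cong[where f = "smoothing \<tau>"]) (simp add: fun_eq_iff step_source_def algebra_simps)
    then show "\<exists>d>0. \<forall>h\<in>Lr r. Lr_norm r h < d \<longrightarrow>
        norm (step_map \<tau> W \<psi> emb f (\<lambda>x. u x + h x) v - step_map \<tau> W \<psi> emb f u v - ?D h) \<le> e * Lr_norm r h"
      using \<open>e > 0\<close> by (intro exI[of _ 1]) (simp add: Lr_norm_def)
  qed
  then show ?thesis by blast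
qed

end


section \<open>Differentiation on Lebesgue spaces\<close>

lemma Lr_norm_nonneg [simp]: "Lr_norm r u \<ge> 0"
  by (simp add: Lr_norm_def)

lemma has_derivative_Lr_add:
  assumes F: "has_derivative_Lr r F D u" and G: "has_derivative_Lr r G D' u"
  shows "has_derivative_Lr r (\<lambda>w. F w + G w) (\<lambda>h. D h + D' h) u"
  unfolding has_derivative_Lr_def
proof (intro conjI allI impI)
  obtain K where K: "\<forall>h\<in>Lr r. norm (D h) \<le> K * Lr_norm r h"
    using F unfolding has_derivative_Lr_def bounded_linear_Lr_def by blast
  obtain K' where K': "\<forall>h\<in>Lr r. norm (D' h) \<le> K' * Lr_norm r h"
    using G unfolding has_derivative_Lr_def bounded_linear_Lr_def by blast
  have "\<forall>h\<in>Lr r. norm (D h + D' h) \<le> (K + K') * Lr_norm r h"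
    unfolding distrib_right using K K' by (intro ballI norm_triangle_mono) auto
  moreover have "D (\<lambda>x. g x + h x) + D' (\<lambda>x. g x + h x) = (D g + D' g) + (D h + D' h)"
    if "g \<in> Lr r" "h \<in> Lr r" for g h
    using F G that unfolding has_derivative_Lr_def bounded_linear_Lr_def by simp
  moreover have "D (\<lambda>x. c * h x) + D' (\<lambda>x. c * h x) = c *\<^sub>R (D h + D' h)" if "h \<in> Lr r" for c h
    using F G that unfolding has_derivative_Lr_def bounded_linear_Lr_def by (simp add: scaleR_add_right)
  ultimately show "bounded_linear_Lr r (\<lambda>h. D h + D' h)"
    unfolding bounded_linear_Lr_def by blast
  fix e :: real assume "e > 0"
  then have e: "e / 2 > 0" by simp
  obtain d where d: "d > 0" "\<And>h. h \<in> Lr r \<Longrightarrow> Lr_norm r h < d \<Longrightarrow>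
      norm (F (\<lambda>x. u x + h x) - F u - D h) \<le> e / 2 * Lr_norm r h"
    using F e unfolding has_derivative_Lr_def by blast
  obtain d' where d': "d' > 0" "\<And>h. h \<in> Lr r \<Longrightarrow> Lr_norm r h < d' \<Longrightarrow>
      norm (G (\<lambda>x. u x + h x) - G u - D' h) \<le> e / 2 * Lr_norm r h"
    using G e unfolding has_derivative_Lr_def by blast
  have "norm (F (\<lambda>x. u x + h x) + G (\<lambda>x. u x + h x) - (F u + G u) - (D h + D' h)) \<le> e * Lr_norm r h"
    if "h \<in> Lr r" "Lr_norm r h < min d d'" for h
  proof -
    have "F (\<lambda>x. u x + h x) + G (\<lambda>x. u x + h x) - (F u + G u) - (D h + D' h)
        = (F (\<lambda>x. u x + h x) - F u - D h) + (G (\<lambda>x. u x + h x) - G u - D' h)" by simp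
    also have "norm \<dots> \<le> e / 2 * Lr_norm r h + e / 2 * Lr_norm r h"
      using d(2) d'(2) that by (intro norm_triangle_mono) auto
    finally show ?thesis by simp
  qed
  then show "\<exists>d>0. \<forall>h\<in>Lr r. Lr_norm r h < d \<longrightarrow>
      norm (F (\<lambda>x. u x + h x) + G (\<lambda>x. u x + h x) - (F u + G u) - (D h + D' h)) \<le> e * Lr_norm r h"
    using d(1) d'(1) by (intro exI[of _ "min d d'"]) auto
qed

text \<open>The inner map starts in \<open>Lr r\<close>, the outer one acts between normed spaces.
  This mixed form is the one that occurs, since states lie in C^1_0 and costs are real.\<close>

lemma has_derivative_Lr_compose:
  assumes F: "has_derivative_Lr r F D u" and P: "(\<Phi> has_derivative \<Phi>') (at (F u))"
  shows "has_derivative_Lr r (\<lambda>w. \<Phi> (F w)) (\<lambda>h. \<Phi>' (D h)) u"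
  unfolding has_derivative_Lr_def
proof (intro conjI allI impI)
  interpret P: bounded_linear \<Phi>' using P by (rule has_derivative_bounded_linear)
  obtain B where B: "B \<ge> 0" "\<And>x. norm (\<Phi>' x) \<le> norm x * B" using P.nonneg_bounded by blast
  obtain K0 where K0: "\<And>h. h \<in> Lr r \<Longrightarrow> norm (D h) \<le> K0 * Lr_norm r h"
    using F unfolding has_derivative_Lr_def bounded_linear_Lr_def by blast
  define K where "K = \<bar>K0\<bar>"
  have K: "K \<ge> 0" "\<And>h. h \<in> Lr r \<Longrightarrow> norm (D h) \<le> K * Lr_norm r h"
    using order_trans[OF K0 mult_right_mono[OF abs_ge_self Lr_norm_nonneg]] by (auto simp: K_def)
  have "\<forall>h\<in>Lr r. norm (\<Phi>' (D h)) \<le> (K * B) * Lr_norm r h"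
    using order_trans[OF B(2) mult_right_mono[OF K(2) B(1)]] by (simp add: mult_ac)
  then show "bounded_linear_Lr r (\<lambda>h. \<Phi>' (D h))"
    using F unfolding has_derivative_Lr_def bounded_linear_Lr_def by (auto simp: P.add P.scaleR)
  fix e :: real assume e: "e > 0"
  \<comment> \<open>For short h the increment of F is at most K + 1 times the norm of h, so e1 keeps
    the outer remainder below e / 2 times that norm. The entry 1 of e2 yields this growth, and its
    other entry keeps the image under \<Phi>' of the inner remainder below e / 2 times the
    norm.\<close>
  define e1 e2 where "e1 = e / (2 * (K + 1))" and "e2 = min 1 (e / (2 * (B + 1)))"
  have e12: "e1 > 0" "e2 > 0" using e K B by (auto simp: e1_def e2_def)
  obtain d1 where d1: "d1 > 0" "\<And>y. norm (y - F u) < d1 \<Longrightarrow>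
      norm (\<Phi> y - \<Phi> (F u) - \<Phi>' (y - F u)) \<le> e1 * norm (y - F u)"
    using P e12 unfolding has_derivative_at_alt by blast
  obtain d2 where d2: "d2 > 0" "\<And>h. h \<in> Lr r \<Longrightarrow> Lr_norm r h < d2 \<Longrightarrow>
      norm (F (\<lambda>x. u x + h x) - F u - D h) \<le> e2 * Lr_norm r h"
    using F e12 unfolding has_derivative_Lr_def by blast
  have "norm (\<Phi> (F (\<lambda>x. u x + h x)) - \<Phi> (F u) - \<Phi>' (D h)) \<le> e * Lr_norm r h"
    if h: "h \<in> Lr r" "Lr_norm r h < min d2 (d1 / (K + 1))" for h
  proof -
    define y n where "y = F (\<lambda>x. u x + h x)" and "n = Lr_norm r h"
    have n: "n \<ge> 0" "n < d2" "n * (K + 1) < d1"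
      using h(2) K(1) by (auto simp: n_def pos_less_divide_eq)
    have r2: "norm (y - F u - D h) \<le> e2 * n" using d2(2)[OF h(1)] n by (simp add: y_def n_def)
    have "norm (y - F u) \<le> norm (y - F u - D h) + norm (D h)"
      using norm_triangle_ineq[of "y - F u - D h" "D h"] by simp
    also have "\<dots> \<le> e2 * n + K * n" using r2 K(2)[OF h(1)] by (simp add: n_def)
    also have "\<dots> \<le> 1 * n + K * n" using n by (intro add_right_mono mult_right_mono) (auto simp: e2_def)
    finally have yn: "norm (y - F u) \<le> n * (K + 1)" by (simp add: algebra_simps)
    have r1: "norm (\<Phi> y - \<Phi> (F u) - \<Phi>' (y - F u)) \<le> e1 * (n * (K + 1))"
      using d1(2)[of y] yn n e12 by (intro order_trans[OF d1(2) mult_left_mono[OF yn]]) auto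
    have "\<Phi> y - \<Phi> (F u) - \<Phi>' (D h) = (\<Phi> y - \<Phi> (F u) - \<Phi>' (y - F u)) + \<Phi>' (y - F u - D h)"
      by (simp add: P.diff)
    also have "norm \<dots> \<le> e1 * (n * (K + 1)) + (e2 * n) * B"
      by (intro norm_triangle_mono r1 order_trans[OF B(2) mult_right_mono[OF r2 B(1)]])
    also have "e1 * (n * (K + 1)) = e / 2 * n" using K(1) by (simp add: e1_def divide_simps)
    also have "(e2 * n) * B \<le> (e / (2 * (B + 1)) * n) * (B + 1)"
      using n B(1) e by (intro mult_mono) (auto simp: e2_def)
    also have "\<dots> = e / 2 * n" using B(1) by (simp add: divide_simps)
    finally show ?thesis by (simp add: y_def n_def)
  qed
  then show "\<exists>d>0. \<forall>h\<in>Lr r. Lr_norm r h < d \<longrightarrow>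
      norm (\<Phi> (F (\<lambda>x. u x + h x)) - \<Phi> (F u) - \<Phi>' (D h)) \<le> e * Lr_norm r h"
    using d1(1) d2(1) K(1) by (intro exI[of _ "min d2 (d1 / (K + 1))"]) auto
qed

section \<open>Differentiability of powers of the L^r norm\<close>

lemma Lr_measurable: "u \<in> Lr r \<Longrightarrow> u \<in> borel_measurable borel"
  by (simp add: Lr_def)

lemma Lr_integrable: "u \<in> Lr r \<Longrightarrow> integrable lborel (\<lambda>x. \<bar>u x\<bar> powr r)"
  by (simp add: Lr_def)

lemma Lr_norm_powr: "r > 0 \<Longrightarrow> Lr_norm r u powr r = (\<integral>x. \<bar>u x\<bar> powr r \<partial>lborel)"
  by (simp add: Lr_norm_def powr_powr)

lemma Lr_norm_eq_0_iff:
  assumes "u \<in> Lr r" "r > 0"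
  shows "Lr_norm r u = 0 \<longleftrightarrow> (AE x in lborel. u x = 0)"
  using integral_nonneg_eq_0_iff_AE[OF Lr_integrable[OF assms(1)]] assms(2)
  by (simp add: Lr_norm_def)

lemma Lr_add:
  assumes "u \<in> Lr r" "h \<in> Lr r" "r > 0"
  shows "(\<lambda>x. u x + h x) \<in> Lr r"
proof -
  note [measurable] = assms(1,2)[THEN Lr_measurable]
  have "\<bar>u x + h x\<bar> powr r \<le> 2 powr r * (\<bar>u x\<bar> powr r + \<bar>h x\<bar> powr r)" for x
  proof -
    have "\<bar>u x + h x\<bar> powr r \<le> (2 * max \<bar>u x\<bar> \<bar>h x\<bar>) powr r"
      using assms(3) by (intro powr_mono2) auto
    also have "\<dots> \<le> 2 powr r * (\<bar>u x\<bar> powr r + \<bar>h x\<bar> powr r)"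
      by (simp add: powr_mult max_def)
    finally show ?thesis .
  qed
  then have le: "norm (\<bar>u x + h x\<bar> powr r) \<le> norm (2 powr r * (\<bar>u x\<bar> powr r + \<bar>h x\<bar> powr r))" for x
    using order_trans[OF _ abs_ge_self] by simp
  have "integrable lborel (\<lambda>x. \<bar>u x + h x\<bar> powr r)"
  proof (rule Bochner_Integration.integrable_bound)
    show "integrable lborel (\<lambda>x. 2 powr r * (\<bar>u x\<bar> powr r + \<bar>h x\<bar> powr r))"
      by (intro integrable_mult_right Bochner_Integration.integrable_add Lr_integrable assms)
    show "(\<lambda>x. \<bar>u x + h x\<bar> powr r) \<in> borel_measurable lborel" by measurable
  qed (rule AE_I2[OF le])
  then show ?thesis using assms by (simp add: Lr_def)
qed

text \<open>A Young inequality without the optimal weights: both factors are replaced by the larger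
  number.\<close>

lemma powr_mult_le_add:
  fixes a b r :: real
  assumes "a \<ge> 0" "b \<ge> 0" "r > 1"
  shows "a powr (r - 1) * b \<le> a powr r + b powr r"
proof -
  define m where "m = max a b"
  have "a powr (r - 1) * b \<le> m powr (r - 1) * m powr 1"
    using assms by (intro mult_mono powr_mono2) (auto simp: m_def)
  also have "\<dots> = m powr r" by (simp only: powr_add[symmetric]) simp
  also have "\<dots> \<le> a powr r + b powr r" by (simp add: m_def max_def)
  finally show ?thesis .
qed

text \<open>Young's inequality for the normalized functions, integrated. Without the optimal weights
  a factor 2 remains, which is harmless for boundedness and for remainders. Normalization requires
  positive norms; if one of them is 0, the integrand vanishes almost everywhere.\<close>

lemma Lr_Hoelder:
  assumes u: "u \<in> Lr r" and h: "h \<in> Lr r" and r: "r > 1"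
  shows Lr_Hoelder_integrable: "integrable lborel (\<lambda>x. \<bar>u x\<bar> powr (r - 1) * \<bar>h x\<bar>)"
    and Lr_Hoelder_le: "(\<integral>x. \<bar>u x\<bar> powr (r - 1) * \<bar>h x\<bar> \<partial>lborel)
      \<le> 2 * Lr_norm r u powr (r - 1) * Lr_norm r h"
proof -
  note [measurable] = u[THEN Lr_measurable] h[THEN Lr_measurable]
  note int = u[THEN Lr_integrable] h[THEN Lr_integrable]
  show I: "integrable lborel (\<lambda>x. \<bar>u x\<bar> powr (r - 1) * \<bar>h x\<bar>)"
    by (rule Bochner_Integration.integrable_bound[OF Bochner_Integration.integrable_add[OF int]])
      (use r in \<open>auto intro!: powr_mult_le_add\<close>)
  define \<alpha> \<beta> where "\<alpha> = Lr_norm r u" and "\<beta> = Lr_norm r h"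
  show "(\<integral>x. \<bar>u x\<bar> powr (r - 1) * \<bar>h x\<bar> \<partial>lborel) \<le> 2 * Lr_norm r u powr (r - 1) * Lr_norm r h"
  proof (cases "\<alpha> = 0 \<or> \<beta> = 0")
    case True
    then have "(AE x in lborel. u x = 0) \<or> (AE x in lborel. h x = 0)"
      using Lr_norm_eq_0_iff[OF u] Lr_norm_eq_0_iff[OF h] r by (auto simp: \<alpha>_def \<beta>_def)
    then have "AE x in lborel. \<bar>u x\<bar> powr (r - 1) * \<bar>h x\<bar> = 0" by auto
    then show ?thesis by (simp add: integral_eq_zero_AE)
  next
    case False
    then have pos: "\<alpha> > 0" "\<beta> > 0" by (auto simp: \<alpha>_def \<beta>_def less_le)
    let ?c = "\<alpha> powr (r - 1) * \<beta>"
    have "\<bar>u x\<bar> powr (r - 1) * \<bar>h x\<bar> \<le> ?c * (\<bar>u x\<bar> powr r / \<alpha> powr r + \<bar>h x\<bar> powr r / \<beta> powr r)" for x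
    proof -
      have "(\<bar>u x\<bar> / \<alpha>) powr (r - 1) * (\<bar>h x\<bar> / \<beta>) \<le> (\<bar>u x\<bar> / \<alpha>) powr r + (\<bar>h x\<bar> / \<beta>) powr r"
        using pos r by (intro powr_mult_le_add) auto
      then have "?c * ((\<bar>u x\<bar> / \<alpha>) powr (r - 1) * (\<bar>h x\<bar> / \<beta>))
          \<le> ?c * ((\<bar>u x\<bar> / \<alpha>) powr r + (\<bar>h x\<bar> / \<beta>) powr r)"
        using pos by (intro mult_left_mono) auto
      then show ?thesis using pos by (simp add: powr_divide)
    qed
    then have "(\<integral>x. \<bar>u x\<bar> powr (r - 1) * \<bar>h x\<bar> \<partial>lborel)
        \<le> (\<integral>x. ?c * (\<bar>u x\<bar> powr r / \<alpha> powr r + \<bar>h x\<bar> powr r / \<beta> powr r) \<partial>lborel)"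
      by (intro integral_mono I) (use int in auto)
    also have "\<dots> = ?c * (\<alpha> powr r / \<alpha> powr r + \<beta> powr r / \<beta> powr r)"
      using int r by (simp add: Lr_norm_powr \<alpha>_def \<beta>_def)
    also have "\<dots> = 2 * ?c" using pos by simp
    finally show ?thesis by (simp add: \<alpha>_def \<beta>_def)
  qed
qed

text \<open>
  The two regimes are \<open>\<bar>b\<bar> \<le> \<delta> * \<bar>a\<bar>\<close>, where homogeneity reduces the estimate to the
  differentiability of \<open>t powr r\<close> at 1, and \<open>\<bar>b\<bar> > \<delta> * \<bar>a\<bar>\<close>, where every term is a multiple of
  \<open>\<bar>b\<bar> powr r\<close>.  This covers \<open>r < 2\<close>, where \<open>\<bar>a\<bar> powr r\<close> is not twice differentiable.
\<close>

lemma abs_powr_taylor: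
  fixes r e :: real
  assumes r: "r > 1" and e: "e > 0"
  obtains C where "C \<ge> 0" "\<And>a b. \<bar>\<bar>a + b\<bar> powr r - \<bar>a\<bar> powr r - r * (\<bar>a\<bar> powr (r - 1) * sgn a * b)\<bar>
      \<le> e * (\<bar>a\<bar> powr (r - 1) * \<bar>b\<bar>) + C * \<bar>b\<bar> powr r"
proof -
  have "((\<lambda>t. t powr r) has_derivative (*) (r * 1 powr (r - 1))) (at 1)"
    using has_real_derivative_powr[of 1 r] by (simp add: has_field_derivative_def)
  then obtain \<delta>' where \<delta>': "\<delta>' > 0" "\<And>y. \<bar>y - 1\<bar> < \<delta>' \<Longrightarrow> \<bar>y powr r - 1 - r * (y - 1)\<bar> \<le> e * \<bar>y - 1\<bar>"
    using e unfolding has_derivative_at_alt by auto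
  \<comment> \<open>Half of the minimum gives \<delta> < \<delta>' and \<delta> < 1; the latter
    keeps 1 + t positive.\<close>
  define \<delta> where "\<delta> = min 1 \<delta>' / 2"
  have \<delta>: "\<delta> > 0" "\<delta> < 1" "\<delta> < \<delta>'" using \<delta>'(1) by (auto simp: \<delta>_def)
  define c where "c = 1 / \<delta>"
  \<comment> \<open>In the second regime |a| <= c |b|; the three summands bound |a + b|^r, |a|^r and
    the linear term by multiples of |b|^r.\<close>
  define C where "C = (c + 1) powr r + c powr r + r * c powr (r - 1)"
  have C: "C \<ge> 0" using r by (simp add: C_def)
  have "\<bar>\<bar>a + b\<bar> powr r - \<bar>a\<bar> powr r - r * (\<bar>a\<bar> powr (r - 1) * sgn a * b)\<bar>
      \<le> e * (\<bar>a\<bar> powr (r - 1) * \<bar>b\<bar>) + C * \<bar>b\<bar> powr r" for a b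
  proof (cases "a \<noteq> 0 \<and> \<bar>b\<bar> \<le> \<delta> * \<bar>a\<bar>")
    case True
    define t where "t = b / a"
    have a: "\<bar>a\<bar> powr r = \<bar>a\<bar> powr (r - 1) * \<bar>a\<bar>"
      using True powr_add[of "\<bar>a\<bar>" "r - 1" 1] by simp
    have t: "\<bar>t\<bar> \<le> \<delta>" "b = a * t" using True by (auto simp: t_def abs_divide pos_divide_le_eq)
    then have t1: "1 + t > 0" using \<delta> by linarith
    have "a + b = a * (1 + t)" by (simp add: t(2) distrib_left)
    then have "\<bar>a + b\<bar> = \<bar>a\<bar> * (1 + t)" using t1 by (simp only: abs_mult)
    then have "\<bar>a + b\<bar> powr r = \<bar>a\<bar> powr r * (1 + t) powr r" by (simp add: powr_mult)
    moreover have "\<bar>a\<bar> powr (r - 1) * sgn a * b = \<bar>a\<bar> powr r * t"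
      unfolding a t(2) by (simp add: sgn_if abs_if)
    ultimately have "\<bar>a + b\<bar> powr r - \<bar>a\<bar> powr r - r * (\<bar>a\<bar> powr (r - 1) * sgn a * b)
        = \<bar>a\<bar> powr r * ((1 + t) powr r - 1 - r * ((1 + t) - 1))"
      by (simp add: algebra_simps)
    also have "\<bar>\<dots>\<bar> \<le> \<bar>a\<bar> powr r * (e * \<bar>(1 + t) - 1\<bar>)"
      unfolding abs_mult using \<delta>'(2)[of "1 + t"] t \<delta> by (intro mult_mono) auto
    also have "\<dots> = e * (\<bar>a\<bar> powr (r - 1) * \<bar>b\<bar>)"
      unfolding a t(2) by (simp add: abs_mult)
    finally show ?thesis using C by (simp add: add_increasing2)
  next
    case False
    then have ab: "\<bar>a\<bar> \<le> c * \<bar>b\<bar>" using \<delta> by (cases "a = 0") (auto simp: c_def field_simps)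
    then have ab2: "\<bar>a + b\<bar> \<le> (c + 1) * \<bar>b\<bar>" unfolding distrib_right by linarith
    have d0: "0 \<le> c" using \<delta> by (simp add: c_def)
    have 1: "\<bar>a + b\<bar> powr r \<le> (c + 1) powr r * \<bar>b\<bar> powr r"
      using powr_mono2[OF _ _ ab2, of r] r d0 by (simp add: powr_mult)
    have 2: "\<bar>a\<bar> powr r \<le> c powr r * \<bar>b\<bar> powr r"
      using powr_mono2[OF _ _ ab, of r] r d0 by (simp add: powr_mult)
    have "\<bar>a\<bar> powr (r - 1) * \<bar>b\<bar> \<le> (c * \<bar>b\<bar>) powr (r - 1) * \<bar>b\<bar>"
      using powr_mono2[OF _ _ ab, of "r - 1"] r by (intro mult_right_mono) auto
    also have "\<dots> = c powr (r - 1) * \<bar>b\<bar> powr r"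
      using powr_add[of "\<bar>b\<bar>" "r - 1" 1] d0 by (cases "b = 0") (simp_all add: powr_mult)
    finally have "r * (\<bar>a\<bar> powr (r - 1) * \<bar>b\<bar>) \<le> r * (c powr (r - 1) * \<bar>b\<bar> powr r)"
      using r by (intro mult_left_mono) auto
    moreover have "\<bar>r * (\<bar>a\<bar> powr (r - 1) * sgn a * b)\<bar> \<le> r * (\<bar>a\<bar> powr (r - 1) * \<bar>b\<bar>)"
      using r by (cases "a = 0") (auto simp: abs_mult abs_sgn_eq)
    ultimately have 3: "\<bar>r * (\<bar>a\<bar> powr (r - 1) * sgn a * b)\<bar> \<le> r * c powr (r - 1) * \<bar>b\<bar> powr r"
      by (simp add: mult.assoc)
    have "0 \<le> e * (\<bar>a\<bar> powr (r - 1) * \<bar>b\<bar>)" using e by simp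
    moreover have "0 \<le> \<bar>a + b\<bar> powr r" "0 \<le> \<bar>a\<bar> powr r" by auto
    moreover have "C * \<bar>b\<bar> powr r = (c + 1) powr r * \<bar>b\<bar> powr r + c powr r * \<bar>b\<bar> powr r
        + r * c powr (r - 1) * \<bar>b\<bar> powr r" by (simp add: C_def algebra_simps)
    ultimately show ?thesis using 1 2 3 by linarith
  qed
  then show ?thesis using C that by blast
qed

lemma Lr_pairing_bounds:
  assumes u: "u \<in> Lr r" and h: "h \<in> Lr r" and r: "r > 1"
  shows Lr_pairing_integrable: "integrable lborel (\<lambda>x. \<bar>u x\<bar> powr (r - 1) * sgn (u x) * h x)"
    and Lr_pairing_le: "\<bar>Lr_pairing (\<lambda>x. \<bar>u x\<bar> powr (r - 1) * sgn (u x)) h\<bar>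
      \<le> 2 * Lr_norm r u powr (r - 1) * Lr_norm r h"
proof -
  note [measurable] = u[THEN Lr_measurable] h[THEN Lr_measurable]
  have le: "\<bar>\<bar>u x\<bar> powr (r - 1) * sgn (u x) * h x\<bar> \<le> \<bar>u x\<bar> powr (r - 1) * \<bar>h x\<bar>" for x
    by (simp add: abs_mult abs_sgn_eq)
  show I: "integrable lborel (\<lambda>x. \<bar>u x\<bar> powr (r - 1) * sgn (u x) * h x)"
    unfolding sgn_if
    by (rule Bochner_Integration.integrable_bound[OF Lr_Hoelder_integrable[OF u h r]])
      (use le in \<open>auto simp: sgn_if\<close>)
  have "\<bar>Lr_pairing (\<lambda>x. \<bar>u x\<bar> powr (r - 1) * sgn (u x)) h\<bar>
      \<le> (\<integral>x. \<bar>u x\<bar> powr (r - 1) * \<bar>h x\<bar> \<partial>lborel)"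
    unfolding Lr_pairing_def
    by (rule integral_abs_bound_integral[OF I])
      (use Lr_Hoelder_integrable[OF u h r] le in auto)
  also have "\<dots> \<le> 2 * Lr_norm r u powr (r - 1) * Lr_norm r h" by (rule Lr_Hoelder_le[OF u h r])
  finally show "\<bar>Lr_pairing (\<lambda>x. \<bar>u x\<bar> powr (r - 1) * sgn (u x)) h\<bar>
      \<le> 2 * Lr_norm r u powr (r - 1) * Lr_norm r h" .
qed

text \<open>\<open>abs_powr_taylor\<close> is integrated: the Hoelder estimate controls its first
  error term with a factor of order e, and its second one becomes C times the r-th power of the norm
  of h, which is of higher order because r > 1.\<close>

lemma Lr_integral_has_derivative:
  assumes u: "u \<in> Lr r" and r: "r > 1"
  shows "has_derivative_Lr r (\<lambda>w. \<integral>x. \<bar>w x\<bar> powr r \<partial>lborel)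
    (\<lambda>h. r * Lr_pairing (\<lambda>x. \<bar>u x\<bar> powr (r - 1) * sgn (u x)) h) u"
  unfolding has_derivative_Lr_def
proof (intro conjI allI impI)
  let ?P = "Lr_pairing (\<lambda>x. \<bar>u x\<bar> powr (r - 1) * sgn (u x))"
  have "?P (\<lambda>x. g x + h x) = ?P g + ?P h" if "g \<in> Lr r" "h \<in> Lr r" for g h
    using Lr_pairing_integrable[OF u that(1) r] Lr_pairing_integrable[OF u that(2) r]
    by (simp add: Lr_pairing_def distrib_left)
  moreover have "?P (\<lambda>x. c * h x) = c * ?P h" for c h
    unfolding Lr_pairing_def by (subst mult.left_commute) simp
  moreover have "\<bar>r * ?P h\<bar> \<le> (r * (2 * Lr_norm r u powr (r - 1))) * Lr_norm r h" if "h \<in> Lr r" for h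
    using mult_left_mono[OF Lr_pairing_le[OF u that r], of r] r by (simp add: abs_mult mult.assoc)
  ultimately show "bounded_linear_Lr r (\<lambda>h. r * ?P h)"
    unfolding bounded_linear_Lr_def real_norm_def real_scaleR_def
    by (intro conjI ballI allI exI[of _ "r * (2 * Lr_norm r u powr (r - 1))"]) (simp_all add: distrib_left)
  fix e :: real assume e: "e > 0"
  define A where "A = Lr_norm r u powr (r - 1)"
  have A: "A \<ge> 0" by (simp add: A_def)
  define e1 where "e1 = e / (4 * (A + 1))"
  have e1: "e1 > 0" using e A by (simp add: e1_def)
  obtain C where C: "C \<ge> 0"
    "\<And>a b. \<bar>\<bar>a + b\<bar> powr r - \<bar>a\<bar> powr r - r * (\<bar>a\<bar> powr (r - 1) * sgn a * b)\<bar>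
      \<le> e1 * (\<bar>a\<bar> powr (r - 1) * \<bar>b\<bar>) + C * \<bar>b\<bar> powr r"
    using abs_powr_taylor[OF r e1] by metis
  \<comment> \<open>For n below d the factor C n^(r - 1) is at most e / 2.\<close>
  define d where "d = (e / (2 * (C + 1))) powr (1 / (r - 1))"
  have d: "d > 0" using e C(1) by (simp add: d_def)
  have "\<bar>(\<integral>x. \<bar>u x + h x\<bar> powr r \<partial>lborel) - (\<integral>x. \<bar>u x\<bar> powr r \<partial>lborel) - r * ?P h\<bar> \<le> e * Lr_norm r h"
    if h: "h \<in> Lr r" "Lr_norm r h < d" for h
  proof -
    have "r > 0" using r by simp
    note int = Lr_integrable[OF u] Lr_integrable[OF h(1)] Lr_pairing_integrable[OF u h(1) r]
      Lr_Hoelder_integrable[OF u h(1) r] Lr_integrable[OF Lr_add[OF u h(1) this]]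
    define n where "n = Lr_norm r h"
    have n: "n \<ge> 0" by (simp add: n_def)
    have eq: "(\<integral>x. \<bar>u x + h x\<bar> powr r \<partial>lborel) - (\<integral>x. \<bar>u x\<bar> powr r \<partial>lborel) - r * ?P h
        = (\<integral>x. \<bar>u x + h x\<bar> powr r - \<bar>u x\<bar> powr r
          - r * (\<bar>u x\<bar> powr (r - 1) * sgn (u x) * h x) \<partial>lborel)"
      using int r by (simp add: Lr_pairing_def)
    have "\<bar>(\<integral>x. \<bar>u x + h x\<bar> powr r \<partial>lborel) - (\<integral>x. \<bar>u x\<bar> powr r \<partial>lborel) - r * ?P h\<bar>
        \<le> (\<integral>x. e1 * (\<bar>u x\<bar> powr (r - 1) * \<bar>h x\<bar>) + C * \<bar>h x\<bar> powr r \<partial>lborel)"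
      unfolding eq
    proof (rule integral_abs_bound_integral)
      show "integrable lborel (\<lambda>x. \<bar>u x + h x\<bar> powr r - \<bar>u x\<bar> powr r
          - r * (\<bar>u x\<bar> powr (r - 1) * sgn (u x) * h x))"
        by (intro Bochner_Integration.integrable_diff integrable_mult_right int)
      show "integrable lborel (\<lambda>x. e1 * (\<bar>u x\<bar> powr (r - 1) * \<bar>h x\<bar>) + C * \<bar>h x\<bar> powr r)"
        by (intro Bochner_Integration.integrable_add integrable_mult_right int)
    qed (rule C(2))
    also have "\<dots> = e1 * (\<integral>x. \<bar>u x\<bar> powr (r - 1) * \<bar>h x\<bar> \<partial>lborel) + C * n powr r"
      unfolding n_def Lr_norm_powr[OF \<open>r > 0\<close>]
      by (subst Bochner_Integration.integral_add) (use int in simp_all)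
    also have "\<dots> \<le> e1 * (2 * A * n) + C * (n powr (r - 1) * n)"
    proof (rule add_mono)
      show "e1 * (\<integral>x. \<bar>u x\<bar> powr (r - 1) * \<bar>h x\<bar> \<partial>lborel) \<le> e1 * (2 * A * n)"
        using Lr_Hoelder_le[OF u h(1) r] e1 by (simp add: A_def n_def)
      show "C * n powr r \<le> C * (n powr (r - 1) * n)"
        using powr_add[of n "r - 1" 1] n by (cases "n = 0") simp_all
    qed
    also have "\<dots> \<le> e / 2 * n + e / 2 * n"
    proof (rule add_mono)
      have "e1 * (2 * A) \<le> e / 2" using A e by (simp add: e1_def field_simps)
      from mult_right_mono[OF this n] show "e1 * (2 * A * n) \<le> e / 2 * n" by (simp add: mult_ac)
      have "n powr (r - 1) \<le> d powr (r - 1)" using h(2) n r by (intro powr_mono2) (auto simp: n_def)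
      also have "\<dots> = e / (2 * (C + 1))" using r e C(1) by (simp add: d_def powr_powr)
      finally have "C * n powr (r - 1) \<le> (C + 1) * (e / (2 * (C + 1)))"
        using C(1) by (intro mult_mono) auto
      also have "\<dots> = e / 2" using C(1) by (simp add: divide_simps)
      finally show "C * (n powr (r - 1) * n) \<le> e / 2 * n"
        by (simp only: mult.assoc[symmetric] mult_right_mono[OF _ n])
    qed
    finally show ?thesis by (simp add: n_def)
  qed
  then show "\<exists>d>0. \<forall>h\<in>Lr r. Lr_norm r h < d \<longrightarrow>
      norm ((\<integral>x. \<bar>u x + h x\<bar> powr r \<partial>lborel) - (\<integral>x. \<bar>u x\<bar> powr r \<partial>lborel) - r * ?P h) \<le> e * Lr_norm r h"
    using d by auto
qed

text \<open>Where the norm is positive this is the chain rule for t^(p/r) applied to the integral.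
  That power need not be differentiable at 0; there the increment is the p-th power of the norm of
  h, which is of higher order because p > 1.\<close>

lemma Lr_norm_powr_has_derivative:
  assumes u: "u \<in> Lr r" and r: "r > 1" and p: "p > 1"
  shows "has_derivative_Lr r (\<lambda>w. Lr_norm r w powr p)
    (\<lambda>h. p * Lr_norm r u powr (p - r) * Lr_pairing (\<lambda>x. \<bar>u x\<bar> powr (r - 1) * sgn (u x)) h) u"
proof (cases "Lr_norm r u = 0")
  case False
  define N where "N = (\<integral>x. \<bar>u x\<bar> powr r \<partial>lborel)"
  have N: "N = Lr_norm r u powr r" using Lr_norm_powr[of r u] r by (simp add: N_def)
  have pos: "Lr_norm r u > 0" using False by (simp add: less_le)
  then have "N > 0" by (simp add: N)
  then have "((\<lambda>t. t powr (p / r)) has_derivative (*) (p / r * N powr (p / r - 1))) (at N)"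
    using has_real_derivative_powr unfolding has_field_derivative_def by blast
  note der = has_derivative_Lr_compose[OF Lr_integral_has_derivative[OF u r], folded N_def, OF this]
  have "N powr (p / r - 1) = Lr_norm r u powr (p - r)"
    using pos r by (simp add: N powr_powr right_diff_distrib)
  then have "(\<lambda>h. p / r * N powr (p / r - 1) * (r * D h)) = (\<lambda>h. p * Lr_norm r u powr (p - r) * D h)"
    for D :: "('a \<Rightarrow> real) \<Rightarrow> real" using r by (auto simp: fun_eq_iff)
  moreover have "(\<lambda>w. Lr_norm r w powr p) = (\<lambda>w :: 'a \<Rightarrow> real. (\<integral>x. \<bar>w x\<bar> powr r \<partial>lborel) powr (p / r))"
    by (simp add: Lr_norm_def powr_powr)
  ultimately show ?thesis using der by simp
next
  case True
  then have u0: "AE x in lborel. u x = 0" using Lr_norm_eq_0_iff[OF u] r by simp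
  \<comment> \<open>Elements of \<open>Lr r\<close> are functions and not classes: u vanishes only
    almost everywhere, yet adding it changes no norm.\<close>
  have eq: "Lr_norm r (\<lambda>x. u x + h x) = Lr_norm r h" if h: "h \<in> Lr r" for h
  proof -
    note [measurable] = u[THEN Lr_measurable] h[THEN Lr_measurable]
    have "(\<integral>x. \<bar>u x + h x\<bar> powr r \<partial>lborel) = (\<integral>x. \<bar>h x\<bar> powr r \<partial>lborel)"
      by (rule integral_cong_AE) (use u0 in auto)
    then show ?thesis by (simp add: Lr_norm_def)
  qed
  have "has_derivative_Lr r (\<lambda>w. Lr_norm r w powr p) (\<lambda>_. 0) u"
    unfolding has_derivative_Lr_def
  proof (intro conjI allI impI)
    show "bounded_linear_Lr r (\<lambda>_. 0::real)"
      by (auto simp: bounded_linear_Lr_def intro!: exI[of _ 0])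
    fix e :: real assume e: "e > 0"
    have "Lr_norm r h powr p \<le> e * Lr_norm r h" if "Lr_norm r h < e powr (1 / (p - 1))"
      for h :: "'a \<Rightarrow> real"
    proof -
      have "Lr_norm r h powr (p - 1) \<le> (e powr (1 / (p - 1))) powr (p - 1)"
        using that p by (intro powr_mono2) auto
      also have "\<dots> = e" using p e by (simp add: powr_powr)
      finally have "Lr_norm r h powr (p - 1) * Lr_norm r h \<le> e * Lr_norm r h"
        by (rule mult_right_mono) simp
      then show ?thesis
        using powr_add[of "Lr_norm r h" "p - 1" 1] by (cases "Lr_norm r h = 0") simp_all
    qed
    then show "\<exists>d>0. \<forall>h\<in>Lr r. Lr_norm r h < d \<longrightarrow>
        norm (Lr_norm r (\<lambda>x. u x + h x) powr p - Lr_norm r u powr p - 0) \<le> e * Lr_norm r h"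
      using e True by (intro exI[of _ "e powr (1 / (p - 1))"]) (auto simp: eq)
  qed
  \<comment> \<open>\<open>0 powr (p - r)\<close> is 0 even for a negative exponent, so the formula
    gives the zero functional here, in accordance with the convention for u = 0.\<close>
  then show ?thesis using True by simp
qed

text \<open>At v = 0 the increment |s|^p is at most |s|^2 for |s| <= 1 because p >= 2; elsewhere the
  chain rule applies.\<close>

lemma norm_powr_has_derivative:
  fixes v :: "'v::real_inner"
  assumes "p \<ge> 2"
  shows "((\<lambda>w. norm w powr p) has_derivative (\<lambda>h. p * norm v powr (p - 2) * (v \<bullet> h))) (at v)"
proof (cases "v = 0")
  case True
  have "((\<lambda>w::'v. norm w powr p) has_derivative (\<lambda>h. 0)) (at 0)"
  proof (rule has_derivative_quadraticI[where N = 1])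
    fix s :: 'v assume "norm s \<le> 1"
    then show "norm (norm (0 + s) powr p - norm (0::'v) powr p - 0) \<le> 1 * (norm s)\<^sup>2"
      using powr_mono'[of 2 p "norm s"] assms by (cases "s = 0") auto
  qed simp
  then show ?thesis using True by simp
next
  case False
  have "((\<lambda>t. t powr p) has_derivative (*) (p * norm v powr (p - 1))) (at (norm v))"
    using has_real_derivative_powr[of "norm v" p] False by (simp add: has_field_derivative_def)
  from has_derivative_compose[OF has_derivative_norm[OF False] this]
  have "((\<lambda>w. norm w powr p) has_derivative (\<lambda>h. p * norm v powr (p - 1) * (h \<bullet> sgn v))) (at v)"
    by simp
  moreover have "norm v powr (p - 1) * (h \<bullet> sgn v) = norm v powr (p - 2) * (v \<bullet> h)" for h
    using False powr_add[of "norm v" "p - 2" 1]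
    by (simp add: sgn_div_norm inner_commute)
  ultimately show ?thesis by (simp add: mult.assoc)
qed


section \<open>The Lagrangian and the adjoint equations\<close>

lemma deriv_f_works:
  assumes "(\<lambda>g. G g u v) differentiable (at f)"
  shows "((\<lambda>g. G g u v) has_derivative blinfun_apply (deriv_f G f u v)) (at f)"
  using assms has_derivative_bounded_linear
  by (fastforce simp: frechet_derivative_works deriv_f_def bounded_linear_Blinfun_apply)

lemma deriv_v_works:
  assumes "(\<lambda>w. G f u w) differentiable (at v)"
  shows "((\<lambda>w. G f u w) has_derivative blinfun_apply (deriv_v G f u v)) (at v)"
  using assms has_derivative_bounded_linear
  by (fastforce simp: frechet_derivative_works deriv_v_def bounded_linear_Blinfun_apply)

lemma deriv_u_works:
  assumes "\<exists>D. has_derivative_Lr r (\<lambda>w. G f w v) D u"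
  shows "has_derivative_Lr r (\<lambda>w. G f w v) (deriv_u r G f u v) u"
  using someI_ex[OF assms] by (simp add: deriv_u_def frechet_derivative_Lr_def)

section \<open>Dependence of cost, Lagrangian and states on a single variable\<close>

lemma control_cost_upd_u:
  assumes "k \<in> {1..T-1}"
  shows "control_cost T C p r (u(k := w)) v
    = control_cost T C p r u v + 1 / real T * C * (Lr_norm r w powr p - Lr_norm r (u k) powr p)"
proof -
  have "(\<Sum>j=1..T-1. C * Lr_norm r ((u(k := w)) j) powr p + norm (v j) powr p)
      = (\<Sum>j=1..T-1. (C * Lr_norm r (u j) powr p + norm (v j) powr p)
          + (if j = k then C * (Lr_norm r w powr p - Lr_norm r (u k) powr p) else 0))"
    by (intro sum.cong) (auto simp: algebra_simps)
  also have "\<dots> = (\<Sum>j=1..T-1. C * Lr_norm r (u j) powr p + norm (v j) powr p)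
      + C * (Lr_norm r w powr p - Lr_norm r (u k) powr p)"
    using assms by (subst sum.distrib) simp
  finally show ?thesis by (simp add: control_cost_def add_divide_distrib)
qed

lemma control_cost_upd_v:
  assumes "k \<in> {1..T-1}"
  shows "control_cost T C p r u (v(k := w))
    = control_cost T C p r u v + 1 / real T * (norm w powr p - norm (v k) powr p)"
proof -
  have "(\<Sum>j=1..T-1. C * Lr_norm r (u j) powr p + norm ((v(k := w)) j) powr p)
      = (\<Sum>j=1..T-1. (C * Lr_norm r (u j) powr p + norm (v j) powr p)
          + (if j = k then norm w powr p - norm (v k) powr p else 0))"
    by (intro sum.cong) auto
  also have "\<dots> = (\<Sum>j=1..T-1. C * Lr_norm r (u j) powr p + norm (v j) powr p)
      + (norm w powr p - norm (v k) powr p)"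
    using assms by (subst sum.distrib) simp
  finally show ?thesis by (simp add: control_cost_def add_divide_distrib)
qed

text \<open>Besides the cost, u_k occurs only in constraint k + 1.\<close>

lemma lagrangian_upd_u:
  assumes k: "k \<in> {1..T-1}"
  shows "lagrangian T C p r U G i f (u(k := w)) v l = lagrangian T C p r U G i f u v l
    + 1 / real T * C * (Lr_norm r w powr p - Lr_norm r (u k) powr p)
    - l (k + 1) (G (f k) w (v k) - G (f k) (u k) (v k))"
proof -
  have "(\<Sum>j=2..T. l j (f j - G (f (j-1)) ((u(k := w)) (j-1)) (v (j-1))))
      = (\<Sum>j=2..T. l j (f j - G (f (j-1)) (u (j-1)) (v (j-1)))
          + (if j = k + 1 then - l (k + 1) (G (f k) w (v k) - G (f k) (u k) (v k)) else 0))"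
    by (intro sum.cong) (auto simp: blinfun.diff_right)
  also have "\<dots> = (\<Sum>j=2..T. l j (f j - G (f (j-1)) (u (j-1)) (v (j-1))))
      - l (k + 1) (G (f k) w (v k) - G (f k) (u k) (v k))"
    using k by (subst sum.distrib) auto
  finally show ?thesis by (simp add: lagrangian_def control_cost_upd_u[OF k])
qed

lemma lagrangian_upd_v:
  assumes k: "k \<in> {1..T-1}"
  shows "lagrangian T C p r U G i f u (v(k := w)) l = lagrangian T C p r U G i f u v l
    + 1 / real T * (norm w powr p - norm (v k) powr p)
    - l (k + 1) (G (f k) (u k) w - G (f k) (u k) (v k))"
proof -
  have "(\<Sum>j=2..T. l j (f j - G (f (j-1)) (u (j-1)) ((v(k := w)) (j-1))))
      = (\<Sum>j=2..T. l j (f j - G (f (j-1)) (u (j-1)) (v (j-1)))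
          + (if j = k + 1 then - l (k + 1) (G (f k) (u k) w - G (f k) (u k) (v k)) else 0))"
    by (intro sum.cong) (auto simp: blinfun.diff_right)
  also have "\<dots> = (\<Sum>j=2..T. l j (f j - G (f (j-1)) (u (j-1)) (v (j-1))))
      - l (k + 1) (G (f k) (u k) w - G (f k) (u k) (v k))"
    using k by (subst sum.distrib) auto
  finally show ?thesis by (simp add: lagrangian_def control_cost_upd_v[OF k])
qed

text \<open>f_k occurs linearly in constraint k and through G in constraint k + 1; at k = T the
  latter is absent and U takes its place.\<close>

lemma lagrangian_upd_f:
  assumes k: "k \<in> {1..T}"
  shows "lagrangian T C p r U G i (f(k := g)) u v l = lagrangian T C p r U G i f u v l
    + (if k = T then U g - U (f T) else 0) + l k (g - f k)
    - (if k < T then l (k + 1) (G g (u k) (v k) - G (f k) (u k) (v k)) else 0)"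
proof -
  let ?f = "f(k := g)"
  have "(\<Sum>j=2..T. l j (?f j - G (?f (j-1)) (u (j-1)) (v (j-1))))
      = (\<Sum>j=2..T. l j (f j - G (f (j-1)) (u (j-1)) (v (j-1)))
          + ((if j = k then l k (g - f k) else 0)
            + (if j = k + 1 then - l (k + 1) (G g (u k) (v k) - G (f k) (u k) (v k)) else 0)))"
    by (intro sum.cong) (auto simp: blinfun.diff_right)
  also have "\<dots> = (\<Sum>j=2..T. l j (f j - G (f (j-1)) (u (j-1)) (v (j-1))))
      + ((if k \<in> {2..T} then l k (g - f k) else 0)
        + (if k + 1 \<in> {2..T} then - l (k + 1) (G g (u k) (v k) - G (f k) (u k) (v k)) else 0))"
    by (subst sum.distrib, subst sum.distrib) simp
  \<comment> \<open>For k = 1 the linear occurrence lies in the separate term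
    \<open>l 1 (f 1 - i)\<close>, outside the sum that starts at 2.\<close>
  finally show ?thesis
    using k by (cases "k = 1") (auto simp: lagrangian_def blinfun.diff_right)
qed

text \<open>States 0 and 1 are the initial state, and u_k acts first on state k + 1.\<close>

lemma state_upd_u: "j \<le> k \<Longrightarrow> state G i (u(k := w)) v j = state G i u v j"
  by (induction j) auto

lemma state_upd_v: "j \<le> k \<Longrightarrow> state G i u (v(k := w)) j = state G i u v j"
  by (induction j) auto

section \<open>Derivatives of the states, paired with the multipliers\<close>

context
  fixes G :: "'a::euclidean_space C10 \<Rightarrow> ('a \<Rightarrow> real) \<Rightarrow> 'v::real_inner \<Rightarrow> 'a C10" and r :: real
  assumes diff_f: "\<And>f u v. u \<in> Lr r \<Longrightarrow> (\<lambda>g. G g u v) differentiable (at f)"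
    and diff_u: "\<And>f u v. u \<in> Lr r \<Longrightarrow> \<exists>D. has_derivative_Lr r (\<lambda>w. G f w v) D u"
    and diff_v: "\<And>f u v. u \<in> Lr r \<Longrightarrow> (\<lambda>w. G f u w) differentiable (at v)"
begin

context
  fixes T :: nat and i :: "'a C10" and u :: "nat \<Rightarrow> 'a \<Rightarrow> real" and v :: "nat \<Rightarrow> 'v"
    and l :: "nat \<Rightarrow> 'a C10 \<Rightarrow>\<^sub>L real" and f :: "nat \<Rightarrow> 'a C10"
  assumes u: "\<forall>k\<in>{1..T-1}. u k \<in> Lr r" and f: "f = state G i u v"
    and l: "\<forall>k\<in>{1..T-1}. l k = banach_adjoint (deriv_f G (f k) (u k) (v k)) (l (k + 1))"
begin

text \<open>The derivative of the state stays existential; what the induction propagates is its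
  pairing with l_j, so the product of partial differentials along the trajectory is never written
  down.\<close>

lemma state_has_derivative_u:
  assumes k: "k \<in> {1..T-1}" and j: "k + 1 \<le> j" "j \<le> T"
  shows "\<exists>D. has_derivative_Lr r (\<lambda>w. state G i (u(k := w)) v j) D (u k) \<and>
    (\<forall>h. l j (D h) = l (k + 1) (deriv_u r G (f k) (u k) (v k) h))"
  using j
proof (induction j rule: dec_induct)
  case base
  have "(\<lambda>w. state G i (u(k := w)) v (k + 1)) = (\<lambda>w. G (f k) w (v k))"
    using k by (simp add: state_upd_u f)
  moreover have "has_derivative_Lr r (\<lambda>w. G (f k) w (v k)) (deriv_u r G (f k) (u k) (v k)) (u k)"
    by (intro deriv_u_works diff_u u[rule_format] k)
  ultimately show ?case by (simp only:) blast
next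
  case (step j)
  then obtain D where D: "has_derivative_Lr r (\<lambda>w. state G i (u(k := w)) v j) D (u k)"
    "\<And>h. l j (D h) = l (k + 1) (deriv_u r G (f k) (u k) (v k) h)" using Suc_leD by blast
  have j: "j \<in> {1..T-1}" using step k by auto
  \<comment> \<open>The evaluation point carries the trivial update \<open>u(k := u k)\<close>, the
    form in which the chain rule presents the value of the inner map.\<close>
  have "((\<lambda>g. G g (u j) (v j)) has_derivative blinfun_apply (deriv_f G (f j) (u j) (v j)))
      (at (state G i (u(k := u k)) v j))"
    unfolding fun_upd_triv f[symmetric] by (intro deriv_f_works diff_f u[rule_format] j)
  note der = has_derivative_Lr_compose[OF D(1), OF this]
  have eq: "(\<lambda>w. state G i (u(k := w)) v (Suc j)) = (\<lambda>w. G (state G i (u(k := w)) v j) (u j) (v j))"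
    using step by (auto simp: fun_eq_iff)
  have adj: "l (Suc j) (deriv_f G (f j) (u j) (v j) (D h)) = l j (D h)" for h
    using l j by (simp add: banach_adjoint_def)
  show ?case
    unfolding eq
    by (intro exI[of _ "\<lambda>h. deriv_f G (f j) (u j) (v j) (D h)"] conjI allI der) (simp only: adj D(2))
qed

text \<open>The same induction with the ordinary chain rule, since v_k ranges over a normed
  space.\<close>

lemma state_has_derivative_v:
  assumes k: "k \<in> {1..T-1}" and j: "k + 1 \<le> j" "j \<le> T"
  shows "\<exists>D. ((\<lambda>w. state G i u (v(k := w)) j) has_derivative D) (at (v k)) \<and>
    (\<forall>h. l j (D h) = l (k + 1) (deriv_v G (f k) (u k) (v k) h))"
  using j
proof (induction j rule: dec_induct)
  case base
  have "(\<lambda>w. state G i u (v(k := w)) (k + 1)) = (\<lambda>w. G (f k) (u k) w)"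
    using k by (simp add: state_upd_v f)
  moreover have "((\<lambda>w. G (f k) (u k) w) has_derivative deriv_v G (f k) (u k) (v k)) (at (v k))"
    by (intro deriv_v_works diff_v u[rule_format] k)
  ultimately show ?case by (simp only:) blast
next
  case (step j)
  then obtain D where D: "((\<lambda>w. state G i u (v(k := w)) j) has_derivative D) (at (v k))"
    "\<And>h. l j (D h) = l (k + 1) (deriv_v G (f k) (u k) (v k) h)" using Suc_leD by blast
  have j: "j \<in> {1..T-1}" using step k by auto
  have "((\<lambda>g. G g (u j) (v j)) has_derivative blinfun_apply (deriv_f G (f j) (u j) (v j)))
      (at (state G i u (v(k := v k)) j))"
    unfolding fun_upd_triv f[symmetric] by (intro deriv_f_works diff_f u[rule_format] j)
  note der = has_derivative_compose[OF D(1), OF this]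
  have eq: "(\<lambda>w. state G i u (v(k := w)) (Suc j)) = (\<lambda>w. G (state G i u (v(k := w)) j) (u j) (v j))"
    using step by (auto simp: fun_eq_iff)
  have adj: "l (Suc j) (deriv_f G (f j) (u j) (v j) (D h)) = l j (D h)" for h
    using l j by (simp add: banach_adjoint_def)
  show ?case
    unfolding eq
    by (intro exI[of _ "\<lambda>h. deriv_f G (f j) (u j) (v j) (D h)"] conjI allI der) (simp only: adj D(2))
qed

end

section \<open>Critical points and the gradients of the reduced energy and of the Lagrangian\<close>

context
  fixes p C :: real and T :: nat and U :: "'a C10 \<Rightarrow> real" and dU :: "'a C10 \<Rightarrow> 'a C10 \<Rightarrow>\<^sub>L real"
  assumes p: "p > 2" and r: "r > 1" and T: "T > 0"
    and dU: "\<And>h. (U has_derivative blinfun_apply (dU h)) (at h)"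
begin

text \<open>Derivatives are unique, so the one computed from \<open>lagrangian_upd_f\<close> must be
  the zero map; evaluation in every direction gives the equations between functionals.\<close>

lemma critical_point_imp_adjoint_system:
  assumes "critical_point T r (lagrangian T C p r U G i) f u v l"
  shows "adjoint_system T dU G f u v l"
proof -
  let ?L = "lagrangian T C p r U G i"
  have u: "u k \<in> Lr r" if "k \<in> {1..T-1}" for k
    using assms that by (simp add: critical_point_def)
  have crit: "((\<lambda>g. ?L (f(k := g)) u v l) has_derivative (\<lambda>_. 0)) (at (f k))" if "k \<in> {1..T}" for k
    using assms that by (simp add: critical_point_def)
  have "l T = - dU (f T)"
  proof -
    have TT: "T \<in> {1..T}" using T by simp
    have "((\<lambda>g. ?L (f(T := g)) u v l) has_derivative (\<lambda>h. dU (f T) h + l T h)) (at (f T))"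
      unfolding lagrangian_upd_f[OF TT]
      by (auto intro!: derivative_eq_intros dU)
    from has_derivative_unique[OF this crit[OF TT]] show ?thesis
      by (intro blinfun_eqI) (auto simp: fun_eq_iff blinfun.minus_left eq_neg_iff_add_eq_0 add.commute)
  qed
  moreover have "l k = banach_adjoint (deriv_f G (f k) (u k) (v k)) (l (k + 1))" if k: "k \<in> {1..T-1}" for k
  proof -
    have kT: "k \<in> {1..T}" "k < T" "k \<noteq> T" using k by auto
    have "((\<lambda>g. ?L (f(k := g)) u v l) has_derivative
        (\<lambda>h. l k h - l (k + 1) (deriv_f G (f k) (u k) (v k) h))) (at (f k))"
      unfolding lagrangian_upd_f[OF kT(1)] using kT
      by (auto intro!: derivative_eq_intros deriv_f_works diff_f u k)
    from has_derivative_unique[OF this crit[OF kT(1)]] show ?thesis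
      by (intro blinfun_eqI) (auto simp: fun_eq_iff banach_adjoint_def)
  qed
  ultimately show ?thesis by (simp add: adjoint_system_def)
qed

text \<open>The shape \<open>a + c * (_ - b)\<close> is that of \<open>control_cost_upd_u\<close>.
  The scalar factors are moved inside the pairing, so that a single function represents the
  derivative; it lies in the dual space by \<open>Lr_duality_map\<close>.\<close>

lemma Lr_norm_cost_has_derivative:
  assumes "u \<in> Lr r"
  shows "has_derivative_Lr r (\<lambda>w. a + c * (Lr_norm r w powr p - b))
    (Lr_pairing (\<lambda>x. c * p * Lr_norm r u powr (p - r) * \<bar>u x\<bar> powr (r - 1) * sgn (u x))) u"
proof -
  have "((\<lambda>t. a + c * (t - b)) has_derivative (\<lambda>s. c * s)) (at (Lr_norm r u powr p))"
    by (auto intro!: derivative_eq_intros)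
  from has_derivative_Lr_compose[OF Lr_norm_powr_has_derivative[OF assms r], OF _ this] p
  have "has_derivative_Lr r (\<lambda>w. a + c * (Lr_norm r w powr p - b))
    (\<lambda>h. c * (p * Lr_norm r u powr (p - r) * Lr_pairing (\<lambda>x. \<bar>u x\<bar> powr (r - 1) * sgn (u x)) h)) u"
    by simp
  moreover have "(\<lambda>h. c * (p * Lr_norm r u powr (p - r) * Lr_pairing (\<lambda>x. \<bar>u x\<bar> powr (r - 1) * sgn (u x)) h))
      = Lr_pairing (\<lambda>x. c * p * Lr_norm r u powr (p - r) * \<bar>u x\<bar> powr (r - 1) * sgn (u x))"
    by (intro ext) (simp add: Lr_pairing_def mult.assoc)
  ultimately show ?thesis by simp
qed

lemma norm_cost_has_derivative:
  "((\<lambda>w. a + c * (norm w powr p - b)) has_derivative (\<lambda>h. c * p * norm v powr (p - 2) * (v \<bullet> h))) (at v)"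
  for v :: 'v
proof -
  have "((\<lambda>t. a + c * (t - b)) has_derivative (\<lambda>s. c * s)) (at (norm v powr p))"
    by (auto intro!: derivative_eq_intros)
  from has_derivative_compose[OF norm_powr_has_derivative, OF _ this] p show ?thesis
    by (simp add: mult.assoc)
qed

context
  fixes i :: "'a C10" and f u v l k
  assumes u: "\<forall>k\<in>{1..T-1}. u k \<in> Lr r" and f: "f = state G i u v"
    and adj: "adjoint_system T dU G f u v l" and k: "k \<in> {1..T-1}"
begin

lemma l_adjoint: "\<forall>k\<in>{1..T-1}. l k = banach_adjoint (deriv_f G (f k) (u k) (v k)) (l (k + 1))"
  and l_final: "l T = - dU (f T)"
  using adj by (auto simp: adjoint_system_def)

lemma k_less: "k + 1 \<le> T"
  using k by auto

lemma reduced_energy_has_derivative_u: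
  "has_derivative_Lr r (\<lambda>w. reduced_energy T C p r U G i (u(k := w)) v)
    (\<lambda>h. Lr_pairing (\<lambda>x. 1 / real T * C * p * Lr_norm r (u k) powr (p - r)
        * \<bar>u k x\<bar> powr (r - 1) * sgn (u k x)) h
      - l (k + 1) (deriv_u r G (f k) (u k) (v k) h)) (u k)"
proof -
  obtain D where D: "has_derivative_Lr r (\<lambda>w. state G i (u(k := w)) v T) D (u k)"
    "\<And>h. l T (D h) = l (k + 1) (deriv_u r G (f k) (u k) (v k) h)"
    using state_has_derivative_u[OF u f l_adjoint k k_less order_refl] by blast
  have "(U has_derivative dU (f T)) (at (state G i (u(k := u k)) v T))"
    using dU[of "f T"] by (simp add: f)
  note U_der = has_derivative_Lr_compose[OF D(1), OF this]
  \<comment> \<open>The minus sign of the adjoint term arises here, from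
    \<open>l T = - dU (f T)\<close>.\<close>
  have eq: "dU (f T) (D h) = - l (k + 1) (deriv_u r G (f k) (u k) (v k) h)" for h
    using D(2)[of h] by (simp add: l_final blinfun.minus_left)
  show ?thesis
    unfolding reduced_energy_def control_cost_upd_u[OF k]
    by (rule has_derivative_Lr_add[OF Lr_norm_cost_has_derivative[OF u[rule_format, OF k]] U_der,
          unfolded eq add_uminus_conv_diff])
qed

lemma reduced_energy_has_derivative_v:
  "((\<lambda>w. reduced_energy T C p r U G i u (v(k := w))) has_derivative
    (\<lambda>h. 1 / real T * p * norm (v k) powr (p - 2) * (v k \<bullet> h)
      - banach_adjoint (deriv_v G (f k) (u k) (v k)) (l (k + 1)) h)) (at (v k))"
proof -
  obtain D where D: "((\<lambda>w. state G i u (v(k := w)) T) has_derivative D) (at (v k))"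
    "\<And>h. l T (D h) = l (k + 1) (deriv_v G (f k) (u k) (v k) h)"
    using state_has_derivative_v[OF u f l_adjoint k k_less order_refl] by blast
  have "(U has_derivative dU (f T)) (at (state G i u (v(k := v k)) T))"
    using dU[of "f T"] by (simp add: f)
  note U_der = has_derivative_compose[OF D(1), OF this]
  have eq: "dU (f T) (D h) = - l (k + 1) (deriv_v G (f k) (u k) (v k) h)" for h
    using D(2)[of h] by (simp add: l_final blinfun.minus_left)
  show ?thesis
    unfolding reduced_energy_def control_cost_upd_v[OF k] banach_adjoint_def blinfun_apply_blinfun_compose o_apply
    by (rule has_derivative_add[OF norm_cost_has_derivative U_der, unfolded eq add_uminus_conv_diff])
qed

text \<open>With the states held fixed, u_k acts on the cost and on constraint k + 1 alone; this
  gives directly the term that the adjoint recursion produces for the reduced energy.\<close>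

lemma lagrangian_has_derivative_u:
  "has_derivative_Lr r (\<lambda>w. lagrangian T C p r U G i f (u(k := w)) v l)
    (\<lambda>h. Lr_pairing (\<lambda>x. 1 / real T * C * p * Lr_norm r (u k) powr (p - r)
        * \<bar>u k x\<bar> powr (r - 1) * sgn (u k x)) h
      - l (k + 1) (deriv_u r G (f k) (u k) (v k) h)) (u k)"
proof -
  have uk: "u k \<in> Lr r" using u k by blast
  have G_der: "has_derivative_Lr r (\<lambda>w. G (f k) w (v k)) (deriv_u r G (f k) (u k) (v k)) (u k)"
    by (intro deriv_u_works diff_u uk)
  have "((\<lambda>z. - l (k + 1) (z - G (f k) (u k) (v k))) has_derivative (\<lambda>z. - l (k + 1) z))
      (at (G (f k) (u k) (v k)))"
    by (auto intro!: derivative_eq_intros)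
  from has_derivative_Lr_compose[OF G_der, OF this]
  have "has_derivative_Lr r (\<lambda>w. - l (k + 1) (G (f k) w (v k) - G (f k) (u k) (v k)))
      (\<lambda>h. - l (k + 1) (deriv_u r G (f k) (u k) (v k) h)) (u k)" .
  from has_derivative_Lr_add[OF Lr_norm_cost_has_derivative[OF uk] this] show ?thesis
    unfolding lagrangian_upd_u[OF k] add_uminus_conv_diff .
qed

lemma lagrangian_has_derivative_v:
  "((\<lambda>w. lagrangian T C p r U G i f u (v(k := w)) l) has_derivative
    (\<lambda>h. 1 / real T * p * norm (v k) powr (p - 2) * (v k \<bullet> h)
      - banach_adjoint (deriv_v G (f k) (u k) (v k)) (l (k + 1)) h)) (at (v k))"
proof -
  have uk: "u k \<in> Lr r" using u k by blast
  have G_der: "((\<lambda>w. G (f k) (u k) w) has_derivative deriv_v G (f k) (u k) (v k)) (at (v k))"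
    by (intro deriv_v_works diff_v uk)
  have "((\<lambda>z. l (k + 1) (z - G (f k) (u k) (v k))) has_derivative (\<lambda>z. l (k + 1) z))
      (at (G (f k) (u k) (v k)))"
    by (auto intro!: derivative_eq_intros)
  from has_derivative_diff[OF norm_cost_has_derivative
      has_derivative_compose[OF G_der, OF this]]
  show ?thesis
    unfolding lagrangian_upd_v[OF k] banach_adjoint_def blinfun_apply_blinfun_compose o_apply .
qed

end

end

end

theorem corollary3:
  fixes p r \<sigma> W \<psi> C \<Delta>t \<tau> :: real and T :: nat
    and f\<^sub>0 :: "'a::euclidean_space \<Rightarrow> real"
    and U :: "'a C10 \<Rightarrow> real" and dU :: "'a C10 \<Rightarrow> 'a C10 \<Rightarrow>\<^sub>L real"
    and emb :: "'v::{real_inner, complete_space} \<Rightarrow> ('a, 'a) bC1"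
    and G :: "'a C10 \<Rightarrow> ('a \<Rightarrow> real) \<Rightarrow> 'v \<Rightarrow> 'a C10" and i :: "'a C10"
    and E :: "(nat \<Rightarrow> 'a \<Rightarrow> real) \<Rightarrow> (nat \<Rightarrow> 'v) \<Rightarrow> real"
    and L :: "(nat \<Rightarrow> 'a C10) \<Rightarrow> (nat \<Rightarrow> 'a \<Rightarrow> real) \<Rightarrow> (nat \<Rightarrow> 'v) \<Rightarrow>
              (nat \<Rightarrow> 'a C10 \<Rightarrow>\<^sub>L real) \<Rightarrow> real"
  assumes "p > 2" and "r > DIM('a) * p / (p - 2)"
    and "\<sigma> > 0" and "W > 0" and "\<psi> > 0" and "C > 0" and "T > 0"
    and "\<Delta>t = 1 / real T" and "\<tau> = \<sigma> * sqrt \<Delta>t"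
    and "bounded_linear emb" and "inj emb"
    and "f\<^sub>0 \<in> Lr (conj_exponent r)"
    and "\<And>h. (U has_derivative blinfun_apply (dU h)) (at h)"
    and "continuous_on UNIV dU" and "bdd_below (range U)"
    and "G = step_map \<tau> W \<psi> emb" and "i = initial_state \<tau> f\<^sub>0"
    and "E = reduced_energy T C p r U G i" and "L = lagrangian T C p r U G i"
  shows
    "(\<forall>f u v l. critical_point T r L f u v l \<longrightarrow> adjoint_system T dU G f u v l) \<and>
     (\<forall>f u v l. (\<forall>k\<in>{1..T-1}. u k \<in> Lr r) \<longrightarrow> f = state G i u v \<longrightarrow>
        adjoint_system T dU G f u v l \<longrightarrow>
        (\<forall>k\<in>{1..T-1}.
           let Du = (\<lambda>h. Lr_pairing (\<lambda>x. \<Delta>t * C * p * Lr_norm r (u k) powr (p - r)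
                               * \<bar>u k x\<bar> powr (r - 1) * sgn (u k x)) h
                        - blinfun_apply (l (k + 1)) (deriv_u r G (f k) (u k) (v k) h));
               Dv = (\<lambda>h. \<Delta>t * p * norm (v k) powr (p - 2) * (v k \<bullet> h)
                        - blinfun_apply (banach_adjoint (deriv_v G (f k) (u k) (v k)) (l (k + 1))) h)
           in has_derivative_Lr r (\<lambda>w. E (u(k := w)) v) Du (u k) \<and>
              has_derivative_Lr r (\<lambda>w. L f (u(k := w)) v l) Du (u k) \<and>
              ((\<lambda>w. E u (v(k := w))) has_derivative Dv) (at (v k)) \<and>
              ((\<lambda>w. L f u (v(k := w)) l) has_derivative Dv) (at (v k))))"
proof -
  have p: "p > 2" and T: "T > 0" and \<psi>: "\<psi> > 0" and emb: "bounded_linear emb"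
    and dU: "\<And>h. (U has_derivative blinfun_apply (dU h)) (at h)"
    by fact+
  have \<tau>: "\<tau> > 0" using assms(3,7-9) by simp
  \<comment> \<open>The dimension is at least 1 and p >= p - 2, so the lower bound on r is at least
    1.\<close>
  have "1 * p \<le> DIM('a) * p" using p by (intro mult_right_mono) (auto simp: Suc_le_eq)
  then have "p - 2 \<le> DIM('a) * p" by linarith
  then have "1 \<le> DIM('a) * p / (p - 2)" using p by simp
  then have r: "r > 1" using assms(2) by linarith
  have diff_f: "(\<lambda>g. G g u v) differentiable (at f)" if "u \<in> Lr r" for f u v
    unfolding \<open>G = _\<close> by (rule step_map_differentiable_f[OF \<tau> r \<psi> emb that])
  have diff_u: "\<exists>D. has_derivative_Lr r (\<lambda>w. G f w v) D u" if "u \<in> Lr r" for f u v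
    unfolding \<open>G = _\<close> by (rule step_map_has_derivative_Lr[OF \<tau> r \<psi> emb that])
  have diff_v: "(\<lambda>w. G f u w) differentiable (at v)" if "u \<in> Lr r" for f u v
    unfolding \<open>G = _\<close> by (rule step_map_differentiable_v[OF \<tau> r \<psi> emb that])
  note hyps = diff_f diff_u diff_v p r T dU
  \<comment> \<open>The five goals are the adjoint system and, for each of E and L, the derivatives
    in u_k and v_k; each is an instance of one of the five rules.\<close>
  show ?thesis
    unfolding Let_def \<open>E = _\<close> \<open>L = _\<close> \<open>\<Delta>t = _\<close>
    by (intro conjI allI impI ballI;
        rule critical_point_imp_adjoint_system[OF hyps]
          reduced_energy_has_derivative_u[OF hyps] lagrangian_has_derivative_u[OF hyps]
          reduced_energy_has_derivative_v[OF hyps] lagrangian_has_derivative_v[OF hyps];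
        assumption)
qed

end
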